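(* Let $M$ be a Lorentzian $n$-manifold, and let $\mathcal{C}$ be the category whose objects are the open subsets of $M$ that are diffeomorphic to $\mathbb{R}^n$ and whose morphisms are the canonical inclusions $U\hookrightarrow V$ whenever $U\subset V$, equipped with the Grothendieck topology given by good open covers. Then the presheaf of groupoids $$\mathcal{E}:\mathcal{C}^{op}\longrightarrow Grpds,\qquad U\mapsto \mathcal{E}(U),$$ is a stack on $\mathcal{C}$ (the stack of Ricci-flat Lorentzian metrics), where the objects of $\mathcal{E}(U)$ form the set of Ricci-flat Lorentzian metrics $$Ob(\mathcal{E}(U))=\{\, g\in \Gamma(Sym^2(T^*U)) : Ric(g)=0\,\},$$ and a morphism $g\to g'$ in $\mathcal{E}(U)$ is determined by an automorphism $\varphi$ of the bundle $Sym^2(T^*U)$ with $g'=g\cdot\varphi$ (as specified in the context).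
   Context: $Grpds$ is the 2-category of groupoids. Topology on $\mathcal{C}$: a covering family of $U$ is a good open cover $\{U_i\subseteq U\}$, i.e. an open cover by objects of $\mathcal{C}$ such that every finite intersection $U_{i_1\dots i_m}=U_{i_1}\cap\dots\cap U_{i_m}$ is either empty or diffeomorphic to $\mathbb{R}^n$ (empty intersections contribute a trivial, one-morphism, factor to products). The presheaf $\mathcal{E}$: (1) Objects of $\mathcal{E}(U)$ are the Lorentzian metrics $g$ on $U$, viewed as sections of $Sym^2(T^*U)$, with $Ric(g)=0$. (2) $Aut(Sym^2(T^*U))$ denotes the group of smooth vector bundle automorphisms of $Sym^2(T^*U)$ covering $\mathrm{id}_U$. Such a $\varphi$ acts fiberwise on sections: $(g\cdot\varphi)_p=\varphi_p(g_p)$ for $p\in U$. The morphisms are $$Hom_{\mathcal{E}(U)}(g,g')=\{\varphi\in Aut(Sym^2(T^*U)) : g'=g\cdot\varphi\},$$ where the action is required to be that of an infinitesimal diffeomorphism: there is $\hat\varphi\in L(U)$ with $g'=g+\hat\varphi(g)$. Here $L(U)$ is the algebra over $C^\infty(U)$ of operators on sections of $Sym^2(T^*U)$ generated (under $C^\infty(U)$-linear combinations and composition) by the Lie derivatives $\mathcal{L}_X$, $X\in\Gamma(TU)$. Composition is composition of automorphisms: $g\cdot(\varphi\circ\psi)=(g\cdot\psi)\cdot\varphi$. (3) For an inclusion $f:U\hookrightarrow V$, the functor $\mathcal{E}(f):\mathcal{E}(V)\to\mathcal{E}(U)$ is restriction: $g\mapsto g|_U$, $\varphi\mapsto\varphi|_U$.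 Stack: a presheaf of groupoids $\mathcal{X}:\mathcal{C}^{op}\to Grpds$ is a stack if for every object $U$ and every covering family $\{U_i\to U\}$ the canonical functor $\mathcal{X}(U)\to holim_{Grpds}(\mathcal{X}(U_\bullet))$ is a weak equivalence, i.e. fully faithful and essentially surjective, where $\mathcal{X}(U_\bullet)$ is the cosimplicial diagram $\prod_i\mathcal{X}(U_i)\rightrightarrows\prod_{ij}\mathcal{X}(U_{ij})\cdots$. Its homotopy limit is the descent groupoid: objects are pairs $(\{x_i\},\{h_{ij}\})$ with $x_i\in\mathcal{X}(U_i)$ and morphisms $h_{ij}:x_i|_{U_{ij}}\to x_j|_{U_{ij}}$ in $\mathcal{X}(U_{ij})$ such that $h_{ii}=\mathrm{id}$ and $h_{jk}\circ h_{ij}=h_{ik}$ on $U_{ijk}$; morphisms $(\{x_i\},\{h_{ij}\})\to(\{x_i'\},\{h_{ij}'\})$ are families $f_i:x_i\to x_i'$ in $\mathcal{X}(U_i)$ with $h_{ij}'\circ f_i|_{U_{ij}}=f_j|_{U_{ij}}\circ h_{ij}$. The canonical functor sends $x$ to $(\{x|_{U_i}\},\{\mathrm{id}\})$ and $f$ to $\{f|_{U_i}\}$. *)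

theory Defs
  imports "HOL-Analysis.Analysis"
begin

section \<open>Smooth maps between open subsets of Euclidean spaces\<close>

primrec Ck_on :: "nat \<Rightarrow> 'v::real_normed_vector set \<Rightarrow> ('v \<Rightarrow> 'w::real_normed_vector) \<Rightarrow> bool" where
  "Ck_on 0 S f \<longleftrightarrow> continuous_on S f"
| "Ck_on (Suc k) S f \<longleftrightarrow>
     (\<forall>x\<in>S. f differentiable at x) \<and> (\<forall>v. Ck_on k S (\<lambda>x. frechet_derivative f (at x) v))"

text \<open>The derivatives are taken at interior points, so this is meant for open sets only.\<close>

definition smooth_on :: "'v::real_normed_vector set \<Rightarrow> ('v \<Rightarrow> 'w::real_normed_vector) \<Rightarrow> bool" where
  "smooth_on S f \<longleftrightarrow> (\<forall>k. Ck_on k S f)"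

definition partial :: "'n \<Rightarrow> (real^'n \<Rightarrow> real) \<Rightarrow> real^'n \<Rightarrow> real" where
  "partial k f x = frechet_derivative f (at x) (axis k 1)"

section \<open>Smooth manifolds\<close>

text \<open>A chart is a pair of its domain and its coordinate map; the values of the coordinate map
  outside the domain are irrelevant. The dimension is \<open>CARD('n)\<close>.\<close>

type_synonym ('a, 'n) chart = "'a set \<times> ('a \<Rightarrow> real^'n)"

definition chart_inv :: "('a, 'n::finite) chart \<Rightarrow> real^'n \<Rightarrow> 'a" where
  "chart_inv c = inv_into (fst c) (snd c)"

text \<open>Hausdorffness and second countability of \<open>M\<close> come from the type class of \<open>'a\<close>.\<close>

definition smooth_manifold ::
  "'a::{t2_space, second_countable_topology} set \<Rightarrow> ('a, 'n::finite) chart set \<Rightarrow> bool" where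
  "smooth_manifold M A \<longleftrightarrow>
     (\<Union>c\<in>A. fst c) = M \<and>
     (\<forall>c\<in>A. open (fst c) \<and> open (snd c ` fst c) \<and>
        homeomorphism (fst c) (snd c ` fst c) (snd c) (chart_inv c)) \<and>
     (\<forall>c\<in>A. \<forall>d\<in>A. smooth_on (snd c ` (fst c \<inter> fst d)) (snd d \<circ> chart_inv c))"

definition charts_at :: "('a, 'n::finite) chart set \<Rightarrow> 'a \<Rightarrow> ('a, 'n) chart set" where
  "charts_at A p = {c\<in>A. p \<in> fst c}"

definition diffeomorphic_Rn ::
  "('a::topological_space, 'n::finite) chart set \<Rightarrow> 'a set \<Rightarrow> bool" where
  "diffeomorphic_Rn A U \<longleftrightarrow>
     (\<exists>f :: 'a \<Rightarrow> real^'n. homeomorphism U UNIV f (inv_into U f) \<and>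
        (\<forall>c\<in>A. smooth_on (snd c ` (fst c \<inter> U)) (f \<circ> chart_inv c) \<and>
               smooth_on (f ` (fst c \<inter> U)) (snd c \<circ> inv_into U f)))"

definition smooth_fun :: "('a, 'n::finite) chart set \<Rightarrow> 'a set \<Rightarrow> ('a \<Rightarrow> real) \<Rightarrow> bool" where
  "smooth_fun A U f \<longleftrightarrow> (\<forall>c\<in>A. smooth_on (snd c ` (fst c \<inter> U)) (f \<circ> chart_inv c))"

section \<open>The bundles \<open>TM\<close> and \<open>Sym\<^sup>2(T\<^sup>*M)\<close>\<close>

text \<open>Both bundles are built from their transition cocycles: a (co)tensor at \<open>p\<close> is the family of its
  components with respect to all charts around \<open>p\<close>, subject to the tensor transformation law.
  Components for charts that do not contain \<open>p\<close> are set to 0, so that equality of families is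
  equality of tensors and the vector space operations are pointwise.
  For open \<open>U \<subseteq> M\<close> the fibres of \<open>Sym\<^sup>2(T\<^sup>*U)\<close> are those of \<open>Sym\<^sup>2(T\<^sup>*M)\<close> over points of \<open>U\<close>.\<close>

type_synonym ('a, 'n) tvec = "('a, 'n) chart \<Rightarrow> real^'n"
type_synonym ('a, 'n) form = "('a, 'n) chart \<Rightarrow> real^'n^'n"

definition jac :: "('a, 'n::finite) chart \<Rightarrow> ('a, 'n) chart \<Rightarrow> 'a \<Rightarrow> real^'n^'n" where
  "jac c d p = matrix (frechet_derivative (snd d \<circ> chart_inv c) (at (snd c p)))"

definition tangent :: "('a, 'n::finite) chart set \<Rightarrow> 'a \<Rightarrow> ('a, 'n) tvec set" where
  "tangent A p = {v. (\<forall>c. c \<notin> charts_at A p \<longrightarrow> v c = 0) \<and>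
     (\<forall>c\<in>charts_at A p. \<forall>d\<in>charts_at A p. v d = jac c d p *v v c)}"

definition sym2 :: "('a, 'n::finite) chart set \<Rightarrow> 'a \<Rightarrow> ('a, 'n) form set" where
  "sym2 A p = {t. (\<forall>c. c \<notin> charts_at A p \<longrightarrow> t c = 0) \<and>
     (\<forall>c\<in>charts_at A p. transpose (t c) = t c) \<and>
     (\<forall>c\<in>charts_at A p. \<forall>d\<in>charts_at A p. t c = transpose (jac c d p) ** t d ** jac c d p)}"

text \<open>The inverse of the local trivialization \<open>t \<mapsto> t c\<close> of \<open>Sym\<^sup>2(T\<^sup>*M)\<close> given by a chart \<open>c\<close>.\<close>

definition form_of ::
  "('a, 'n::finite) chart set \<Rightarrow> ('a, 'n) chart \<Rightarrow> 'a \<Rightarrow> real^'n^'n \<Rightarrow> ('a, 'n) form" where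
  "form_of A c p S =
     (\<lambda>d. if d \<in> charts_at A p then transpose (jac d c p) ** S ** jac d c p else 0)"

definition vector_fields ::
  "('a, 'n::finite) chart set \<Rightarrow> 'a set \<Rightarrow> ('a \<Rightarrow> ('a, 'n) tvec) set" where
  "vector_fields A U = {X \<in> (\<Pi>\<^sub>E p\<in>U. tangent A p).
     \<forall>c\<in>A. smooth_on (snd c ` (fst c \<inter> U)) (\<lambda>x. X (chart_inv c x) c)}"

definition sections ::
  "('a, 'n::finite) chart set \<Rightarrow> 'a set \<Rightarrow> ('a \<Rightarrow> ('a, 'n) form) set" where
  "sections A U = {h \<in> (\<Pi>\<^sub>E p\<in>U. sym2 A p).
     \<forall>c\<in>A. smooth_on (snd c ` (fst c \<inter> U)) (\<lambda>x. h (chart_inv c x) c)}"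

text \<open>Smooth vector bundle endomorphisms of \<open>Sym\<^sup>2(T\<^sup>*U)\<close> over the identity of \<open>U\<close>. Since they
  are fibrewise linear, smoothness in a local trivialization is smoothness of the images of all
  constant sections of the trivialization.\<close>

definition bundle_endos ::
  "('a, 'n::finite) chart set \<Rightarrow> 'a set \<Rightarrow> ('a \<Rightarrow> ('a, 'n) form \<Rightarrow> ('a, 'n) form) set" where
  "bundle_endos A U = {\<phi> \<in> (\<Pi>\<^sub>E p\<in>U. sym2 A p \<rightarrow>\<^sub>E sym2 A p).
     (\<forall>p\<in>U. \<forall>s\<in>sym2 A p. \<forall>t\<in>sym2 A p. \<forall>a b :: real.
        \<phi> p (\<lambda>c. a *\<^sub>R s c + b *\<^sub>R t c) = (\<lambda>c. a *\<^sub>R \<phi> p s c + b *\<^sub>R \<phi> p t c)) \<and>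
     (\<forall>c\<in>A. \<forall>S. transpose S = S \<longrightarrow>
        smooth_on (snd c ` (fst c \<inter> U))
          (\<lambda>x. \<phi> (chart_inv c x) (form_of A c (chart_inv c x) S) c))}"

definition bundle_comp ::
  "('a, 'n::finite) chart set \<Rightarrow> 'a set \<Rightarrow> ('a \<Rightarrow> ('a, 'n) form \<Rightarrow> ('a, 'n) form) \<Rightarrow>
   ('a \<Rightarrow> ('a, 'n) form \<Rightarrow> ('a, 'n) form) \<Rightarrow> 'a \<Rightarrow> ('a, 'n) form \<Rightarrow> ('a, 'n) form" where
  "bundle_comp A U \<phi> \<psi> = (\<lambda>p\<in>U. compose (sym2 A p) (\<phi> p) (\<psi> p))"

definition bundle_id ::
  "('a, 'n::finite) chart set \<Rightarrow> 'a set \<Rightarrow> 'a \<Rightarrow> ('a, 'n) form \<Rightarrow> ('a, 'n) form" where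
  "bundle_id A U = (\<lambda>p\<in>U. \<lambda>t\<in>sym2 A p. t)"

definition bundle_auts ::
  "('a, 'n::finite) chart set \<Rightarrow> 'a set \<Rightarrow> ('a \<Rightarrow> ('a, 'n) form \<Rightarrow> ('a, 'n) form) set" where
  "bundle_auts A U = {\<phi> \<in> bundle_endos A U. \<exists>\<psi>\<in>bundle_endos A U.
     bundle_comp A U \<psi> \<phi> = bundle_id A U \<and> bundle_comp A U \<phi> \<psi> = bundle_id A U}"

definition act ::
  "'a set \<Rightarrow> ('a \<Rightarrow> ('a, 'n) form) \<Rightarrow> ('a \<Rightarrow> ('a, 'n) form \<Rightarrow> ('a, 'n) form) \<Rightarrow> 'a \<Rightarrow> ('a, 'n) form"
  where "act U g \<phi> = (\<lambda>p\<in>U. \<phi> p (g p))"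

section \<open>Lie derivatives and the algebra \<open>L(U)\<close>\<close>

text \<open>In coordinates,
  \<open>(L\<^sub>X h)\<^sub>i\<^sub>j = X\<^sup>k \<partial>\<^sub>k h\<^sub>i\<^sub>j + h\<^sub>k\<^sub>j \<partial>\<^sub>i X\<^sup>k + h\<^sub>i\<^sub>k \<partial>\<^sub>j X\<^sup>k\<close>.\<close>

definition lie_coord ::
  "(real^'n \<Rightarrow> real^'n) \<Rightarrow> (real^'n \<Rightarrow> real^'n^'n) \<Rightarrow> real^'n \<Rightarrow> real^'n^'n::finite" where
  "lie_coord Y H x = (\<chi> i j. \<Sum>k\<in>UNIV.
       Y x $ k * partial k (\<lambda>y. H y $ i $ j) x
     + H x $ k $ j * partial i (\<lambda>y. Y y $ k) x
     + H x $ i $ k * partial j (\<lambda>y. Y y $ k) x)"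

definition lie_derivative ::
  "('a, 'n::finite) chart set \<Rightarrow> 'a set \<Rightarrow> ('a \<Rightarrow> ('a, 'n) tvec) \<Rightarrow>
   ('a \<Rightarrow> ('a, 'n) form) \<Rightarrow> 'a \<Rightarrow> ('a, 'n) form" where
  "lie_derivative A U X h = (\<lambda>p\<in>U. \<lambda>c. if c \<in> charts_at A p
     then lie_coord (\<lambda>x. X (chart_inv c x) c) (\<lambda>x. h (chart_inv c x) c) (snd c p) else 0)"

definition sec_add ::
  "'a set \<Rightarrow> ('a \<Rightarrow> ('a, 'n::finite) form) \<Rightarrow> ('a \<Rightarrow> ('a, 'n) form) \<Rightarrow> 'a \<Rightarrow> ('a, 'n) form" where
  "sec_add U s t = (\<lambda>p\<in>U. \<lambda>c. s p c + t p c)"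

definition sec_smult ::
  "'a set \<Rightarrow> ('a \<Rightarrow> real) \<Rightarrow> ('a \<Rightarrow> ('a, 'n::finite) form) \<Rightarrow> 'a \<Rightarrow> ('a, 'n) form" where
  "sec_smult U f s = (\<lambda>p\<in>U. \<lambda>c. f p *\<^sub>R s p c)"

inductive_set lie_algebra_ops ::
  "('a, 'n::finite) chart set \<Rightarrow> 'a set \<Rightarrow> (('a \<Rightarrow> ('a, 'n) form) \<Rightarrow> 'a \<Rightarrow> ('a, 'n) form) set"
  for A U where
  lie: "X \<in> vector_fields A U \<Longrightarrow> lie_derivative A U X \<in> lie_algebra_ops A U"
| add: "\<Phi> \<in> lie_algebra_ops A U \<Longrightarrow> \<Psi> \<in> lie_algebra_ops A U \<Longrightarrow>
    (\<lambda>h. sec_add U (\<Phi> h) (\<Psi> h)) \<in> lie_algebra_ops A U"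
| smult: "smooth_fun A U f \<Longrightarrow> \<Phi> \<in> lie_algebra_ops A U \<Longrightarrow>
    (\<lambda>h. sec_smult U f (\<Phi> h)) \<in> lie_algebra_ops A U"
| comp: "\<Phi> \<in> lie_algebra_ops A U \<Longrightarrow> \<Psi> \<in> lie_algebra_ops A U \<Longrightarrow>
    (\<lambda>h. \<Phi> (\<Psi> h)) \<in> lie_algebra_ops A U"

section \<open>Lorentzian metrics and the Ricci tensor\<close>

text \<open>Signature \<open>(-,+,\<dots>,+)\<close>: the matrix is congruent to \<open>diag(-1,1,\<dots>,1)\<close>, the position of
  the entry \<open>-1\<close> being immaterial.\<close>

definition lorentz_matrix :: "real^'n^'n::finite \<Rightarrow> bool" where
  "lorentz_matrix S \<longleftrightarrow> (\<exists>(P :: real^'n^'n) k. invertible P \<and>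
     transpose P ** S ** P = (\<chi> i j. if i \<noteq> j then 0 else if i = k then -1 else 1))"

definition lorentzian_metrics ::
  "('a, 'n::finite) chart set \<Rightarrow> 'a set \<Rightarrow> ('a \<Rightarrow> ('a, 'n) form) set" where
  "lorentzian_metrics A U =
     {g \<in> sections A U. \<forall>p\<in>U. \<forall>c\<in>charts_at A p. lorentz_matrix (g p c)}"

text \<open>\<open>\<Gamma>\<^sup>k\<^sub>i\<^sub>j = \<onehalf> g\<^sup>k\<^sup>l (\<partial>\<^sub>i g\<^sub>j\<^sub>l + \<partial>\<^sub>j g\<^sub>i\<^sub>l - \<partial>\<^sub>l g\<^sub>i\<^sub>j)\<close> and
  \<open>R\<^sub>i\<^sub>j = \<partial>\<^sub>k \<Gamma>\<^sup>k\<^sub>i\<^sub>j - \<partial>\<^sub>j \<Gamma>\<^sup>k\<^sub>i\<^sub>k + \<Gamma>\<^sup>k\<^sub>k\<^sub>l \<Gamma>\<^sup>l\<^sub>i\<^sub>j - \<Gamma>\<^sup>k\<^sub>j\<^sub>l \<Gamma>\<^sup>l\<^sub>i\<^sub>k\<close>.\<close>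

definition christoffel ::
  "(real^'n \<Rightarrow> real^'n^'n::finite) \<Rightarrow> 'n \<Rightarrow> 'n \<Rightarrow> 'n \<Rightarrow> real^'n \<Rightarrow> real" where
  "christoffel G k i j x = (\<Sum>l\<in>UNIV. matrix_inv (G x) $ k $ l *
     (partial i (\<lambda>y. G y $ j $ l) x + partial j (\<lambda>y. G y $ i $ l) x
      - partial l (\<lambda>y. G y $ i $ j) x)) / 2"

definition ricci_coord :: "(real^'n \<Rightarrow> real^'n^'n) \<Rightarrow> real^'n \<Rightarrow> real^'n^'n::finite" where
  "ricci_coord G x = (\<chi> i j. \<Sum>k\<in>UNIV.
       partial k (christoffel G k i j) x - partial j (christoffel G k i k) x
     + (\<Sum>l\<in>UNIV. christoffel G k k l x * christoffel G l i j x
                - christoffel G k j l x * christoffel G l i k x))"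

definition ricci ::
  "('a, 'n::finite) chart set \<Rightarrow> 'a set \<Rightarrow> ('a \<Rightarrow> ('a, 'n) form) \<Rightarrow> 'a \<Rightarrow> ('a, 'n) form" where
  "ricci A U g = (\<lambda>p\<in>U. \<lambda>c. if c \<in> charts_at A p
     then ricci_coord (\<lambda>x. g (chart_inv c x) c) (snd c p) else 0)"

section \<open>Groupoids, presheaves of groupoids and stacks\<close>

text \<open>\<open>Cmp G g f\<close> is the composite \<open>g \<circ> f\<close>.\<close>

record ('o, 'm) grpd =
  Obj :: "'o set"
  Hom :: "'o \<Rightarrow> 'o \<Rightarrow> 'm set"
  Cmp :: "'m \<Rightarrow> 'm \<Rightarrow> 'm"
  Idn :: "'o \<Rightarrow> 'm"

definition groupoid :: "('o, 'm) grpd \<Rightarrow> bool" where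
  "groupoid G \<longleftrightarrow>
     (\<forall>x\<in>Obj G. Idn G x \<in> Hom G x x) \<and>
     (\<forall>x\<in>Obj G. \<forall>y\<in>Obj G. \<forall>z\<in>Obj G. \<forall>f\<in>Hom G x y. \<forall>g\<in>Hom G y z. Cmp G g f \<in> Hom G x z) \<and>
     (\<forall>x\<in>Obj G. \<forall>y\<in>Obj G. \<forall>f\<in>Hom G x y. Cmp G f (Idn G x) = f \<and> Cmp G (Idn G y) f = f) \<and>
     (\<forall>w\<in>Obj G. \<forall>x\<in>Obj G. \<forall>y\<in>Obj G. \<forall>z\<in>Obj G. \<forall>f\<in>Hom G w x. \<forall>g\<in>Hom G x y. \<forall>h\<in>Hom G y z.
        Cmp G h (Cmp G g f) = Cmp G (Cmp G h g) f) \<and>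
     (\<forall>x\<in>Obj G. \<forall>y\<in>Obj G. \<forall>f\<in>Hom G x y. \<exists>g\<in>Hom G y x.
        Cmp G g f = Idn G x \<and> Cmp G f g = Idn G y)"

definition grpd_functor ::
  "('o, 'm) grpd \<Rightarrow> ('p, 'q) grpd \<Rightarrow> ('o \<Rightarrow> 'p) \<Rightarrow> ('m \<Rightarrow> 'q) \<Rightarrow> bool" where
  "grpd_functor G H Fo Fm \<longleftrightarrow>
     (\<forall>x\<in>Obj G. Fo x \<in> Obj H) \<and>
     (\<forall>x\<in>Obj G. \<forall>y\<in>Obj G. \<forall>f\<in>Hom G x y. Fm f \<in> Hom H (Fo x) (Fo y)) \<and>
     (\<forall>x\<in>Obj G. Fm (Idn G x) = Idn H (Fo x)) \<and>
     (\<forall>x\<in>Obj G. \<forall>y\<in>Obj G. \<forall>z\<in>Obj G. \<forall>f\<in>Hom G x y. \<forall>g\<in>Hom G y z.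
        Fm (Cmp G g f) = Cmp H (Fm g) (Fm f))"

text \<open>Fully faithful and essentially surjective; every morphism of a groupoid is invertible.\<close>

definition weak_equivalence ::
  "('o, 'm) grpd \<Rightarrow> ('p, 'q) grpd \<Rightarrow> ('o \<Rightarrow> 'p) \<Rightarrow> ('m \<Rightarrow> 'q) \<Rightarrow> bool" where
  "weak_equivalence G H Fo Fm \<longleftrightarrow>
     grpd_functor G H Fo Fm \<and>
     (\<forall>x\<in>Obj G. \<forall>y\<in>Obj G. bij_betw Fm (Hom G x y) (Hom H (Fo x) (Fo y))) \<and>
     (\<forall>z\<in>Obj H. \<exists>x\<in>Obj G. Hom H (Fo x) z \<noteq> {})"

text \<open>Presheaves on a category of subsets of \<open>'a\<close> and inclusions; \<open>res_ob X V U\<close> and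
  \<open>res_mor X V U\<close> are the two components of the restriction functor \<open>X(V) \<rightarrow> X(U)\<close> for \<open>U \<subseteq> V\<close>.\<close>

record ('a, 'o, 'm) psh =
  grpd_on :: "'a set \<Rightarrow> ('o, 'm) grpd"
  res_ob :: "'a set \<Rightarrow> 'a set \<Rightarrow> 'o \<Rightarrow> 'o"
  res_mor :: "'a set \<Rightarrow> 'a set \<Rightarrow> 'm \<Rightarrow> 'm"

definition presheaf_of_groupoids :: "'a set set \<Rightarrow> ('a, 'o, 'm) psh \<Rightarrow> bool" where
  "presheaf_of_groupoids C X \<longleftrightarrow>
     (\<forall>U\<in>C. groupoid (grpd_on X U)) \<and>
     (\<forall>V\<in>C. \<forall>U\<in>C. U \<subseteq> V \<longrightarrow>
        grpd_functor (grpd_on X V) (grpd_on X U) (res_ob X V U) (res_mor X V U)) \<and>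
     (\<forall>U\<in>C. \<forall>x\<in>Obj (grpd_on X U). res_ob X U U x = x \<and>
        (\<forall>y\<in>Obj (grpd_on X U). \<forall>f\<in>Hom (grpd_on X U) x y. res_mor X U U f = f)) \<and>
     (\<forall>W\<in>C. \<forall>V\<in>C. \<forall>U\<in>C. U \<subseteq> V \<and> V \<subseteq> W \<longrightarrow> (\<forall>x\<in>Obj (grpd_on X W).
        res_ob X V U (res_ob X W V x) = res_ob X W U x \<and>
        (\<forall>y\<in>Obj (grpd_on X W). \<forall>f\<in>Hom (grpd_on X W) x y.
           res_mor X V U (res_mor X W V f) = res_mor X W U f)))"

text \<open>The descent groupoid of a family \<open>(U\<^sub>i)\<^sub>i\<^sub>\<in>\<^sub>I\<close>. Empty overlaps contribute trivial factors,
  hence \<open>h\<^sub>i\<^sub>j\<close> is recorded, and conditions are imposed, on nonempty overlaps only.\<close>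

definition overlaps :: "'i set \<Rightarrow> ('i \<Rightarrow> 'a set) \<Rightarrow> ('i \<times> 'i) set" where
  "overlaps I U = {(i, j). i \<in> I \<and> j \<in> I \<and> U i \<inter> U j \<noteq> {}}"

definition descent ::
  "('a, 'o, 'm) psh \<Rightarrow> 'i set \<Rightarrow> ('i \<Rightarrow> 'a set) \<Rightarrow>
   (('i \<Rightarrow> 'o) \<times> ('i \<times> 'i \<Rightarrow> 'm), 'i \<Rightarrow> 'm) grpd" where
  "descent X I U = \<lparr>
     Obj = {(x, h).
       x \<in> (\<Pi>\<^sub>E i\<in>I. Obj (grpd_on X (U i))) \<and>
       h \<in> (\<Pi>\<^sub>E (i, j)\<in>overlaps I U. Hom (grpd_on X (U i \<inter> U j))
              (res_ob X (U i) (U i \<inter> U j) (x i)) (res_ob X (U j) (U i \<inter> U j) (x j))) \<and>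
       (\<forall>i\<in>I. h (i, i) = Idn (grpd_on X (U i)) (x i)) \<and>
       (\<forall>i\<in>I. \<forall>j\<in>I. \<forall>k\<in>I. let W = U i \<inter> U j \<inter> U k in W \<noteq> {} \<longrightarrow>
          Cmp (grpd_on X W) (res_mor X (U j \<inter> U k) W (h (j, k))) (res_mor X (U i \<inter> U j) W (h (i, j)))
            = res_mor X (U i \<inter> U k) W (h (i, k)))},
     Hom = (\<lambda>(x, h) (x', h'). {f \<in> (\<Pi>\<^sub>E i\<in>I. Hom (grpd_on X (U i)) (x i) (x' i)).
       \<forall>(i, j)\<in>overlaps I U. let W = U i \<inter> U j in
          Cmp (grpd_on X W) (h' (i, j)) (res_mor X (U i) W (f i))
            = Cmp (grpd_on X W) (res_mor X (U j) W (f j)) (h (i, j))}),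
     Cmp = (\<lambda>f' f. \<lambda>i\<in>I. Cmp (grpd_on X (U i)) (f' i) (f i)),
     Idn = (\<lambda>(x, h). \<lambda>i\<in>I. Idn (grpd_on X (U i)) (x i)) \<rparr>"

definition canonical_ob ::
  "('a, 'o, 'm) psh \<Rightarrow> 'a set \<Rightarrow> 'i set \<Rightarrow> ('i \<Rightarrow> 'a set) \<Rightarrow> 'o \<Rightarrow>
   ('i \<Rightarrow> 'o) \<times> ('i \<times> 'i \<Rightarrow> 'm)" where
  "canonical_ob X V I U x = (\<lambda>i\<in>I. res_ob X V (U i) x,
     \<lambda>(i, j)\<in>overlaps I U. Idn (grpd_on X (U i \<inter> U j)) (res_ob X V (U i \<inter> U j) x))"

definition canonical_mor ::
  "('a, 'o, 'm) psh \<Rightarrow> 'a set \<Rightarrow> 'i set \<Rightarrow> ('i \<Rightarrow> 'a set) \<Rightarrow> 'm \<Rightarrow> 'i \<Rightarrow> 'm" where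
  "canonical_mor X V I U f = (\<lambda>i\<in>I. res_mor X V (U i) f)"

text \<open>\<open>Cov V I U\<close> says that \<open>(U\<^sub>i)\<^sub>i\<^sub>\<in>\<^sub>I\<close> is a covering family of \<open>V\<close>.\<close>

definition stack ::
  "'a set set \<Rightarrow> ('a set \<Rightarrow> 'i set \<Rightarrow> ('i \<Rightarrow> 'a set) \<Rightarrow> bool) \<Rightarrow> ('a, 'o, 'm) psh \<Rightarrow> bool" where
  "stack C Cov X \<longleftrightarrow> presheaf_of_groupoids C X \<and>
     (\<forall>V\<in>C. \<forall>I U. Cov V I U \<longrightarrow>
        weak_equivalence (grpd_on X V) (descent X I U)
          (canonical_ob X V I U) (canonical_mor X V I U))"

section \<open>The site and the presheaf of Ricci-flat Lorentzian metrics\<close>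

definition disks ::
  "'a::{t2_space, second_countable_topology} set \<Rightarrow> ('a, 'n::finite) chart set \<Rightarrow> 'a set set" where
  "disks M A = {U. open U \<and> U \<subseteq> M \<and> diffeomorphic_Rn A U}"

definition good_cover ::
  "'a::{t2_space, second_countable_topology} set \<Rightarrow> ('a, 'n::finite) chart set \<Rightarrow>
   'a set \<Rightarrow> 'i set \<Rightarrow> ('i \<Rightarrow> 'a set) \<Rightarrow> bool" where
  "good_cover M A V I U \<longleftrightarrow> (\<forall>i\<in>I. U i \<in> disks M A) \<and> (\<Union>i\<in>I. U i) = V \<and>
     (\<forall>F. F \<subseteq> I \<and> finite F \<and> F \<noteq> {} \<longrightarrow> (\<Inter>i\<in>F. U i) = {} \<or> diffeomorphic_Rn A (\<Inter>i\<in>F. U i))"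

definition ricci_flat_metrics ::
  "('a, 'n::finite) chart set \<Rightarrow> 'a set \<Rightarrow> ('a \<Rightarrow> ('a, 'n) form) set" where
  "ricci_flat_metrics A U = {g \<in> lorentzian_metrics A U. ricci A U g = (\<lambda>p\<in>U. \<lambda>c. 0)}"

definition ricci_flat_groupoid ::
  "('a, 'n::finite) chart set \<Rightarrow> 'a set \<Rightarrow>
   ('a \<Rightarrow> ('a, 'n) form, 'a \<Rightarrow> ('a, 'n) form \<Rightarrow> ('a, 'n) form) grpd" where
  "ricci_flat_groupoid A U = \<lparr>
     Obj = ricci_flat_metrics A U,
     Hom = (\<lambda>g g'. {\<phi> \<in> bundle_auts A U. g' = act U g \<phi> \<and>
       (\<exists>\<Phi>\<in>lie_algebra_ops A U. g' = sec_add U g (\<Phi> g))}),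
     Cmp = bundle_comp A U,
     Idn = (\<lambda>g. bundle_id A U) \<rparr>"

definition ricci_flat_psh ::
  "('a, 'n::finite) chart set \<Rightarrow>
   ('a, 'a \<Rightarrow> ('a, 'n) form, 'a \<Rightarrow> ('a, 'n) form \<Rightarrow> ('a, 'n) form) psh" where
  "ricci_flat_psh A = \<lparr>
     grpd_on = ricci_flat_groupoid A,
     res_ob = (\<lambda>V U g. restrict g U),
     res_mor = (\<lambda>V U \<phi>. restrict \<phi> U) \<rparr>"

end

theory Submission
  imports Defs
begin

text \<open>On a disk the infinitesimality condition on morphisms is vacuous: \<open>L\<^bsub>uX\<^esub> - u L\<^sub>X\<close> is the
  zero-order operator \<open>h \<mapsto> du \<otimes> h(X,-) + h(X,-) \<otimes> du\<close>, and such operators, taken for coordinate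
  functions and coordinate fields, generate enough endomorphisms of \<open>Sym\<^sup>2(T\<^sup>*U)\<close> to carry a nowhere
  vanishing section to any section. So a morphism \<open>g \<rightarrow> g'\<close> is just a bundle automorphism with
  \<open>g' = g \<cdot> \<phi>\<close>, and full faithfulness is the gluing of automorphisms.

  For essential surjectivity, a descent datum glues the bundles \<open>Sym\<^sup>2(T\<^sup>*U\<^sub>i)\<close> to a vector bundle with a
  nowhere vanishing section \<open>(g\<^sub>i)\<close>. Over a disk this pair is isomorphic to \<open>Sym\<^sup>2(T\<^sup>*V)\<close> with any
  prescribed nowhere vanishing section; the flat metric of global coordinates is chosen, since it is
  Ricci-flat. The isomorphism exists locally, and two local ones differ by a map into the stabilizer
  of the flat metric, a fixed group because the flat metric is constant in the coordinates. Hence the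
  difference can be pulled back along self-maps of \<open>\<real>\<^sup>n\<close> that are the identity on a smaller box,
  which permits gluing first over boxes and then over an exhaustion by cubes.\<close>

subsection \<open>Calculus of smooth maps\<close>

text \<open>The gluing maps \<open>h\<close> are mere bundle automorphisms. The metrics of a descent
  datum therefore need not patch to a metric on \<open>V\<close>, and transporting a metric by an
  automorphism destroys Ricci-flatness in general. So the target metric is fixed beforehand and the
  automorphisms are adjusted to it, which is possible because a linear automorphism joins any two
  nonzero forms and a Lorentzian form is nonzero. Automorphisms cannot be averaged with a partition
  of unity, since a convex combination of invertible maps need not be invertible. Pulling back along
  a self-map of \<real>^n avoids this: the cut-off functions act on the base and never on the
  fibres. The zero-order operators suffice for the following reason. For coordinates u_i and
  coordinate fields X_j, two of them compose, up to a multiple of a single one, to h -> h(X_j, X_l)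
  (du_i du_k + du_k du_i). Weighting these by the coefficients of h itself, divided by the sum of
  their squares, gives an operator with value du_i du_k + du_k du_i at h, and such forms span. The
  division is where nonvanishing enters.\<close>

lemma Ck_on_subset: "Ck_on k S f \<Longrightarrow> T \<subseteq> S \<Longrightarrow> Ck_on k T f"
  by (induction k arbitrary: f) (auto intro: continuous_on_subset)

text \<open>The derivatives are taken \<open>at x\<close> and not within the set, so they are the
  same functions for \<open>S\<close> and for \<open>T\<close>, and only continuity has to be
  localized.\<close>

lemma Ck_on_local:
  assumes "\<And>x. x \<in> S \<Longrightarrow> \<exists>T. open T \<and> x \<in> T \<and> Ck_on k T f"
  shows "Ck_on k S f"
  using assms
proof (induction k arbitrary: f)
  case 0
  then show ?case
    by (metis Ck_on.simps(1) continuous_at_imp_continuous_on continuous_on_eq_continuous_at)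
next
  case (Suc k)
  then show ?case by (metis Ck_on.simps(2))
qed

lemma Ck_on_cong:
  assumes "open S" "\<And>x. x \<in> S \<Longrightarrow> f x = g x" "Ck_on k S f"
  shows "Ck_on k S g"
  using assms(2,3)
proof (induction k arbitrary: f g)
  case 0
  then show ?case by (metis Ck_on.simps(1) continuous_on_cong)
next
  case (Suc k)
  have d: "(g has_derivative frechet_derivative f (at x)) (at x)" if "x \<in> S" for x
    using Suc.prems that assms(1)
    by (meson Ck_on.simps(2) frechet_derivative_works has_derivative_transform_within_open)
  moreover have "frechet_derivative g (at x) = frechet_derivative f (at x)" if "x \<in> S" for x
    using d[OF that] frechet_derivative_at by metis
  ultimately show ?case
    using Suc.prems Suc.IH[of "\<lambda>x. frechet_derivative f (at x) _" "\<lambda>x. frechet_derivative g (at x) _"]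
    unfolding Ck_on.simps differentiable_def by metis
qed

text \<open>Replaces \<open>frechet_derivative\<close> by a derivative in closed form, to which the
  induction hypotheses of the following closure lemmas apply.\<close>

lemma Ck_on_SucI:
  assumes "open S" "\<And>x. x \<in> S \<Longrightarrow> (f has_derivative f' x) (at x)" "\<And>v. Ck_on k S (\<lambda>x. f' x v)"
  shows "Ck_on (Suc k) S f"
proof -
  have "frechet_derivative f (at x) = f' x" if "x \<in> S" for x
    using assms(2)[OF that] frechet_derivative_at by metis
  then have "Ck_on k S (\<lambda>x. frechet_derivative f (at x) v)" for v
    by (intro Ck_on_cong[OF assms(1) _ assms(3)[of v]]) simp
  then show ?thesis using assms(2) by (auto simp: differentiable_def)
qed

lemma Ck_on_SucD:
  assumes "Ck_on (Suc k) S f"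
  shows "x \<in> S \<Longrightarrow> (f has_derivative frechet_derivative f (at x)) (at x)"
    and "Ck_on k S (\<lambda>x. frechet_derivative f (at x) v)"
  using assms frechet_derivative_works by auto

text \<open>\<open>Ck_on (Suc k)\<close> does not mention \<open>Ck_on k\<close> of \<open>f\<close>
  itself, hence the separate induction. The product and chain rules need it for the factor that is
  left undifferentiated.\<close>

lemma Ck_on_Suc_imp: "Ck_on (Suc k) S f \<Longrightarrow> Ck_on k S f"
proof (induction k arbitrary: f)
  case 0
  then show ?case
    by (auto intro!: continuous_at_imp_continuous_on differentiable_imp_continuous_within)
next
  case (Suc k)
  have "Ck_on k S (\<lambda>x. frechet_derivative f (at x) v)" for v
    by (rule Suc.IH[OF Ck_on_SucD(2)[OF Suc.prems]])
  moreover have "\<forall>x\<in>S. f differentiable at x"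
    using Ck_on_SucD(1)[OF Suc.prems] by (auto simp: differentiable_def)
  ultimately show ?case by simp
qed

lemma Ck_on_const: "Ck_on k S (\<lambda>x. c)"
  by (induction k arbitrary: c) auto

lemma Ck_on_linear:
  assumes "bounded_linear L" "open S"
  shows "Ck_on k S f \<Longrightarrow> Ck_on k S (\<lambda>x. L (f x))"
proof (induction k arbitrary: f)
  case 0
  then show ?case by (auto intro: bounded_linear.continuous_on[OF assms(1)])
next
  case (Suc k)
  show ?case
    by (rule Ck_on_SucI[OF assms(2) bounded_linear.has_derivative[OF assms(1) Ck_on_SucD(1)[OF Suc.prems]]
          Suc.IH[OF Ck_on_SucD(2)[OF Suc.prems]]])
qed

lemma Ck_on_add:
  assumes "open S"
  shows "Ck_on k S f \<Longrightarrow> Ck_on k S g \<Longrightarrow> Ck_on k S (\<lambda>x. f x + g x)"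
proof (induction k arbitrary: f g)
  case 0
  then show ?case by (auto intro: continuous_on_add)
next
  case (Suc k)
  show ?case
    by (rule Ck_on_SucI[OF assms has_derivative_add[OF Ck_on_SucD(1)[OF Suc.prems(1)] Ck_on_SucD(1)[OF Suc.prems(2)]]
          Suc.IH[OF Ck_on_SucD(2)[OF Suc.prems(1)] Ck_on_SucD(2)[OF Suc.prems(2)]]])
qed

text \<open>Both terms of the product rule are again of the form \<open>B (f x) (g x)\<close>, so
  the induction closes with \<open>f\<close> and \<open>g\<close> arbitrary. Products, scalar
  multiples and matrix products are all reduced to this case.\<close>

lemma Ck_on_bilinear:
  assumes "bounded_bilinear B" "open S"
  shows "Ck_on k S f \<Longrightarrow> Ck_on k S g \<Longrightarrow> Ck_on k S (\<lambda>x. B (f x) (g x))"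
proof (induction k arbitrary: f g)
  case 0
  then show ?case by (auto intro: bounded_bilinear.continuous_on[OF assms(1)])
next
  case (Suc k)
  show ?case
  proof (rule Ck_on_SucI[OF assms(2)])
    fix x assume x: "x \<in> S"
    show "((\<lambda>x. B (f x) (g x)) has_derivative
        (\<lambda>v. B (f x) (frechet_derivative g (at x) v) + B (frechet_derivative f (at x) v) (g x))) (at x)"
      by (rule bounded_bilinear.FDERIV[OF assms(1) Ck_on_SucD(1)[OF Suc.prems(1) x] Ck_on_SucD(1)[OF Suc.prems(2) x]])
  next
    fix v
    show "Ck_on k S (\<lambda>x. B (f x) (frechet_derivative g (at x) v) + B (frechet_derivative f (at x) v) (g x))"
      by (intro Ck_on_add[OF assms(2)] Suc.IH Ck_on_SucD(2)[OF Suc.prems(1)] Ck_on_SucD(2)[OF Suc.prems(2)]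
          Ck_on_Suc_imp[OF Suc.prems(1)] Ck_on_Suc_imp[OF Suc.prems(2)])
  qed
qed

lemma Ck_on_sum:
  assumes "open S" "\<And>i. i \<in> I \<Longrightarrow> Ck_on k S (f i)"
  shows "Ck_on k S (\<lambda>x. \<Sum>i\<in>I. f i x)"
  using assms(2)
  by (induction I rule: infinite_finite_induct) (auto intro: Ck_on_const Ck_on_add[OF assms(1)])

text \<open>The chain rule evaluates the derivative of \<open>g\<close> in the moving direction
  \<open>f' x v\<close>, whereas \<open>Ck_on\<close> only controls fixed directions. Expanding the
  moving direction in a basis leaves fixed directions with differentiable coefficients; this is why
  the middle space is Euclidean.\<close>

lemma Ck_on_compose:
  fixes f :: "'v::real_normed_vector \<Rightarrow> 'b::euclidean_space"
  assumes "open S" "f ` S \<subseteq> T"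
  shows "Ck_on k S f \<Longrightarrow> Ck_on k T g \<Longrightarrow> Ck_on k S (\<lambda>x. g (f x))"
proof (induction k arbitrary: g)
  case 0
  then show ?case using assms(2) by (auto intro: continuous_on_compose2)
next
  case (Suc k)
  let ?f' = "\<lambda>x. frechet_derivative f (at x)" and ?g' = "\<lambda>x. frechet_derivative g (at x)"
  show ?case
  proof (rule Ck_on_SucI[OF assms(1)])
    fix x assume x: "x \<in> S"
    have g: "(g has_derivative ?g' (f x)) (at (f x))"
      using Ck_on_SucD(1)[OF Suc.prems(2)] x assms(2) by auto
    have R: "?g' (f x) y = (\<Sum>b\<in>Basis. (y \<bullet> b) *\<^sub>R ?g' (f x) b)" for y
    proof -
      have "?g' (f x) (\<Sum>b\<in>Basis. (y \<bullet> b) *\<^sub>R b) = (\<Sum>b\<in>Basis. ?g' (f x) ((y \<bullet> b) *\<^sub>R b))"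
        by (rule linear_sum) (rule has_derivative_linear[OF g])
      then show ?thesis
        using has_derivative_linear[OF g] by (simp add: euclidean_representation linear_cmul)
    qed
    show "((\<lambda>x. g (f x)) has_derivative (\<lambda>v. \<Sum>b\<in>Basis. (?f' x v \<bullet> b) *\<^sub>R ?g' (f x) b)) (at x)"
      using has_derivative_compose[OF Ck_on_SucD(1)[OF Suc.prems(1) x] g]
      by (simp only: R[symmetric])
  next
    fix v
    have "Ck_on k S (\<lambda>x. ?g' (f x) b)" for b
      by (rule Suc.IH[OF Ck_on_Suc_imp[OF Suc.prems(1)] Ck_on_SucD(2)[OF Suc.prems(2)]])
    then show "Ck_on k S (\<lambda>x. \<Sum>b\<in>Basis. (?f' x v \<bullet> b) *\<^sub>R ?g' (f x) b)"
      by (intro Ck_on_sum assms(1) Ck_on_bilinear[OF bounded_bilinear_scaleR assms(1)]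
          Ck_on_linear[OF bounded_linear_inner_left assms(1)] Ck_on_SucD(2)[OF Suc.prems(1)])
  qed
qed

lemma Ck_on_inverse:
  fixes f :: "'v::real_normed_vector \<Rightarrow> real"
  assumes "open S" "\<And>x. x \<in> S \<Longrightarrow> f x \<noteq> 0"
  shows "Ck_on k S f \<Longrightarrow> Ck_on k S (\<lambda>x. inverse (f x))"
proof (induction k)
  case 0
  then show ?case using assms(2) by (auto intro: continuous_on_inverse)
next
  case (Suc k)
  show ?case
    by (rule Ck_on_SucI[OF assms(1) Deriv.has_derivative_inverse[OF _ Ck_on_SucD(1)[OF Suc.prems]]])
      (auto simp: assms(2) intro!: Ck_on_linear[OF bounded_linear_minus[OF bounded_linear_ident] assms(1)]
        Ck_on_bilinear[OF bounded_bilinear_mult assms(1)] Ck_on_SucD(2)[OF Suc.prems]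
        Suc.IH Ck_on_Suc_imp[OF Suc.prems] simp del: Ck_on.simps)
qed

section \<open>Closure properties of smoothness of all orders\<close>

lemma smooth_on_subset: "smooth_on S f \<Longrightarrow> T \<subseteq> S \<Longrightarrow> smooth_on T f"
  unfolding smooth_on_def using Ck_on_subset by blast

lemma smooth_on_localI:
  assumes "\<And>x. x \<in> S \<Longrightarrow> \<exists>T g. open T \<and> x \<in> T \<and> smooth_on T g \<and> (\<forall>y\<in>T. f y = g y)"
  shows "smooth_on S f"
  unfolding smooth_on_def
  by (intro allI Ck_on_local) (metis assms Ck_on_cong smooth_on_def)

lemma smooth_on_cong:
  "open S \<Longrightarrow> (\<And>x. x \<in> S \<Longrightarrow> f x = g x) \<Longrightarrow> smooth_on S f \<Longrightarrow> smooth_on S g"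
  unfolding smooth_on_def using Ck_on_cong by blast

lemma smooth_on_has_derivative:
  "smooth_on S f \<Longrightarrow> x \<in> S \<Longrightarrow> (f has_derivative frechet_derivative f (at x)) (at x)"
  unfolding smooth_on_def using Ck_on_SucD(1) by blast

lemma smooth_on_frechet_derivative:
  "smooth_on S f \<Longrightarrow> smooth_on S (\<lambda>x. frechet_derivative f (at x) v)"
  unfolding smooth_on_def using Ck_on_SucD(2) by blast

lemma smooth_on_continuous: "smooth_on S f \<Longrightarrow> continuous_on S f"
  unfolding smooth_on_def using Ck_on.simps(1) by blast

lemma smooth_on_const: "smooth_on S (\<lambda>x. c)"
  unfolding smooth_on_def by (auto intro: Ck_on_const)

lemma smooth_on_linear:
  "bounded_linear L \<Longrightarrow> open S \<Longrightarrow> smooth_on S f \<Longrightarrow> smooth_on S (\<lambda>x. L (f x))"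
  unfolding smooth_on_def using Ck_on_linear by blast

lemma smooth_on_add:
  "open S \<Longrightarrow> smooth_on S f \<Longrightarrow> smooth_on S g \<Longrightarrow> smooth_on S (\<lambda>x. f x + g x)"
  unfolding smooth_on_def using Ck_on_add by blast

lemma smooth_on_bilinear:
  "bounded_bilinear B \<Longrightarrow> open S \<Longrightarrow> smooth_on S f \<Longrightarrow> smooth_on S g \<Longrightarrow> smooth_on S (\<lambda>x. B (f x) (g x))"
  unfolding smooth_on_def using Ck_on_bilinear by blast

lemmas smooth_on_mult = smooth_on_bilinear[OF bounded_bilinear_mult]
lemmas smooth_on_scaleR = smooth_on_bilinear[OF bounded_bilinear_scaleR]

lemma smooth_on_minus: "open S \<Longrightarrow> smooth_on S f \<Longrightarrow> smooth_on S (\<lambda>x. - f x)"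
  by (rule smooth_on_linear[OF bounded_linear_minus[OF bounded_linear_ident]])

lemma smooth_on_diff:
  "open S \<Longrightarrow> smooth_on S f \<Longrightarrow> smooth_on S g \<Longrightarrow> smooth_on S (\<lambda>x. f x - g x)"
  using smooth_on_add[OF _ _ smooth_on_minus, of S f g] by simp

lemma smooth_on_sum:
  "open S \<Longrightarrow> (\<And>i. i \<in> I \<Longrightarrow> smooth_on S (f i)) \<Longrightarrow> smooth_on S (\<lambda>x. \<Sum>i\<in>I. f i x)"
  unfolding smooth_on_def using Ck_on_sum[of S I _ f] by blast

lemma smooth_on_compose:
  fixes f :: "'v::real_normed_vector \<Rightarrow> 'b::euclidean_space"
  shows "open S \<Longrightarrow> f ` S \<subseteq> T \<Longrightarrow> smooth_on S f \<Longrightarrow> smooth_on T g \<Longrightarrow> smooth_on S (\<lambda>x. g (f x))"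
  unfolding smooth_on_def using Ck_on_compose by blast

lemma smooth_on_inverse:
  fixes f :: "'v::real_normed_vector \<Rightarrow> real"
  shows "open S \<Longrightarrow> (\<And>x. x \<in> S \<Longrightarrow> f x \<noteq> 0) \<Longrightarrow> smooth_on S f \<Longrightarrow> smooth_on S (\<lambda>x. inverse (f x))"
  unfolding smooth_on_def using Ck_on_inverse by blast

lemma smooth_on_divide:
  fixes f :: "'v::real_normed_vector \<Rightarrow> real"
  shows "open S \<Longrightarrow> (\<And>x. x \<in> S \<Longrightarrow> g x \<noteq> 0) \<Longrightarrow> smooth_on S f \<Longrightarrow> smooth_on S g \<Longrightarrow>
    smooth_on S (\<lambda>x. f x / g x)"
  unfolding divide_inverse by (intro smooth_on_mult smooth_on_inverse)

lemma smooth_on_id: "open S \<Longrightarrow> smooth_on S (\<lambda>x. x)"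
  unfolding smooth_on_def
proof
  fix k
  assume "open S"
  then show "Ck_on k S (\<lambda>x. x)"
    by (cases k) (auto intro: continuous_on_id Ck_on_const)
qed

section \<open>Vector- and matrix-valued smooth maps, partial derivatives\<close>

lemma smooth_on_vec_nth: "open S \<Longrightarrow> smooth_on S f \<Longrightarrow> smooth_on S (\<lambda>x. f x $ i)"
  by (rule smooth_on_linear[OF bounded_linear_vec_nth])

lemma bounded_linear_axis: "bounded_linear (axis i :: 'b::real_normed_vector \<Rightarrow> 'b ^ 'n::finite)"
proof (rule bounded_linear_intro[where K = 1])
  fix x :: 'b
  have "norm (axis i x :: 'b ^ 'n) \<le> (\<Sum>j\<in>UNIV. norm ((axis i x :: 'b ^ 'n) $ j))"
    unfolding norm_vec_def by (rule L2_set_le_sum) simp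
  also have "\<dots> = norm x * 1"
    by (simp add: axis_def if_distrib cong: if_cong)
  finally show "norm (axis i x :: 'b ^ 'n) \<le> norm x * 1" .
qed (auto simp: vec_eq_iff axis_def)

lemma smooth_on_vec_lambda:
  fixes F :: "'n::finite \<Rightarrow> 'v::real_normed_vector \<Rightarrow> 'b::real_normed_vector"
  assumes "open S" "\<And>i. smooth_on S (F i)"
  shows "smooth_on S (\<lambda>x. \<chi> i. F i x)"
proof -
  have "(\<lambda>x. \<chi> i. F i x) = (\<lambda>x. \<Sum>i\<in>UNIV. axis i (F i x))"
    by (rule ext) (simp add: vec_eq_iff axis_def sum_component)
  then show ?thesis
    using assms by (auto intro!: smooth_on_sum smooth_on_linear[OF bounded_linear_axis])
qed

lemma smooth_on_transpose:
  fixes F :: "'v::real_normed_vector \<Rightarrow> real^'m::finite^'n::finite"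
  shows "open S \<Longrightarrow> smooth_on S F \<Longrightarrow> smooth_on S (\<lambda>x. transpose (F x))"
  unfolding transpose_def by (intro smooth_on_vec_lambda smooth_on_vec_nth)

lemma smooth_on_matrix_mult:
  fixes F :: "'v::real_normed_vector \<Rightarrow> real^'m::finite^'n::finite" and G :: "'v \<Rightarrow> real^'k::finite^'m"
  shows "open S \<Longrightarrow> smooth_on S F \<Longrightarrow> smooth_on S G \<Longrightarrow> smooth_on S (\<lambda>x. F x ** G x)"
  unfolding matrix_matrix_mult_def
  by (intro smooth_on_vec_lambda smooth_on_sum smooth_on_mult smooth_on_vec_nth)

lemma smooth_on_matrix_frechet_derivative:
  fixes f :: "real^'m::finite \<Rightarrow> real^'n::finite"
  shows "open S \<Longrightarrow> smooth_on S f \<Longrightarrow> smooth_on S (\<lambda>x. matrix (frechet_derivative f (at x)))"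
  unfolding matrix_def
  by (intro smooth_on_vec_lambda smooth_on_vec_nth smooth_on_frechet_derivative)

lemma has_derivative_partial:
  "(f has_derivative f') (at x) \<Longrightarrow> partial k f x = f' (axis k 1)"
  unfolding partial_def using frechet_derivative_at by metis

lemma smooth_on_partial: "smooth_on S f \<Longrightarrow> smooth_on S (partial k f)"
  unfolding partial_def by (rule smooth_on_frechet_derivative)

lemma partial_cong:
  assumes "open S" "x \<in> S" "\<And>y. y \<in> S \<Longrightarrow> f y = g y"
  shows "partial k f x = partial k g x"
proof -
  \<comment> \<open>\<open>frechet_derivative\<close> is a choice among derivatives, so equal sets
    of candidates give equal values, whether or not a derivative exists.\<close>
  have "(f has_derivative D) (at x) \<longleftrightarrow> (g has_derivative D) (at x)" for D
    using assms has_derivative_transform_within_open by metis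
  then show ?thesis unfolding partial_def frechet_derivative_def by presburger
qed

subsection \<open>Symmetry of second derivatives\<close>

text \<open>Two applications of the mean value theorem: along \<open>u\<close> to the increment in
  direction \<open>v\<close>, then along \<open>v\<close> to the derivative in direction
  \<open>u\<close>. The second difference on the left is symmetric in \<open>u\<close> and
  \<open>v\<close>, while the right-hand side differentiates in a definite order.\<close>

lemma second_difference_mean_value:
  fixes f :: "'v::real_normed_vector \<Rightarrow> real"
  assumes f: "smooth_on S f" and h: "h > 0"
    and S: "\<And>s t. 0 \<le> s \<Longrightarrow> s \<le> h \<Longrightarrow> 0 \<le> t \<Longrightarrow> t \<le> h \<Longrightarrow> x + s *\<^sub>R u + t *\<^sub>R v \<in> S"
  shows "\<exists>s t. 0 \<le> s \<and> s \<le> h \<and> 0 \<le> t \<and> t \<le> h \<and>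
    f (x + h *\<^sub>R u + h *\<^sub>R v) - f (x + h *\<^sub>R u) - f (x + h *\<^sub>R v) + f x =
      h * (h * frechet_derivative (\<lambda>y. frechet_derivative f (at y) u) (at (x + s *\<^sub>R u + t *\<^sub>R v)) v)"
proof -
  let ?D = "\<lambda>y. frechet_derivative f (at y) u"
  have df: "((\<lambda>s. f (x + s *\<^sub>R u + t *\<^sub>R v)) has_real_derivative ?D (x + s *\<^sub>R u + t *\<^sub>R v)) (at s)"
    if "0 \<le> s" "s \<le> h" "0 \<le> t" "t \<le> h" for s t
  proof -
    have "((\<lambda>s. f (x + s *\<^sub>R u + t *\<^sub>R v)) has_derivative
        (\<lambda>r. frechet_derivative f (at (x + s *\<^sub>R u + t *\<^sub>R v)) (r *\<^sub>R u))) (at s)"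
      by (rule has_derivative_compose[where f = "\<lambda>s. x + s *\<^sub>R u + t *\<^sub>R v" and f' = "\<lambda>r. r *\<^sub>R u",
            OF _ smooth_on_has_derivative[OF f S[OF that]]])
        (auto intro!: derivative_eq_intros)
    moreover have "linear (frechet_derivative f (at (x + s *\<^sub>R u + t *\<^sub>R v)))"
      by (rule has_derivative_linear[OF smooth_on_has_derivative[OF f S[OF that]]])
    ultimately show ?thesis by (simp add: has_field_derivative_def linear_cmul mult.commute[of _ "?D _"])
  qed
  have dD: "((\<lambda>t. ?D (x + s *\<^sub>R u + t *\<^sub>R v)) has_real_derivative
      frechet_derivative ?D (at (x + s *\<^sub>R u + t *\<^sub>R v)) v) (at t)"
    if "0 \<le> s" "s \<le> h" "0 \<le> t" "t \<le> h" for s t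
  proof -
    note D = smooth_on_has_derivative[OF smooth_on_frechet_derivative[OF f] S[OF that]]
    have "((\<lambda>t. ?D (x + s *\<^sub>R u + t *\<^sub>R v)) has_derivative
        (\<lambda>r. frechet_derivative ?D (at (x + s *\<^sub>R u + t *\<^sub>R v)) (r *\<^sub>R v))) (at t)"
      by (rule has_derivative_compose[where f = "\<lambda>t. x + s *\<^sub>R u + t *\<^sub>R v" and f' = "\<lambda>r. r *\<^sub>R v", OF _ D])
        (auto intro!: derivative_eq_intros)
    moreover have "linear (frechet_derivative ?D (at (x + s *\<^sub>R u + t *\<^sub>R v)))"
      by (rule has_derivative_linear[OF D])
    ultimately show ?thesis
      by (simp add: has_field_derivative_def linear_cmul mult.commute[of _ "frechet_derivative ?D _ _"])
  qed
  let ?\<phi> = "\<lambda>s. f (x + s *\<^sub>R u + h *\<^sub>R v) - f (x + s *\<^sub>R u + 0 *\<^sub>R v)"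
  have "\<exists>s>0. s < h \<and> ?\<phi> h - ?\<phi> 0 =
      (h - 0) * (?D (x + s *\<^sub>R u + h *\<^sub>R v) - ?D (x + s *\<^sub>R u + 0 *\<^sub>R v))"
    using h by (intro MVT2 DERIV_diff df) auto
  then obtain s where s: "0 < s" "s < h"
    "?\<phi> h - ?\<phi> 0 = (h - 0) * (?D (x + s *\<^sub>R u + h *\<^sub>R v) - ?D (x + s *\<^sub>R u + 0 *\<^sub>R v))"
    by blast
  have "\<exists>t>0. t < h \<and> ?D (x + s *\<^sub>R u + h *\<^sub>R v) - ?D (x + s *\<^sub>R u + 0 *\<^sub>R v) =
      (h - 0) * frechet_derivative ?D (at (x + s *\<^sub>R u + t *\<^sub>R v)) v"
    using h s by (intro MVT2 dD) auto
  then obtain t where t: "0 < t" "t < h"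
    "?D (x + s *\<^sub>R u + h *\<^sub>R v) - ?D (x + s *\<^sub>R u + 0 *\<^sub>R v) =
      (h - 0) * frechet_derivative ?D (at (x + s *\<^sub>R u + t *\<^sub>R v)) v"
    by blast
  show ?thesis
    using s t by (intro exI[of _ s] exI[of _ t]) auto
qed

text \<open>Both mixed derivatives are, at points close to \<open>x\<close>, the same second
  difference divided by the square of its step. Continuity carries the equality to \<open>x\<close>
  up to an arbitrary error.\<close>

lemma frechet_derivative_symmetric:
  fixes f :: "'v::real_normed_vector \<Rightarrow> real"
  assumes "open S" "x \<in> S" and f: "smooth_on S f"
  shows "frechet_derivative (\<lambda>y. frechet_derivative f (at y) u) (at x) v =
    frechet_derivative (\<lambda>y. frechet_derivative f (at y) v) (at x) u"
proof -
  let ?D = "\<lambda>u v y. frechet_derivative (\<lambda>y. frechet_derivative f (at y) u) (at y) v"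
  have "dist (?D u v x) (?D v u x) \<le> 0 + e" if "e > 0" for e
  proof -
    have "isCont (?D a b) x" for a b
      using smooth_on_continuous[OF smooth_on_frechet_derivative[OF smooth_on_frechet_derivative[OF f]]]
        assms(1,2) by (simp add: continuous_on_eq_continuous_at)
    then have "\<exists>r>0. \<forall>y. dist y x < r \<longrightarrow> dist (?D a b y) (?D a b x) < e / 2" for a b
      using that half_gt_zero[OF that] unfolding continuous_at_eps_delta by blast
    then obtain r where r: "r a b > 0" "\<And>y. dist y x < r a b \<Longrightarrow> dist (?D a b y) (?D a b x) < e / 2" for a b
      by metis
    obtain r' where r': "r' > 0" "ball x r' \<subseteq> S" using assms(1,2) open_contains_ball by blast
    define R where "R = min r' (min (r u v) (r v u))"
    have "R > 0" using r(1) r'(1) by (simp add: R_def)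
    \<comment> \<open>Small enough for the whole parallelogram spanned by
      \<open>h *\<^sub>R u\<close> and \<open>h *\<^sub>R v\<close> at \<open>x\<close> to stay
      within distance \<open>R\<close>; the summand 1 keeps the denominator positive when both
      directions vanish.\<close>
    define h where "h = R / (2 * (norm u + norm v + 1))"
    have nn: "norm u + norm v + 1 > 0" by (smt (verit) norm_ge_zero)
    have h: "h > 0" using \<open>R > 0\<close> nn by (simp add: h_def)
    have near: "dist (x + s *\<^sub>R a + t *\<^sub>R b) x < R"
      if "0 \<le> s" "s \<le> h" "0 \<le> t" "t \<le> h" "norm a + norm b = norm u + norm v" for s t a b
    proof -
      have "dist (x + s *\<^sub>R a + t *\<^sub>R b) x \<le> s * norm a + t * norm b"
        using norm_triangle_ineq[of "s *\<^sub>R a" "t *\<^sub>R b"] that by (simp add: dist_norm)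
      also have "\<dots> \<le> h * norm a + h * norm b"
        using that by (intro add_mono mult_right_mono) auto
      also have "\<dots> < h * (2 * (norm u + norm v + 1))"
        unfolding distrib_left[symmetric] that(5) using h nn by (intro mult_strict_left_mono) auto
      also have "\<dots> = R" using nn by (simp add: h_def)
      finally show ?thesis .
    qed
    have inS: "x + s *\<^sub>R a + t *\<^sub>R b \<in> S"
      if "0 \<le> s" "s \<le> h" "0 \<le> t" "t \<le> h" "norm a + norm b = norm u + norm v" for s t a b
      using near[OF that] r' by (auto simp: R_def dist_commute)
    obtain s t where st: "0 \<le> s" "s \<le> h" "0 \<le> t" "t \<le> h"
      "f (x + h *\<^sub>R u + h *\<^sub>R v) - f (x + h *\<^sub>R u) - f (x + h *\<^sub>R v) + f x =
        h * (h * ?D u v (x + s *\<^sub>R u + t *\<^sub>R v))"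
      using second_difference_mean_value[OF f h, of x u v] inS by blast
    obtain s' t' where st': "0 \<le> s'" "s' \<le> h" "0 \<le> t'" "t' \<le> h"
      "f (x + h *\<^sub>R v + h *\<^sub>R u) - f (x + h *\<^sub>R v) - f (x + h *\<^sub>R u) + f x =
        h * (h * ?D v u (x + s' *\<^sub>R v + t' *\<^sub>R u))"
      using second_difference_mean_value[OF f h, of x v u] inS[of _ _ v u] by (auto simp: add.commute[of "norm v"])
    have "h * (h * ?D u v (x + s *\<^sub>R u + t *\<^sub>R v)) = h * (h * ?D v u (x + s' *\<^sub>R v + t' *\<^sub>R u))"
      using st(5) st'(5) by (simp add: algebra_simps)
    then have "?D u v (x + s *\<^sub>R u + t *\<^sub>R v) = ?D v u (x + s' *\<^sub>R v + t' *\<^sub>R u)"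
      using h by simp
    moreover have "dist (?D u v (x + s *\<^sub>R u + t *\<^sub>R v)) (?D u v x) < e / 2"
      using near[OF st(1-4)] r(2)[of _ u v] by (auto simp: R_def)
    moreover have "dist (?D v u (x + s' *\<^sub>R v + t' *\<^sub>R u)) (?D v u x) < e / 2"
      using near[OF st'(1-4), of v u] r(2)[of _ v u] by (auto simp: R_def)
    ultimately show ?thesis by (smt (verit) dist_commute dist_triangle field_sum_of_halves)
  qed
  then have "dist (?D u v x) (?D v u x) \<le> 0" by (rule field_le_epsilon)
  then show ?thesis by simp
qed

lemma partial_commute:
  "open S \<Longrightarrow> x \<in> S \<Longrightarrow> smooth_on S f \<Longrightarrow> partial i (partial j f) x = partial j (partial i f) x"
  unfolding partial_def by (rule frechet_derivative_symmetric)

subsection \<open>Smooth cut-off functions\<close>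

text \<open>The powers of \<open>t\<close> are included to make the family closed under
  differentiation: the derivative of the \<open>m\<close>-th member is the one for
  \<open>m + 2\<close> minus \<open>m\<close> times the one for \<open>m + 1\<close>. Only
  \<open>m = 0\<close> is wanted in the end.\<close>

lemma Ck_on_exp_inverse:
  "Ck_on k UNIV (\<lambda>t::real. if t > 0 then exp (- 1 / t) / t ^ m else 0)"
proof -
  define f :: "nat \<Rightarrow> real \<Rightarrow> real" where "f m t = (if t > 0 then exp (- 1 / t) / t ^ m else 0)" for m t
  have lim: "(f m \<longlongrightarrow> 0) (at_right 0)" for m
  proof -
    \<comment> \<open>The substitution t = 1/x turns the limit at 0 from the right into one at
      infinity.\<close>
    have "((\<lambda>x::real. x ^ m / exp x) \<longlongrightarrow> 0) at_top" by (rule tendsto_power_div_exp_0)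
    moreover have "\<forall>\<^sub>F x in at_top. x ^ m / exp x = f m (inverse x)"
      using eventually_gt_at_top[of 0]
      by eventually_elim (simp add: f_def field_simps exp_minus)
    ultimately have "((\<lambda>x. f m (inverse x)) \<longlongrightarrow> 0) at_top"
      by (rule Lim_transform_eventually)
    then show ?thesis by (simp add: filterlim_at_right_to_top)
  qed
  have d: "(f m has_real_derivative (f (m + 2) x - real m * f (m + 1) x)) (at x)" for m x
  proof -
    consider "x > 0" | "x < 0" | "x = 0" by linarith
    then show ?thesis
    proof cases
      case 1
      have "((\<lambda>t. exp (- 1 / t) / t ^ m) has_real_derivative
          (exp (- 1 / x) * (1 / x\<^sup>2) * x ^ m - exp (- 1 / x) * (real m * x ^ (m - 1))) / (x ^ m * x ^ m)) (at x)"
        using 1 by (auto intro!: derivative_eq_intros simp: power2_eq_square)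
      \<comment> \<open>The truncated exponent \<open>m - 1\<close> is harmless for
        \<open>m = 0\<close>, as it comes with the factor \<open>m\<close>.\<close>
      moreover have "(exp (- 1 / x) * (1 / x\<^sup>2) * x ^ m - exp (- 1 / x) * (real m * x ^ (m - 1))) / (x ^ m * x ^ m) =
          f (m + 2) x - real m * f (m + 1) x"
        using 1 by (cases m) (simp_all add: f_def field_simps power2_eq_square)
      ultimately have "((\<lambda>t. exp (- 1 / t) / t ^ m) has_real_derivative
          (f (m + 2) x - real m * f (m + 1) x)) (at x)"
        by simp
      then show ?thesis
        by (rule has_field_derivative_transform_within_open[where S = "{0<..}"]) (use 1 in \<open>auto simp: f_def\<close>)
    next
      case 2
      have "((\<lambda>t. 0) has_real_derivative (f (m + 2) x - real m * f (m + 1) x)) (at x)"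
        using 2 by (auto simp: f_def)
      then show ?thesis
        by (rule has_field_derivative_transform_within_open[where S = "{..<0}"]) (use 2 in \<open>auto simp: f_def\<close>)
    next
      case 3
      have "((\<lambda>t. (f m t - f m 0) / (t - 0)) \<longlongrightarrow> 0) (at_left 0)"
      proof (rule Lim_transform_eventually[OF tendsto_const])
        show "\<forall>\<^sub>F t in at_left 0. 0 = (f m t - f m 0) / (t - 0)"
          by (auto simp: eventually_at_filter f_def)
      qed
      \<comment> \<open>To the right of 0 the difference quotient of \<open>f m\<close> is
        \<open>f (m + 1)\<close>, whose limit is already known.\<close>
      moreover have "((\<lambda>t. (f m t - f m 0) / (t - 0)) \<longlongrightarrow> 0) (at_right 0)"
      proof (rule Lim_transform_eventually[OF lim])
        show "\<forall>\<^sub>F t in at_right 0. f (m + 1) t = (f m t - f m 0) / (t - 0)"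
          by (auto simp: eventually_at_filter f_def)
      qed
      ultimately have "((\<lambda>t. (f m t - f m 0) / (t - 0)) \<longlongrightarrow> 0) (at 0)"
        by (rule filterlim_split_at)
      then show ?thesis using 3 by (simp add: has_field_derivative_iff) (simp add: f_def)
    qed
  qed
  have "Ck_on k UNIV (f m)" for k m
  proof (induction k arbitrary: m)
    case 0
    then show ?case
      by (auto simp: continuous_on_eq_continuous_at intro: DERIV_isCont[OF d])
  next
    case (Suc k)
    have "Ck_on k UNIV (\<lambda>x. (f (m + 2) x + (- real m) * f (m + 1) x) * v)" for v
      by (intro Ck_on_bilinear[OF bounded_bilinear_mult] Ck_on_add Ck_on_const Suc.IH open_UNIV)
    then show ?case
      by (intro Ck_on_SucI[OF open_UNIV d[of m, unfolded has_field_derivative_def]]) simp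
  qed
  then show ?thesis unfolding f_def .
qed

lemma smooth_step:
  fixes c d :: real
  assumes "c < d"
  obtains s :: "real \<Rightarrow> real" where "smooth_on UNIV s" "\<And>t. 0 \<le> s t \<and> s t \<le> 1" "\<And>t. t \<le> c \<Longrightarrow> s t = 0" "\<And>t. d \<le> t \<Longrightarrow> s t = 1"
proof -
  define e where "e t = (if t > 0 then exp (- 1 / t) else 0)" for t :: real
  have e: "smooth_on UNIV e"
    using Ck_on_exp_inverse[where m = 0] unfolding smooth_on_def e_def by (simp cong: if_cong)
  have ge: "e t \<ge> 0" and pos: "t > 0 \<Longrightarrow> e t > 0" and zero: "t \<le> 0 \<Longrightarrow> e t = 0" for t
    by (auto simp: e_def)
  \<comment> \<open>As c < d, at least one of \<open>t - c\<close> and \<open>d - t\<close> is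
    positive.\<close>
  have ne: "e (t - c) + e (d - t) > 0" for t
    using ge[of "t - c"] ge[of "d - t"] pos[of "t - c"] pos[of "d - t"] assms
    by (smt (verit))
  then have ne': "e (t - c) + e (d - t) \<noteq> 0" for t by (metis less_irrefl)
  show ?thesis
  proof
    show "smooth_on UNIV (\<lambda>t. e (t - c) / (e (t - c) + e (d - t)))"
      by (intro smooth_on_divide smooth_on_add smooth_on_compose[OF _ _ _ e] smooth_on_diff
          smooth_on_id smooth_on_const open_UNIV)
        (auto simp: ne')
    show "0 \<le> e (t - c) / (e (t - c) + e (d - t)) \<and> e (t - c) / (e (t - c) + e (d - t)) \<le> 1" for t
      using ne[of t] ge by (auto simp: divide_le_eq_1)
    show "e (t - c) / (e (t - c) + e (d - t)) = 0" if "t \<le> c" for t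
      using that by (simp add: zero)
    show "e (t - c) / (e (t - c) + e (d - t)) = 1" if "d \<le> t" for t
      using that ne[of t] by (simp add: zero)
  qed
qed

text \<open>The map pulls \<open>t\<close> towards \<open>a'\<close> by a cut-off factor that is 1
  on [a', b'] and 0 outside (a, b). Points of (a, b) move towards \<open>a'\<close> without leaving
  the interval, and all other points land on \<open>a'\<close>.\<close>

lemma smooth_retraction_interval:
  fixes a a' b' b :: real
  assumes "a < a'" "a' \<le> b'" "b' < b"
  obtains \<sigma> where "smooth_on UNIV \<sigma>" "\<And>t. a < \<sigma> t \<and> \<sigma> t < b" "\<And>t. a' \<le> t \<Longrightarrow> t \<le> b' \<Longrightarrow> \<sigma> t = t"
proof -
  obtain u :: "real \<Rightarrow> real" where u: "smooth_on UNIV u" "\<And>t. 0 \<le> u t \<and> u t \<le> 1" "\<And>t. t \<le> a \<Longrightarrow> u t = 0" "\<And>t. a' \<le> t \<Longrightarrow> u t = 1"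
    using smooth_step[OF assms(1)] by blast
  \<comment> \<open>An increasing step, to be used in reflected form: \<open>w (- t)\<close> is 1 up
    to \<open>b'\<close> and 0 from \<open>b\<close> on.\<close>
  obtain w :: "real \<Rightarrow> real" where w: "smooth_on UNIV w" "\<And>t. 0 \<le> w t \<and> w t \<le> 1" "\<And>t. t \<le> - b \<Longrightarrow> w t = 0" "\<And>t. - b' \<le> t \<Longrightarrow> w t = 1"
    using smooth_step[of "- b" "- b'"] assms(3) by (metis neg_less_iff_less)
  let ?\<rho> = "\<lambda>t. u t * w (- t)"
  have \<rho>: "0 \<le> ?\<rho> t" "?\<rho> t \<le> 1" for t
    using u(2) w(2) by (auto intro: mult_le_one)
  show ?thesis
  proof
    show "smooth_on UNIV (\<lambda>t. a' + ?\<rho> t * (t - a'))"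
      by (intro smooth_on_add smooth_on_mult smooth_on_compose[OF _ _ _ w(1)] u(1) smooth_on_minus smooth_on_diff
          smooth_on_id smooth_on_const open_UNIV subset_UNIV)
    show "a' + ?\<rho> t * (t - a') = t" if "a' \<le> t" "t \<le> b'" for t
      using that u(4) w(4) by simp
    show "a < a' + ?\<rho> t * (t - a') \<and> a' + ?\<rho> t * (t - a') < b" for t
    proof -
      consider "t \<le> a \<or> b \<le> t" | "a < t" "t \<le> a'" | "a' \<le> t" "t < b" by linarith
      then show ?thesis
      proof cases
        case 1
        then have "?\<rho> t * (t - a') = 0" using u(3)[of t] w(3)[of "- t"] by auto
        then show ?thesis using assms by linarith
      next
        case 2
        then have "t - a' \<le> ?\<rho> t * (t - a')"
          using mult_right_mono_neg[OF \<rho>(2)[of t], of "t - a'"] by simp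
        moreover have "?\<rho> t * (t - a') \<le> 0" using \<rho>(1)[of t] 2 by (simp add: mult_nonneg_nonpos)
        ultimately show ?thesis using 2 assms by linarith
      next
        case 3
        then have "?\<rho> t * (t - a') \<le> t - a'"
          using mult_right_mono[OF \<rho>(2)[of t], of "t - a'"] by simp
        moreover have "?\<rho> t * (t - a') \<ge> 0" using \<rho>(1)[of t] 3 by simp
        ultimately show ?thesis using 3 assms by linarith
      qed
    qed
  qed
qed

subsection \<open>Gluing local solutions over Euclidean space\<close>

text \<open>An abstract form of the triviality of bundles over \<open>\<real>\<^sup>n\<close>. In the assumption \<open>patch\<close>, \<open>s1\<close> and \<open>s2\<close>
  differ over \<open>W1 \<inter> W2\<close> by a gauge transformation; its pullback along \<open>r\<close> is defined on all of \<open>W1\<close> and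
  corrects \<open>s1\<close> so that it agrees with \<open>s2\<close> wherever \<open>r\<close> is the identity.\<close>

locale euclidean_patching =
  fixes P :: "(real^'n::finite) set \<Rightarrow> (real^'n \<Rightarrow> 'b) \<Rightarrow> bool"
  assumes sheaf: "(\<And>x. x \<in> S \<Longrightarrow> \<exists>W s'. open W \<and> x \<in> W \<and> P W s' \<and> (\<forall>y\<in>W. s y = s' y)) \<Longrightarrow> P S s"
    and local_existence: "\<exists>W s. open W \<and> x \<in> W \<and> P W s"
    and patch: "open W1 \<Longrightarrow> open W2 \<Longrightarrow> P W1 s1 \<Longrightarrow> P W2 s2 \<Longrightarrow> smooth_on UNIV r \<Longrightarrow> r ` W1 \<subseteq> W1 \<inter> W2 \<Longrightarrow>
      \<exists>s. P W1 s \<and> (\<forall>x\<in>W1 \<inter> W2. r x = x \<longrightarrow> s x = s2 x)"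
begin

text \<open>Restriction is the instance of \<open>sheaf\<close> in which the same open set serves
  all points.\<close>

lemma mono: "P W s \<Longrightarrow> open W \<Longrightarrow> W' \<subseteq> W \<Longrightarrow> P W' s"
  by (rule sheaf) blast

lemma open_coordinate_box: "open {x :: real^'n. \<forall>i. l i < x $ i \<and> x $ i < u i}"
proof -
  have "{x :: real^'n. \<forall>i. l i < x $ i \<and> x $ i < u i} = (\<Inter>i. {x. l i < x $ i} \<inter> {x. x $ i < u i})"
    by auto
  also have "open \<dots>"
    by (intro open_INT ballI open_Int open_Collect_less continuous_intros) auto
  finally show ?thesis .
qed

text \<open>The two boxes overlap in the slab of half-width \<open>e\<close> around the hyperplane
  where coordinate \<open>j\<close> is \<open>b\<close>. Compressing coordinate \<open>j\<close>
  into this slab maps the first box into the overlap and fixes the slab of half-width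
  \<open>e/2\<close>, so \<open>patch\<close> makes the two solutions agree there.\<close>

lemma slab_union:
  assumes s1: "P {x. \<forall>i. l i < x $ i \<and> x $ i < (u(j := b + e)) i} s1"
    and s2: "P {x. \<forall>i. (l(j := b - e)) i < x $ i \<and> x $ i < u i} s2"
    and e: "e > 0" and l: "l j \<le> b - e" and u: "b + e \<le> u j"
  shows "\<exists>s. P {x. \<forall>i. l i < x $ i \<and> x $ i < u i} s"
proof -
  let ?W1 = "{x. \<forall>i. l i < x $ i \<and> x $ i < (u(j := b + e)) i}"
  let ?W2 = "{x. \<forall>i. (l(j := b - e)) i < x $ i \<and> x $ i < u i}"
  obtain \<sigma> where \<sigma>: "smooth_on UNIV \<sigma>" "\<And>t. b - e < \<sigma> t \<and> \<sigma> t < b + e"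
      "\<And>t. b - e/2 \<le> t \<Longrightarrow> t \<le> b + e/2 \<Longrightarrow> \<sigma> t = t"
    using smooth_retraction_interval[of "b - e" "b - e/2" "b + e/2" "b + e"] e by auto
  define r :: "real^'n \<Rightarrow> real^'n" where "r x = (\<chi> i. if i = j then \<sigma> (x $ i) else x $ i)" for x
  have "smooth_on UNIV (\<lambda>x::real^'n. if i = j then \<sigma> (x $ i) else x $ i)" for i
    by (cases "i = j") (auto intro!: smooth_on_compose[OF _ _ _ \<sigma>(1)] smooth_on_vec_nth smooth_on_id)
  then have r: "smooth_on UNIV r" unfolding r_def by (intro smooth_on_vec_lambda) auto
  have "r ` ?W1 \<subseteq> ?W1 \<inter> ?W2"
  proof
    fix y assume "y \<in> r ` ?W1"
    then obtain x where x: "x \<in> ?W1" "y = r x" by blast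
    have "l i < y $ i \<and> y $ i < (u(j := b + e)) i \<and> (l(j := b - e)) i < y $ i \<and> y $ i < u i" for i
    proof -
      have "l i < x $ i \<and> x $ i < (u(j := b + e)) i" using x(1) by blast
      then show ?thesis using x(2) \<sigma>(2)[of "x $ i"] l u by (cases "i = j") (auto simp: r_def)
    qed
    then show "y \<in> ?W1 \<inter> ?W2" by blast
  qed
  then obtain s where s: "P ?W1 s" "\<And>x. x \<in> ?W1 \<inter> ?W2 \<Longrightarrow> r x = x \<Longrightarrow> s x = s2 x"
    using patch[OF open_coordinate_box open_coordinate_box s1 s2 r] by blast
  have agree: "s x = s2 x" if "x \<in> ?W1" "x \<in> ?W2" "b - e/2 < x $ j" "x $ j < b + e/2" for x
  proof -
    have "r x = x" using that by (simp add: r_def vec_eq_iff \<sigma>(3))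
    then show ?thesis using s(2) that by blast
  qed
  \<comment> \<open>The switch at \<open>b\<close> is invisible locally: near the hyperplane both
    branches are equal to \<open>s2\<close>.\<close>
  define s' where "s' x = (if x $ j < b then s x else s2 x)" for x
  have "P {x. \<forall>i. l i < x $ i \<and> x $ i < u i} s'"
  proof (rule sheaf)
    fix x :: "real^'n" assume x: "x \<in> {x. \<forall>i. l i < x $ i \<and> x $ i < u i}"
    consider "x $ j < b" | "x $ j > b" | "x $ j = b" by linarith
    then show "\<exists>W s''. open W \<and> x \<in> W \<and> P W s'' \<and> (\<forall>y\<in>W. s' y = s'' y)"
    proof cases
      case 1
      let ?W = "?W1 \<inter> {x. x $ j < b}"
      have "open ?W" by (intro open_Int open_coordinate_box open_Collect_less continuous_intros)
      moreover have "x \<in> ?W" using 1 x e by auto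
      moreover have "P ?W s" by (rule mono[OF s(1) open_coordinate_box]) auto
      ultimately show ?thesis by (intro exI[of _ ?W] exI[of _ s]) (auto simp: s'_def)
    next
      case 2
      let ?W = "?W2 \<inter> {x. b < x $ j}"
      have "open ?W" by (intro open_Int open_coordinate_box open_Collect_less continuous_intros)
      moreover have "x \<in> ?W" using 2 x e by auto
      moreover have "P ?W s2" by (rule mono[OF s2 open_coordinate_box]) auto
      ultimately show ?thesis by (intro exI[of _ ?W] exI[of _ s2]) (auto simp: s'_def)
    next
      case 3
      let ?W = "?W1 \<inter> ?W2 \<inter> ({x. b - e/2 < x $ j} \<inter> {x. x $ j < b + e/2})"
      have "open ?W" by (intro open_Int open_coordinate_box open_Collect_less continuous_intros)
      moreover have "x \<in> ?W" using 3 x e by auto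
      moreover have "P ?W s2" by (rule mono[OF s2 open_coordinate_box]) auto
      moreover have "\<forall>y\<in>?W. s' y = s2 y" using agree by (auto simp: s'_def)
      ultimately show ?thesis by blast
    qed
  qed
  then show ?thesis by blast
qed

text \<open>Induction on the set \<open>K\<close> of coordinates in which the box is already long;
  in the others it is a thin neighbourhood of \<open>y\<close>. Compactness of [-R, R] lengthens one
  further coordinate at the price of a smaller thickness, which is why \<open>e\<close> is
  existential and \<open>y\<close> is arbitrary in the induction.\<close>

lemma solution_box_coordinates:
  assumes "finite K" "R > 0"
  shows "\<exists>e>0. \<exists>s. P {x. \<forall>i. (if i \<in> K then - R else y $ i - e) < x $ i \<and>
    x $ i < (if i \<in> K then R else y $ i + e)} s"
  using assms(1)
proof (induction K arbitrary: y rule: finite_induct)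
  case empty
  obtain W s where W: "open W" "y \<in> W" "P W s" using local_existence by blast
  obtain d where d: "d > 0" "ball y d \<subseteq> W" using W open_contains_ball by blast
  \<comment> \<open>The Euclidean norm is bounded by the sum of the absolute coordinates, one for
    each index.\<close>
  define e where "e = d / CARD('n)"
  have "{x. \<forall>i. y $ i - e < x $ i \<and> x $ i < y $ i + e} \<subseteq> ball y d"
  proof
    fix x assume x: "x \<in> {x. \<forall>i. y $ i - e < x $ i \<and> x $ i < y $ i + e}"
    have "dist y x \<le> (\<Sum>i\<in>UNIV. \<bar>(y - x) $ i\<bar>)" unfolding dist_norm by (rule norm_le_l1_cart)
    also have "\<dots> < (\<Sum>i\<in>(UNIV :: 'n set). e)"
      using x by (intro sum_strict_mono) (auto simp: abs_less_iff less_diff_eq diff_less_eq add.commute)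
    also have "\<dots> = d" by (simp add: e_def)
    finally show "x \<in> ball y d" by simp
  qed
  then have "P {x. \<forall>i. y $ i - e < x $ i \<and> x $ i < y $ i + e} s"
    using mono[OF W(3,1)] d(2) by blast
  moreover have "e > 0" using d(1) by (simp add: e_def)
  ultimately show ?case by auto
next
  case (insert j K)
  let ?l = "\<lambda>e i. if i \<in> K then - R else y $ i - e" and ?u = "\<lambda>e i. if i \<in> K then R else y $ i + e"
  let ?B = "\<lambda>a b e. {x. \<forall>i. ((?l e)(j := a - e)) i < x $ i \<and> x $ i < ((?u e)(j := b + e)) i}"
  \<comment> \<open>Bisection in coordinate \<open>j\<close>: having a solution over some
    neighbourhood of the slab from \<open>p\<close> to \<open>q\<close> is additive by
    \<open>slab_union\<close>, and holds for all short intervals around a given point.\<close>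
  have slab: "\<exists>e>0. \<exists>s. P (?B p q e) s" if "p \<le> q" for p q
    using that
  proof (induction rule: Bolzano)
    case (trans a b c)
    obtain e1 s1 where s1: "e1 > 0" "P (?B a b e1) s1" using trans(1) by (elim exE conjE)
    obtain e2 s2 where s2: "e2 > 0" "P (?B b c e2) s2" using trans(2) by (elim exE conjE)
    define e where "e = min e1 e2"
    have e: "e > 0" using s1 s2 by (simp add: e_def)
    have "?B a b e \<subseteq> ?B a b e1"
      by (intro Collect_mono all_mono impI) (auto simp: e_def split: if_splits)
    then have "P (?B a b e) s1" by (rule mono[OF s1(2) open_coordinate_box])
    moreover have "?B b c e \<subseteq> ?B b c e2"
      by (intro Collect_mono all_mono impI) (auto simp: e_def split: if_splits)
    then have "P (?B b c e) s2" by (rule mono[OF s2(2) open_coordinate_box])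
    ultimately have "\<exists>s. P (?B a c e) s"
      using slab_union[of "(?l e)(j := a - e)" "(?u e)(j := c + e)" j b e s1 s2] e trans by simp
    then show ?case using e by (intro exI[of _ e] conjI)
  next
    case (local t)
    \<comment> \<open>The induction hypothesis is applied at \<open>y\<close> with its
      \<open>j\<close>-th coordinate moved to \<open>t\<close>.\<close>
    obtain e s where e: "e > 0" and s: "P {x. \<forall>i. (if i \<in> K then - R else (\<chi> i. if i = j then t else y $ i) $ i - e) < x $ i \<and>
      x $ i < (if i \<in> K then R else (\<chi> i. if i = j then t else y $ i) $ i + e)} s"
      using insert.IH[of "\<chi> i. if i = j then t else y $ i"] by blast
    \<comment> \<open>An interval of length less than \<open>e/2\<close> containing
      \<open>t\<close>, enlarged by \<open>e/2\<close> at both ends, stays within distance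
      \<open>e\<close> of \<open>t\<close>.\<close>
    have "\<forall>a b. a \<le> t \<and> t \<le> b \<and> b - a < e / 2 \<longrightarrow> (\<exists>e>0. \<exists>s. P (?B a b e) s)"
    proof (intro allI impI)
      fix a b
      assume ab: "a \<le> t \<and> t \<le> b \<and> b - a < e / 2"
      have "P (?B a b (e/2)) s"
      proof (rule mono[OF s open_coordinate_box], intro Collect_mono all_mono impI)
        fix x :: "real^'n" and i
        assume "((?l (e/2))(j := a - e/2)) i < x $ i \<and> x $ i < ((?u (e/2))(j := b + e/2)) i"
        then show "(if i \<in> K then - R else (\<chi> i. if i = j then t else y $ i) $ i - e) < x $ i \<and>
            x $ i < (if i \<in> K then R else (\<chi> i. if i = j then t else y $ i) $ i + e)"
          using ab e insert.hyps(2) by (auto split: if_splits)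
      qed
      then show "\<exists>e>0. \<exists>s. P (?B a b e) s"
        using half_gt_zero[OF e] by (intro exI[of _ "e/2"] conjI exI[of _ s])
    qed
    then show ?case using half_gt_zero[OF e] by (intro exI[of _ "e/2"] conjI)
  qed
  have "- R \<le> R" using assms(2) by simp
  from slab[OF this] obtain e s where e: "e > 0" and s: "P (?B (- R) R e) s" by (elim exE conjE)
  have "P {x. \<forall>i. (if i \<in> insert j K then - R else y $ i - e) < x $ i \<and>
      x $ i < (if i \<in> insert j K then R else y $ i + e)} s"
    using e by (intro mono[OF s open_coordinate_box] Collect_mono all_mono impI) (auto split: if_splits)
  then show ?case using e by (intro exI[of _ e] conjI exI[of _ s])
qed

lemma solution_cube: "R > 0 \<Longrightarrow> \<exists>s. P {x. \<forall>i. - R < x $ i \<and> x $ i < R} s"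
  using solution_box_coordinates[of UNIV R] by auto

text \<open>A solution over the next cube is corrected so as to coincide with the previous one
  except on a collar of its cube. At every point the sequence obtained in this way is eventually
  constant.\<close>

theorem solution_UNIV: "\<exists>s. P UNIV s"
proof -
  define B :: "real \<Rightarrow> (real^'n) set" where "B R = {x. \<forall>i. - R < x $ i \<and> x $ i < R}" for R
  have oB: "open (B R)" for R unfolding B_def by (rule open_coordinate_box)
  have B_mono: "B R \<subseteq> B R'" if "R \<le> R'" for R R'
    unfolding B_def using that by (intro Collect_mono all_mono) auto
  \<comment> \<open>Solutions live on the cube of half-side \<open>n + 2\<close> but are preserved
    only on half-side \<open>n + 1\<close>; the retraction uses up the margin of 1.\<close>
  have "\<exists>s'. P (B (real (Suc n) + 2)) s' \<and> (\<forall>x\<in>B (real n + 1). s' x = s x)"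
    if s: "P (B (real n + 2)) s" for n s
  proof -
    obtain t where t: "P (B (real (Suc n) + 2)) t" using solution_cube[of "real (Suc n) + 2"] by (auto simp: B_def)
    obtain \<sigma> where \<sigma>: "smooth_on UNIV \<sigma>" "\<And>x. - (real n + 2) < \<sigma> x \<and> \<sigma> x < real n + 2"
        "\<And>t. - (real n + 1) \<le> t \<Longrightarrow> t \<le> real n + 1 \<Longrightarrow> \<sigma> t = t"
      using smooth_retraction_interval[of "- (real n + 2)" "- (real n + 1)" "real n + 1" "real n + 2"] by auto
    define r :: "real^'n \<Rightarrow> real^'n" where "r x = (\<chi> i. \<sigma> (x $ i))" for x
    have "smooth_on UNIV r" unfolding r_def
      by (intro smooth_on_vec_lambda smooth_on_compose[OF _ _ _ \<sigma>(1)] smooth_on_vec_nth smooth_on_id) auto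
    moreover have "r x \<in> B (real n + 2)" for x using \<sigma>(2) by (simp add: B_def r_def)
    then have "r ` B (real (Suc n) + 2) \<subseteq> B (real (Suc n) + 2) \<inter> B (real n + 2)"
      using B_mono[of "real n + 2" "real (Suc n) + 2"] by auto
    ultimately obtain s' where s': "P (B (real (Suc n) + 2)) s'"
        "\<And>x. x \<in> B (real (Suc n) + 2) \<inter> B (real n + 2) \<Longrightarrow> r x = x \<Longrightarrow> s' x = s x"
      using patch[OF oB oB t s] by blast
    have "r x = x" if "x \<in> B (real n + 1)" for x
      using that by (auto simp: B_def r_def vec_eq_iff less_imp_le intro!: \<sigma>(3))
    moreover have "B (real n + 1) \<subseteq> B (real (Suc n) + 2) \<inter> B (real n + 2)"
      using B_mono[of "real n + 1" "real n + 2"] B_mono[of "real n + 1" "real (Suc n) + 2"] by auto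
    ultimately show ?thesis using s' by blast
  qed
  then have "\<exists>S. \<forall>n. P (B (real n + 2)) (S n) \<and> (\<forall>x\<in>B (real n + 1). S (Suc n) x = S n x)"
    using solution_cube[of 2] by (intro dependent_nat_choice) (auto simp: B_def)
  then obtain S where S: "\<And>n. P (B (real n + 2)) (S n)" "\<And>n x. x \<in> B (real n + 1) \<Longrightarrow> S (Suc n) x = S n x"
    by blast
  have S_const: "S m x = S n x" if "n \<le> m" "x \<in> B (real n + 1)" for m n x
    using that(1)
  proof (induction m rule: dec_induct)
    case (step m)
    then show ?case using S(2)[of x m] that(2) B_mono[of "real n + 1" "real m + 1"] by auto
  qed simp
  have ex: "\<exists>n. x \<in> B (real n + 1)" for x
  proof -
    obtain n where n: "norm x < real n" using reals_Archimedean2 by blast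
    have "- (real n + 1) < x $ i \<and> x $ i < real n + 1" for i
      using component_le_norm_cart[of x i] n by linarith
    then show ?thesis unfolding B_def by blast
  qed
  \<comment> \<open>The first stage from which on the value at \<open>x\<close> no longer
    changes.\<close>
  define N where "N x = (LEAST n. x \<in> B (real n + 1))" for x
  have N: "x \<in> B (real (N x) + 1)" and N_le: "x \<in> B (real n + 1) \<Longrightarrow> N x \<le> n" for x n
    unfolding N_def using ex by (auto intro: LeastI_ex Least_le)
  have "P UNIV (\<lambda>x. S (N x) x)"
  proof (rule sheaf)
    fix x
    let ?W = "B (real (N x) + 1)"
    have "P ?W (S (N x))" by (rule mono[OF S(1) oB B_mono]) simp
    moreover have "\<forall>y\<in>?W. S (N y) y = S (N x) y" using S_const[OF N_le N] by metis
    ultimately show "\<exists>W s'. open W \<and> x \<in> W \<and> P W s' \<and> (\<forall>y\<in>W. S (N y) y = s' y)"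
      using oB N by blast
  qed
  then show ?thesis by blast
qed

end

subsection \<open>Charts and smooth vector-valued functions\<close>

definition smooth_map ::
  "('a, 'n::finite) chart set \<Rightarrow> 'a set \<Rightarrow> ('a \<Rightarrow> 'w::real_normed_vector) \<Rightarrow> bool" where
  "smooth_map A U F \<longleftrightarrow> (\<forall>c\<in>A. smooth_on (snd c ` (fst c \<inter> U)) (\<lambda>x. F (chart_inv c x)))"

lemma smooth_fun_iff: "smooth_fun A U = smooth_map A U"
  by (simp add: fun_eq_iff smooth_fun_def smooth_map_def comp_def)

lemma smooth_map_subset: "smooth_map A U F \<Longrightarrow> W \<subseteq> U \<Longrightarrow> smooth_map A W F"
  unfolding smooth_map_def by (meson smooth_on_subset image_mono Int_mono subset_refl)

locale smooth_atlas =
  fixes M :: "'a::{t2_space, second_countable_topology} set"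
    and A :: "('a, 'n::finite) chart set"
  assumes atlas: "smooth_manifold M A"
begin

lemma Union_charts: "(\<Union>c\<in>A. fst c) = M"
  using atlas unfolding smooth_manifold_def by blast

lemma charts_at_nonempty: "p \<in> M \<Longrightarrow> \<exists>c. c \<in> charts_at A p"
  unfolding Union_charts[symmetric] charts_at_def by blast

lemma open_chart_domain: "c \<in> A \<Longrightarrow> open (fst c)"
  and chart_homeomorphism: "c \<in> A \<Longrightarrow> homeomorphism (fst c) (snd c ` fst c) (snd c) (chart_inv c)"
  and open_chart_range: "c \<in> A \<Longrightarrow> open (snd c ` fst c)"
  and smooth_transition:
    "c \<in> A \<Longrightarrow> d \<in> A \<Longrightarrow> smooth_on (snd c ` (fst c \<inter> fst d)) (snd d \<circ> chart_inv c)"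
  using atlas unfolding smooth_manifold_def by blast+

lemma chart_inv_chart: "c \<in> A \<Longrightarrow> p \<in> fst c \<Longrightarrow> chart_inv c (snd c p) = p"
  using chart_homeomorphism unfolding homeomorphism_def by blast

lemma open_chart_image:
  assumes "c \<in> A" "open U"
  shows "open (snd c ` (fst c \<inter> U))"
proof -
  have "openin (top_of_set (snd c ` fst c)) (snd c ` (fst c \<inter> U))"
    using homeomorphism_imp_open_map[OF chart_homeomorphism[OF assms(1)]] assms(2) by (simp add: openin_open_Int)
  then show ?thesis using open_chart_range[OF assms(1)] openin_open_trans by blast
qed

lemma open_chart_vimage:
  assumes "c \<in> A" "open W"
  shows "open (fst c \<inter> snd c -` W)"
  using chart_homeomorphism[OF assms(1)] open_chart_domain[OF assms(1)] assms(2)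
  unfolding homeomorphism_def by (meson continuous_on_open_vimage Int_commute continuous_open_preimage)

text \<open>Inside the domain of one chart that chart alone decides smoothness, because the
  transition maps are smooth.\<close>

lemma smooth_map_chartI:
  assumes c: "c \<in> A" and U: "open U" "U \<subseteq> fst c"
    and F: "smooth_on (snd c ` U) (\<lambda>x. F (chart_inv c x))"
  shows "smooth_map A U F"
  unfolding smooth_map_def
proof
  fix d assume d: "d \<in> A"
  let ?S = "snd d ` (fst d \<inter> U)"
  have S: "open ?S" using open_chart_image[OF d U(1)] .
  have "smooth_on ?S (\<lambda>x. F (chart_inv c ((snd c \<circ> chart_inv d) x)))"
  proof (rule smooth_on_compose[OF S _ _ F])
    show "(snd c \<circ> chart_inv d) ` ?S \<subseteq> snd c ` U" using chart_inv_chart[OF d] by auto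
    show "smooth_on ?S (snd c \<circ> chart_inv d)"
      by (rule smooth_on_subset[OF smooth_transition[OF d c]]) (use U(2) in auto)
  qed
  then show "smooth_on ?S (\<lambda>x. F (chart_inv d x))"
    by (rule smooth_on_cong[OF S, rotated]) (use chart_inv_chart[OF c] chart_inv_chart[OF d] U(2) in auto)
qed

lemma smooth_map_chartD:
  assumes "c \<in> A" "smooth_map A U F" "U \<subseteq> fst c"
  shows "smooth_on (snd c ` U) (\<lambda>x. F (chart_inv c x))"
  using assms unfolding smooth_map_def by (metis Int_absorb1)

lemma smooth_map_local:
  assumes "\<And>p. p \<in> U \<Longrightarrow> \<exists>W G. open W \<and> p \<in> W \<and> smooth_map A W G \<and> (\<forall>q\<in>W. F q = G q)"
  shows "smooth_map A U F"
  unfolding smooth_map_def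
proof
  fix c assume c: "c \<in> A"
  show "smooth_on (snd c ` (fst c \<inter> U)) (\<lambda>x. F (chart_inv c x))"
  proof (rule smooth_on_localI)
    fix x assume "x \<in> snd c ` (fst c \<inter> U)"
    then obtain p where p: "p \<in> fst c" "p \<in> U" "x = snd c p" by blast
    obtain W G where W: "open W" "p \<in> W" "smooth_map A W G" "\<forall>q\<in>W. F q = G q"
      using assms[OF p(2)] by blast
    have "smooth_on (snd c ` (fst c \<inter> W)) (\<lambda>x. G (chart_inv c x))"
      using W(3) c unfolding smooth_map_def by blast
    moreover have "\<forall>y\<in>snd c ` (fst c \<inter> W). F (chart_inv c y) = G (chart_inv c y)"
      using W(4) chart_inv_chart[OF c] by auto
    ultimately show "\<exists>T g. open T \<and> x \<in> T \<and> smooth_on T g \<and> (\<forall>y\<in>T. F (chart_inv c y) = g y)"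
      using open_chart_image[OF c W(1)] p W(2) by (intro exI conjI) auto
  qed
qed

lemma smooth_map_cong:
  assumes "open U" "smooth_map A U F" "\<And>p. p \<in> U \<Longrightarrow> G p = F p"
  shows "smooth_map A U G"
  using assms by (intro smooth_map_local) blast

section \<open>Closure properties of smooth functions on the manifold\<close>

lemma smooth_map_const: "smooth_map A U (\<lambda>p. k)"
  unfolding smooth_map_def by (simp add: smooth_on_const)

lemma smooth_map_linear:
  "bounded_linear L \<Longrightarrow> open U \<Longrightarrow> smooth_map A U F \<Longrightarrow> smooth_map A U (\<lambda>p. L (F p))"
  unfolding smooth_map_def by (intro ballI smooth_on_linear[of L] open_chart_image) auto

lemma smooth_map_add:
  "open U \<Longrightarrow> smooth_map A U F \<Longrightarrow> smooth_map A U G \<Longrightarrow> smooth_map A U (\<lambda>p. F p + G p)"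
  unfolding smooth_map_def by (intro ballI smooth_on_add open_chart_image) auto

lemma smooth_map_diff:
  "open U \<Longrightarrow> smooth_map A U F \<Longrightarrow> smooth_map A U G \<Longrightarrow> smooth_map A U (\<lambda>p. F p - G p)"
  unfolding smooth_map_def by (intro ballI smooth_on_diff open_chart_image) auto

lemma smooth_map_minus: "open U \<Longrightarrow> smooth_map A U F \<Longrightarrow> smooth_map A U (\<lambda>p. - F p)"
  unfolding smooth_map_def by (intro ballI smooth_on_minus open_chart_image) auto

lemma smooth_map_scaleR:
  "open U \<Longrightarrow> smooth_map A U F \<Longrightarrow> smooth_map A U G \<Longrightarrow> smooth_map A U (\<lambda>p. F p *\<^sub>R G p)"
  unfolding smooth_map_def by (intro ballI smooth_on_scaleR open_chart_image) auto

lemma smooth_map_mult: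
  fixes F G :: "'a \<Rightarrow> real"
  shows "open U \<Longrightarrow> smooth_map A U F \<Longrightarrow> smooth_map A U G \<Longrightarrow> smooth_map A U (\<lambda>p. F p * G p)"
  unfolding smooth_map_def by (intro ballI smooth_on_mult open_chart_image) auto

lemma smooth_map_divide:
  fixes F G :: "'a \<Rightarrow> real"
  assumes "open U" "\<And>p. p \<in> U \<Longrightarrow> G p \<noteq> 0" "smooth_map A U F" "smooth_map A U G"
  shows "smooth_map A U (\<lambda>p. F p / G p)"
  unfolding smooth_map_def
proof
  fix c assume c: "c \<in> A"
  then show "smooth_on (snd c ` (fst c \<inter> U)) (\<lambda>x. F (chart_inv c x) / G (chart_inv c x))"
    using assms chart_inv_chart[OF c] unfolding smooth_map_def
    by (intro smooth_on_divide open_chart_image) auto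
qed

lemma smooth_map_sum:
  "open U \<Longrightarrow> (\<And>k. k \<in> K \<Longrightarrow> smooth_map A U (F k)) \<Longrightarrow> smooth_map A U (\<lambda>p. \<Sum>k\<in>K. F k p)"
  unfolding smooth_map_def by (intro ballI smooth_on_sum open_chart_image) auto

lemma smooth_map_vec_nth: "open U \<Longrightarrow> smooth_map A U F \<Longrightarrow> smooth_map A U (\<lambda>p. F p $ i)"
  unfolding smooth_map_def by (intro ballI smooth_on_vec_nth open_chart_image) auto

lemma smooth_map_vec_lambda:
  "open U \<Longrightarrow> (\<And>i. smooth_map A U (F i)) \<Longrightarrow> smooth_map A U (\<lambda>p. \<chi> i. F i p)"
  unfolding smooth_map_def by (intro ballI smooth_on_vec_lambda open_chart_image) auto

lemma smooth_map_transpose: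
  fixes F :: "'a \<Rightarrow> real^'m::finite^'k::finite"
  shows "open U \<Longrightarrow> smooth_map A U F \<Longrightarrow> smooth_map A U (\<lambda>p. transpose (F p))"
  unfolding smooth_map_def by (intro ballI smooth_on_transpose open_chart_image) auto

lemma smooth_map_matrix_mult:
  fixes F :: "'a \<Rightarrow> real^'m::finite^'k::finite" and G :: "'a \<Rightarrow> real^'l::finite^'m"
  shows "open U \<Longrightarrow> smooth_map A U F \<Longrightarrow> smooth_map A U G \<Longrightarrow> smooth_map A U (\<lambda>p. F p ** G p)"
  unfolding smooth_map_def by (intro ballI smooth_on_matrix_mult open_chart_image) auto

lemma smooth_map_compose:
  fixes F :: "'a \<Rightarrow> 'b::euclidean_space"
  assumes "open U" "F ` U \<subseteq> T" "smooth_map A U F" "smooth_on T G"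
  shows "smooth_map A U (\<lambda>p. G (F p))"
  unfolding smooth_map_def
proof
  fix c assume c: "c \<in> A"
  show "smooth_on (snd c ` (fst c \<inter> U)) (\<lambda>x. G (F (chart_inv c x)))"
    using assms(2,3) c chart_inv_chart[OF c] unfolding smooth_map_def
    by (intro smooth_on_compose[OF open_chart_image[OF c assms(1)] _ _ assms(4)]) auto
qed

lemma smooth_map_chart: "c \<in> A \<Longrightarrow> smooth_map A (fst c) (snd c)"
  unfolding smooth_map_def using smooth_transition by (simp add: comp_def)

lemma smooth_map_continuous_on:
  assumes "smooth_map A U F" "U \<subseteq> M" "open U"
  shows "continuous_on U F"
proof -
  have "isCont F p" if p: "p \<in> U" for p
  proof -
    obtain c where c: "c \<in> A" "p \<in> fst c" using p assms(2) Union_charts by blast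
    let ?W = "fst c \<inter> U"
    have "continuous_on (snd c ` ?W) (\<lambda>x. F (chart_inv c x))"
      using assms(1) c(1) smooth_on_continuous unfolding smooth_map_def by blast
    moreover have "continuous_on ?W (snd c)"
      by (rule continuous_on_subset[of "fst c"])
        (use chart_homeomorphism[OF c(1)] in \<open>auto simp: homeomorphism_def\<close>)
    ultimately have "continuous_on ?W (\<lambda>q. F (chart_inv c (snd c q)))"
      by (rule continuous_on_compose2[where t = "snd c ` ?W"]) simp
    then have "continuous_on ?W F"
      by (rule continuous_on_eq) (simp add: chart_inv_chart[OF c(1)])
    then show ?thesis
      using p c open_chart_domain[OF c(1)] assms(3) by (simp add: continuous_on_eq_continuous_at open_Int)
  qed
  then show ?thesis by (simp add: continuous_at_imp_continuous_on)
qed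

subsection \<open>Jacobians\<close>

lemma has_derivative_transition:
  assumes "c \<in> A" "d \<in> A" "p \<in> fst c" "p \<in> fst d"
  shows "((snd d \<circ> chart_inv c) has_derivative (*v) (jac c d p)) (at (snd c p))"
proof -
  have D: "((snd d \<circ> chart_inv c) has_derivative frechet_derivative (snd d \<circ> chart_inv c) (at (snd c p))) (at (snd c p))"
    by (rule smooth_on_has_derivative[OF smooth_transition[OF assms(1,2)]]) (use assms in auto)
  have "frechet_derivative (snd d \<circ> chart_inv c) (at (snd c p)) = (*v) (jac c d p)"
    unfolding jac_def using has_derivative_linear[OF D] by (auto simp: matrix_works)
  then show ?thesis using D by metis
qed

lemma jac_refl:
  assumes "c \<in> A" "p \<in> fst c"
  shows "jac c c p = mat 1"
proof -
  have "((\<lambda>x. x) has_derivative (\<lambda>x. x)) (at (snd c p))" by (rule has_derivative_ident)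
  then have "((snd c \<circ> chart_inv c) has_derivative (\<lambda>x. x)) (at (snd c p))"
    by (rule has_derivative_transform_within_open[OF _ open_chart_range[OF assms(1)]])
      (use assms chart_inv_chart[OF assms(1)] in auto)
  then have "(*v) (jac c c p) = (\<lambda>x. x)"
    using has_derivative_transition[OF assms(1,1,2,2)] has_derivative_unique by blast
  then show ?thesis by (simp add: matrix_eq fun_eq_iff)
qed

lemma jac_comp:
  assumes "b \<in> A" "c \<in> A" "d \<in> A" "p \<in> fst b" "p \<in> fst c" "p \<in> fst d"
  shows "jac c d p ** jac b c p = jac b d p"
proof -
  let ?S = "snd b ` (fst b \<inter> (fst c \<inter> fst d))"
  have S: "open ?S" using assms open_chart_image open_chart_domain by (meson open_Int)
  have x: "(snd c \<circ> chart_inv b) (snd b p) = snd c p" using assms by (simp add: chart_inv_chart)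
  have "((\<lambda>x. (snd d \<circ> chart_inv c) ((snd c \<circ> chart_inv b) x)) has_derivative
      (\<lambda>v. jac c d p *v (jac b c p *v v))) (at (snd b p))"
    by (rule has_derivative_compose[OF has_derivative_transition[OF assms(1,2,4,5)]],
        unfold x, rule has_derivative_transition[OF assms(2,3,5,6)])
  then have "((snd d \<circ> chart_inv b) has_derivative (\<lambda>v. jac c d p *v (jac b c p *v v))) (at (snd b p))"
    by (rule has_derivative_transform_within_open[OF _ S]) (use assms in \<open>auto simp: chart_inv_chart[OF assms(1)] chart_inv_chart[OF assms(2)]\<close>)
  then have "(*v) (jac b d p) = (\<lambda>v. jac c d p *v (jac b c p *v v))"
    using has_derivative_transition[OF assms(1,3,4,6)] has_derivative_unique by blast
  then show ?thesis by (simp add: matrix_eq fun_eq_iff matrix_vector_mul_assoc)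
qed

lemma jac_inverse:
  assumes "c \<in> A" "d \<in> A" "p \<in> fst c" "p \<in> fst d"
  shows "jac d c p ** jac c d p = mat 1"
  using jac_comp[OF assms(1,2,1,3,4,3)] jac_refl[OF assms(1,3)] by simp

lemma smooth_map_jac:
  assumes "c \<in> A" "d \<in> A"
  shows "smooth_map A (fst c \<inter> fst d) (jac c d)"
proof -
  have o: "open (fst c \<inter> fst d)" using assms open_chart_domain by blast
  have S: "open (snd c ` (fst c \<inter> fst d))" using open_chart_image[OF assms(1)] open_chart_domain[OF assms(2)] .
  show ?thesis
  proof (rule smooth_map_chartI[OF assms(1) o])
    have "smooth_on (snd c ` (fst c \<inter> fst d)) (\<lambda>x. matrix (frechet_derivative (snd d \<circ> chart_inv c) (at x)))"
      by (rule smooth_on_matrix_frechet_derivative[OF S smooth_transition[OF assms]])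
    then show "smooth_on (snd c ` (fst c \<inter> fst d)) (\<lambda>x. jac c d (chart_inv c x))"
      by (rule smooth_on_cong[OF S, rotated]) (auto simp: jac_def chart_inv_chart[OF assms(1)])
  qed simp
qed

end

subsection \<open>Symmetric forms in a frame\<close>

lemma transpose_add: "transpose (S + T) = transpose S + (transpose T :: real^'m^'n)"
  by (simp add: transpose_def vec_eq_iff)

lemma congruence_lincomb:
  fixes P S T :: "real^'n::finite^'n"
  shows "transpose P ** (a *\<^sub>R S + b *\<^sub>R T) ** P = a *\<^sub>R (transpose P ** S ** P) + b *\<^sub>R (transpose P ** T ** P)"
  by (simp add: vec_eq_iff matrix_matrix_mult_def transpose_def sum_distrib_left sum_distrib_right
      sum.distrib algebra_simps)

lemma congruence_congruence:
  fixes P Q S :: "real^'n::finite^'n"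
  shows "transpose Q ** (transpose P ** S ** P) ** Q = transpose (P ** Q) ** S ** (P ** Q)"
  by (simp add: matrix_transpose_mul matrix_mul_assoc)

lemma congruence_symmetric:
  fixes P S :: "real^'n::finite^'n"
  shows "transpose S = S \<Longrightarrow> transpose (transpose P ** S ** P) = transpose P ** S ** P"
  by (simp add: matrix_transpose_mul matrix_mul_assoc)

lemma sym2D:
  assumes "t \<in> sym2 A p"
  shows "c \<notin> charts_at A p \<Longrightarrow> t c = 0"
    and "c \<in> charts_at A p \<Longrightarrow> transpose (t c) = t c"
    and "c \<in> charts_at A p \<Longrightarrow> d \<in> charts_at A p \<Longrightarrow> t c = transpose (jac c d p) ** t d ** jac c d p"
  using assms unfolding sym2_def by blast+

lemma sym2_lincomb:
  assumes "s \<in> sym2 A p" "t \<in> sym2 A p"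
  shows "(\<lambda>c. a *\<^sub>R s c + b *\<^sub>R t c) \<in> sym2 A p"
  unfolding sym2_def
proof (intro CollectI conjI ballI allI impI)
  fix c d assume cd: "c \<in> charts_at A p" "d \<in> charts_at A p"
  show "a *\<^sub>R s c + b *\<^sub>R t c = transpose (jac c d p) ** (a *\<^sub>R s d + b *\<^sub>R t d) ** jac c d p"
    unfolding congruence_lincomb using sym2D(3)[OF assms(1) cd] sym2D(3)[OF assms(2) cd] by simp
qed (simp_all add: sym2D(1,2)[OF assms(1)] sym2D(1,2)[OF assms(2)] transpose_add transpose_scalar)

lemma sym2_zero: "(\<lambda>c. 0) \<in> sym2 A p"
  unfolding sym2_def by (auto simp: vec_eq_iff matrix_matrix_mult_def transpose_def)

lemma sym2_sum:
  "finite K \<Longrightarrow> (\<And>k. k \<in> K \<Longrightarrow> s k \<in> sym2 A p) \<Longrightarrow> (\<lambda>c. \<Sum>k\<in>K. a k *\<^sub>R s k c) \<in> sym2 A p"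
proof (induction K rule: finite_induct)
  case (insert k K)
  then show ?case using sym2_lincomb[of "s k" A p "\<lambda>c. \<Sum>k\<in>K. a k *\<^sub>R s k c" "a k" 1] by simp
qed (simp add: sym2_zero)

text \<open>The component matrix of \<open>t\<close> in the frame of \<open>e\<close>. A tensor
  stores components for charts of \<open>A\<close> only, so for another \<open>e\<close> they are
  transformed from an arbitrarily chosen chart at \<open>p\<close>; \<open>coord_eq\<close> shows
  that the choice is immaterial.\<close>

definition coord :: "('a, 'n::finite) chart set \<Rightarrow> ('a, 'n) chart \<Rightarrow> 'a \<Rightarrow> ('a, 'n) form \<Rightarrow> real^'n^'n" where
  "coord A e p t = (let d = (SOME d. d \<in> charts_at A p) in transpose (jac e d p) ** t d ** jac e d p)"

lemma coord_lincomb: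
  "coord A e p (\<lambda>c. a *\<^sub>R s c + b *\<^sub>R t c) = a *\<^sub>R coord A e p s + b *\<^sub>R coord A e p t"
  unfolding coord_def Let_def by (rule congruence_lincomb)

lemma form_of_lincomb:
  "form_of A e p (a *\<^sub>R S + b *\<^sub>R T) = (\<lambda>c. a *\<^sub>R form_of A e p S c + b *\<^sub>R form_of A e p T c)"
  unfolding form_of_def by (simp add: fun_eq_iff congruence_lincomb)

lemma form_of_sum:
  assumes "finite K"
  shows "form_of A e p (\<Sum>k\<in>K. a k *\<^sub>R S k) = (\<lambda>c. \<Sum>k\<in>K. a k *\<^sub>R form_of A e p (S k) c)"
  using assms
proof (induction K rule: finite_induct)
  case empty
  show ?case using form_of_lincomb[of A e p 0 0 0 0] by simp
next
  case (insert k K)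
  then show ?case using form_of_lincomb[of A e p "a k" "S k" 1 "\<Sum>k\<in>K. a k *\<^sub>R S k"] by simp
qed

text \<open>The index runs over ordered pairs, so an off-diagonal position is counted twice; the
  factor 1/2 compensates for this in \<open>symmetric_matrix_expansion\<close> and no order on the
  index type is required.\<close>

definition sym_unit :: "'n \<times> 'n \<Rightarrow> real^'n^'n" where
  "sym_unit k = (\<chi> a b. ((if k = (a, b) then 1 else 0) + (if k = (b, a) then 1 else 0)) / 2)"

lemma transpose_sym_unit: "transpose (sym_unit k) = sym_unit k"
  unfolding sym_unit_def transpose_def by (simp add: add.commute)
lemma symmetric_matrix_expansion:
  fixes S :: "real^'n::finite^'n"
  assumes "transpose S = S"
  shows "S = (\<Sum>k\<in>UNIV. S $ fst k $ snd k *\<^sub>R sym_unit k)"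
proof -
  have sym: "S $ i $ j = S $ j $ i" for i j
    using arg_cong[OF assms, of "\<lambda>S. S $ j $ i"] by (simp add: transpose_def)
  have "(\<Sum>k\<in>UNIV. S $ fst k $ snd k *\<^sub>R sym_unit k) $ a $ b = S $ a $ b" for a b
  proof -
    have "(\<Sum>k\<in>UNIV. S $ fst k $ snd k *\<^sub>R sym_unit k) $ a $ b =
        (\<Sum>k\<in>UNIV. S $ fst k $ snd k * sym_unit k $ a $ b)"
      by (simp add: sum_component)
    also have "\<dots> = (\<Sum>k\<in>UNIV. (if k = (a, b) then S $ a $ b / 2 else 0) + (if k = (b, a) then S $ b $ a / 2 else 0))"
    proof (rule sum.cong[OF refl])
      fix k :: "'n \<times> 'n"
      show "S $ fst k $ snd k * sym_unit k $ a $ b =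
          (if k = (a, b) then S $ a $ b / 2 else 0) + (if k = (b, a) then S $ b $ a / 2 else 0)"
        by (cases "k = (a, b)"; cases "k = (b, a)") (unfold sym_unit_def, simp_all add: sym[of b a] del: prod.inject)
    qed
    also have "\<dots> = S $ a $ b" by (simp add: sum.distrib sym[of b a])
    finally show ?thesis .
  qed
  then show ?thesis by (simp add: vec_eq_iff)
qed

text \<open>\<open>e\<close> is a smooth chart that need not belong to the atlas \<open>A\<close> defining the tensors.\<close>

locale compatible_chart = smooth_atlas M A
  for M :: "'a::{t2_space, second_countable_topology} set" and A :: "('a, 'n::finite) chart set" +
  fixes e :: "('a, 'n) chart"
  assumes atlas_insert: "smooth_manifold M (insert e A)"
begin

sublocale ext: smooth_atlas M "insert e A"
  by unfold_locales (rule atlas_insert)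

lemma domain_subset: "fst e \<subseteq> M"
  using ext.Union_charts by blast

lemma charts_at_domain: "p \<in> fst e \<Longrightarrow> \<exists>d. d \<in> charts_at A p"
  using charts_at_nonempty domain_subset by blast

text \<open>The larger atlas contains one more chart in which smoothness must hold, but around each
  point a chart of \<open>A\<close> already decides it.\<close>

lemma smooth_map_ext:
  assumes "smooth_map A U F" "open U" "U \<subseteq> M"
  shows "smooth_map (insert e A) U F"
proof (rule ext.smooth_map_local)
  fix p assume p: "p \<in> U"
  obtain c where c: "c \<in> A" "p \<in> fst c" using p assms(3) Union_charts by blast
  let ?W = "fst c \<inter> U"
  have o: "open ?W" using open_chart_domain[OF c(1)] assms(2) by blast
  have "smooth_map (insert e A) ?W F"
    by (rule ext.smooth_map_chartI[of c]) (use c o assms(1) in \<open>auto simp: smooth_map_def\<close>)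
  then show "\<exists>W G. open W \<and> p \<in> W \<and> smooth_map (insert e A) W G \<and> (\<forall>q\<in>W. F q = G q)"
    using o p c by blast
qed

lemma smooth_map_restrict_atlas: "smooth_map (insert e A) U F \<Longrightarrow> smooth_map A U F"
  unfolding smooth_map_def by blast

lemma smooth_map_jac_ext: "c \<in> insert e A \<Longrightarrow> d \<in> insert e A \<Longrightarrow> smooth_map A (fst c \<inter> fst d) (jac c d)"
  by (rule smooth_map_restrict_atlas[OF ext.smooth_map_jac])

lemma coord_eq:
  assumes "t \<in> sym2 A p" "p \<in> fst e" "d \<in> charts_at A p"
  shows "coord A e p t = transpose (jac e d p) ** t d ** jac e d p"
proof -
  define d' where "d' = (SOME d. d \<in> charts_at A p)"
  have d': "d' \<in> charts_at A p" unfolding d'_def using someI[of "\<lambda>d. d \<in> charts_at A p", OF assms(3)] .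
  have "coord A e p t = transpose (jac e d' p) ** t d' ** jac e d' p"
    by (simp add: coord_def Let_def d'_def)
  also have "t d' = transpose (jac d' d p) ** t d ** jac d' d p"
    using assms d' unfolding sym2_def by blast
  also have "transpose (jac e d' p) ** (transpose (jac d' d p) ** t d ** jac d' d p) ** jac e d' p =
      transpose (jac e d p) ** t d ** jac e d p"
    unfolding congruence_congruence using assms d' ext.jac_comp[of e d' d p] by (simp add: charts_at_def)
  finally show ?thesis .
qed

lemma transpose_coord:
  assumes "t \<in> sym2 A p" "p \<in> fst e"
  shows "transpose (coord A e p t) = coord A e p t"
proof -
  obtain d where d: "d \<in> charts_at A p" using charts_at_domain assms(2) by blast
  show ?thesis
    unfolding coord_eq[OF assms d] by (intro congruence_symmetric sym2D(2)[OF assms(1) d])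
qed

lemma form_of_sym2:
  assumes "transpose S = S" "p \<in> fst e"
  shows "form_of A e p S \<in> sym2 A p"
  unfolding sym2_def
proof (intro CollectI conjI ballI allI impI)
  fix c d assume cd: "c \<in> charts_at A p" "d \<in> charts_at A p"
  show "form_of A e p S c = transpose (jac c d p) ** form_of A e p S d ** jac c d p"
    using cd assms(2) ext.jac_comp[of c d e p]
    by (simp add: form_of_def congruence_congruence charts_at_def)
qed (auto simp: form_of_def congruence_symmetric[OF assms(1)])

lemma coord_form_of:
  assumes "transpose S = S" "p \<in> fst e"
  shows "coord A e p (form_of A e p S) = S"
proof -
  obtain d where d: "d \<in> charts_at A p" using charts_at_domain assms(2) by blast
  show ?thesis
    unfolding coord_eq[OF form_of_sym2[OF assms] assms(2) d]
    using assms d ext.jac_inverse[of e d p] by (simp add: form_of_def congruence_congruence charts_at_def)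
qed

lemma form_of_coord:
  assumes "t \<in> sym2 A p" "p \<in> fst e"
  shows "form_of A e p (coord A e p t) = t"
proof
  fix d
  show "form_of A e p (coord A e p t) d = t d"
  proof (cases "d \<in> charts_at A p")
    case True
    then show ?thesis
      unfolding coord_eq[OF assms True] using assms ext.jac_inverse[of d e p]
      by (simp add: form_of_def congruence_congruence charts_at_def)
  next
    case False
    then show ?thesis using sym2D(1)[OF assms(1)] by (auto simp: form_of_def)
  qed
qed

end

context smooth_atlas
begin

lemma compatible_chart_self: "c \<in> A \<Longrightarrow> compatible_chart M A c"
  by unfold_locales (simp add: insert_absorb atlas)

lemma coord_chart:
  assumes "c \<in> charts_at A p" "t \<in> sym2 A p"
  shows "coord A c p t = t c"
proof -
  interpret compatible_chart M A c using assms by (intro compatible_chart_self) (simp add: charts_at_def)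
  show ?thesis
    using assms coord_eq[OF assms(2) _ assms(1)] jac_refl[of c p] by (simp add: charts_at_def)
qed

end

subsection \<open>Smooth sections and smooth bundle automorphisms\<close>

definition smooth_section ::
  "('a, 'n::finite) chart set \<Rightarrow> 'a set \<Rightarrow> ('a \<Rightarrow> ('a, 'n) form) \<Rightarrow> bool" where
  "smooth_section A W h \<longleftrightarrow>
     (\<forall>p\<in>W. h p \<in> sym2 A p) \<and> (\<forall>c\<in>A. smooth_map A (fst c \<inter> W) (\<lambda>p. h p c))"

definition sym2_linear ::
  "('a, 'n::finite) chart set \<Rightarrow> 'a \<Rightarrow> (('a, 'n) form \<Rightarrow> ('a, 'n) form) \<Rightarrow> bool" where
  "sym2_linear A p F \<longleftrightarrow> (\<forall>t\<in>sym2 A p. F t \<in> sym2 A p) \<and>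
     (\<forall>s\<in>sym2 A p. \<forall>t\<in>sym2 A p. \<forall>a b.
        F (\<lambda>c. a *\<^sub>R s c + b *\<^sub>R t c) = (\<lambda>c. a *\<^sub>R F s c + b *\<^sub>R F t c))"

text \<open>Unlike in \<open>bundle_endos\<close>, values outside \<open>U\<close> or off the fibres are unconstrained, and
  smoothness is the chart-free condition that smooth sections go to smooth sections.\<close>

definition smooth_endo ::
  "('a, 'n::finite) chart set \<Rightarrow> 'a::topological_space set \<Rightarrow> ('a \<Rightarrow> ('a, 'n) form \<Rightarrow> ('a, 'n) form) \<Rightarrow> bool" where
  "smooth_endo A U \<phi> \<longleftrightarrow> (\<forall>p\<in>U. sym2_linear A p (\<phi> p)) \<and>
     (\<forall>W h. open W \<longrightarrow> W \<subseteq> U \<longrightarrow> smooth_section A W h \<longrightarrow> smooth_section A W (\<lambda>p. \<phi> p (h p)))"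

definition smooth_aut ::
  "('a, 'n::finite) chart set \<Rightarrow> 'a::topological_space set \<Rightarrow> ('a \<Rightarrow> ('a, 'n) form \<Rightarrow> ('a, 'n) form) \<Rightarrow> bool" where
  "smooth_aut A U \<phi> \<longleftrightarrow> smooth_endo A U \<phi> \<and>
     (\<exists>\<psi>. smooth_endo A U \<psi> \<and> (\<forall>p\<in>U. \<forall>t\<in>sym2 A p. \<phi> p (\<psi> p t) = t \<and> \<psi> p (\<phi> p t) = t))"

text \<open>An inverse fixed at each point by the fibre map alone, so that inverses found over
  different open sets agree on the overlaps.\<close>

definition aut_inv ::
  "('a, 'n::finite) chart set \<Rightarrow> ('a \<Rightarrow> ('a, 'n) form \<Rightarrow> ('a, 'n) form) \<Rightarrow> 'a \<Rightarrow> ('a, 'n) form \<Rightarrow> ('a, 'n) form" where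
  "aut_inv A \<phi> = (\<lambda>p. inv_into (sym2 A p) (\<phi> p))"

lemma smooth_section_subset: "smooth_section A W h \<Longrightarrow> W' \<subseteq> W \<Longrightarrow> smooth_section A W' h"
  unfolding smooth_section_def by (meson Int_mono order_refl smooth_map_subset subsetD)

lemma sym2_linearD:
  assumes "sym2_linear A p F"
  shows "t \<in> sym2 A p \<Longrightarrow> F t \<in> sym2 A p"
    and "s \<in> sym2 A p \<Longrightarrow> t \<in> sym2 A p \<Longrightarrow>
      F (\<lambda>c. a *\<^sub>R s c + b *\<^sub>R t c) = (\<lambda>c. a *\<^sub>R F s c + b *\<^sub>R F t c)"
  using assms unfolding sym2_linear_def by blast+

lemma sym2_linear_sum:
  assumes F: "sym2_linear A p F" and K: "finite K" "\<And>k. k \<in> K \<Longrightarrow> s k \<in> sym2 A p"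
  shows "F (\<lambda>c. \<Sum>k\<in>K. a k *\<^sub>R s k c) = (\<lambda>c. \<Sum>k\<in>K. a k *\<^sub>R F (s k) c)"
  using K
proof (induction K rule: finite_induct)
  case empty
  show ?case using sym2_linearD(2)[OF F sym2_zero sym2_zero, of 0 0] by simp
next
  case (insert k K)
  then show ?case
    using sym2_linearD(2)[OF F, of "s k" "\<lambda>c. \<Sum>k\<in>K. a k *\<^sub>R s k c" "a k" 1] sym2_sum[of K s A p a] by simp
qed

lemma sym2_linear_cong:
  assumes "sym2_linear A p F" "\<And>t. t \<in> sym2 A p \<Longrightarrow> G t = F t"
  shows "sym2_linear A p G"
  using assms sym2_lincomb[of _ A p] unfolding sym2_linear_def by simp

lemma smooth_endo_subset: "smooth_endo A U \<phi> \<Longrightarrow> W \<subseteq> U \<Longrightarrow> smooth_endo A W \<phi>"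
  unfolding smooth_endo_def by (meson subset_trans subsetD)

lemma smooth_endoI:
  assumes "\<And>p. p \<in> U \<Longrightarrow> sym2_linear A p (\<phi> p)"
    and "\<And>W h. open W \<Longrightarrow> W \<subseteq> U \<Longrightarrow> smooth_section A W h \<Longrightarrow> smooth_section A W (\<lambda>p. \<phi> p (h p))"
  shows "smooth_endo A U \<phi>"
  unfolding smooth_endo_def by (intro conjI ballI allI impI assms)

lemma smooth_endo_linear: "smooth_endo A U \<phi> \<Longrightarrow> p \<in> U \<Longrightarrow> sym2_linear A p (\<phi> p)"
  unfolding smooth_endo_def by (elim conjE bspec)

lemma smooth_endo_sym2: "smooth_endo A U \<phi> \<Longrightarrow> p \<in> U \<Longrightarrow> t \<in> sym2 A p \<Longrightarrow> \<phi> p t \<in> sym2 A p"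
  by (rule sym2_linearD(1)[OF smooth_endo_linear])

lemma smooth_endo_section:
  "smooth_endo A U \<phi> \<Longrightarrow> open W \<Longrightarrow> W \<subseteq> U \<Longrightarrow> smooth_section A W h \<Longrightarrow> smooth_section A W (\<lambda>p. \<phi> p (h p))"
  unfolding smooth_endo_def by (elim conjE allE impE)

lemma smooth_endo_id: "smooth_endo A U (\<lambda>p t. t)"
  unfolding smooth_endo_def sym2_linear_def by simp

lemma smooth_endo_comp:
  assumes "smooth_endo A U \<phi>" "smooth_endo A U \<psi>"
  shows "smooth_endo A U (\<lambda>p t. \<phi> p (\<psi> p t))"
proof -
  show ?thesis
  proof (rule smooth_endoI)
    fix p assume p: "p \<in> U"
    note F = sym2_linearD[OF smooth_endo_linear[OF assms(1) p]]
    note G = sym2_linearD[OF smooth_endo_linear[OF assms(2) p]]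
    show "sym2_linear A p (\<lambda>t. \<phi> p (\<psi> p t))"
      unfolding sym2_linear_def by (intro conjI ballI allI) (simp_all add: F G)
  next
    fix W h assume "open W" "W \<subseteq> U" "smooth_section A W h"
    then show "smooth_section A W (\<lambda>p. \<phi> p (\<psi> p (h p)))"
      by (intro smooth_endo_section[OF assms(1)] smooth_endo_section[OF assms(2)])
  qed
qed

lemma smooth_autI:
  assumes "smooth_endo A U \<phi>" "smooth_endo A U \<psi>"
    and "\<And>p t. p \<in> U \<Longrightarrow> t \<in> sym2 A p \<Longrightarrow> \<phi> p (\<psi> p t) = t"
    and "\<And>p t. p \<in> U \<Longrightarrow> t \<in> sym2 A p \<Longrightarrow> \<psi> p (\<phi> p t) = t"
  shows "smooth_aut A U \<phi>"
  unfolding smooth_aut_def by (intro conjI exI[of _ \<psi>] ballI assms)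

lemma smooth_aut_endo: "smooth_aut A U \<phi> \<Longrightarrow> smooth_endo A U \<phi>"
  unfolding smooth_aut_def by (rule conjunct1)

lemmas smooth_aut_sym2 = smooth_endo_sym2[OF smooth_aut_endo]

lemma aut_inv_eq:
  assumes "\<And>t. t \<in> sym2 A p \<Longrightarrow> \<psi> t \<in> sym2 A p \<and> \<phi> p (\<psi> t) = t \<and> \<psi> (\<phi> p t) = t" "t \<in> sym2 A p"
  shows "aut_inv A \<phi> p t = \<psi> t"
  unfolding aut_inv_def
  by (rule inv_into_f_eq) (use assms in \<open>auto intro: inj_on_inverseI[where g = \<psi>]\<close>)

lemma smooth_aut_subset: "smooth_aut A U \<phi> \<Longrightarrow> W \<subseteq> U \<Longrightarrow> smooth_aut A W \<phi>"
  unfolding smooth_aut_def by (meson smooth_endo_subset subsetD)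

lemma smooth_aut_id: "smooth_aut A U (\<lambda>p t. t)"
  by (rule smooth_autI[OF smooth_endo_id smooth_endo_id]) simp_all

section \<open>Locality, composition and inversion of smooth bundle maps\<close>

context smooth_atlas
begin

lemma sections_iff:
  assumes "open U"
  shows "h \<in> sections A U \<longleftrightarrow> h \<in> extensional U \<and> smooth_section A U h"
proof -
  have "smooth_on (snd c ` (fst c \<inter> U)) (\<lambda>x. h (chart_inv c x) c) \<longleftrightarrow> smooth_map A (fst c \<inter> U) (\<lambda>p. h p c)"
    if c: "c \<in> A" for c
    using smooth_map_chartI[OF c, of "fst c \<inter> U" "\<lambda>p. h p c"] smooth_map_chartD[OF c, of "fst c \<inter> U" "\<lambda>p. h p c"]
      open_chart_domain[OF c] assms by blast
  then show ?thesis
    unfolding sections_def smooth_section_def PiE_iff by blast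
qed

lemma smooth_section_local:
  assumes "\<And>p. p \<in> U \<Longrightarrow> \<exists>W g. open W \<and> p \<in> W \<and> smooth_section A W g \<and> (\<forall>q\<in>W. h q = g q)"
  shows "smooth_section A U h"
  unfolding smooth_section_def
proof (intro conjI ballI)
  fix p assume "p \<in> U"
  then show "h p \<in> sym2 A p" using assms[of p] unfolding smooth_section_def by metis
next
  fix c assume c: "c \<in> A"
  show "smooth_map A (fst c \<inter> U) (\<lambda>p. h p c)"
  proof (rule smooth_map_local)
    fix p assume p: "p \<in> fst c \<inter> U"
    then obtain W g where W: "open W" "p \<in> W" "smooth_section A W g" "\<forall>q\<in>W. h q = g q"
      using assms[of p] by blast
    have "smooth_map A (fst c \<inter> W) (\<lambda>p. g p c)" using W(3) c unfolding smooth_section_def by blast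
    then show "\<exists>W G. open W \<and> p \<in> W \<and> smooth_map A W G \<and> (\<forall>q\<in>W. h q c = G q)"
      using p W open_chart_domain[OF c]
      by (intro exI[of _ "fst c \<inter> W"] exI[of _ "\<lambda>p. g p c"]) auto
  qed
qed

lemma smooth_section_cong:
  "open U \<Longrightarrow> smooth_section A U g \<Longrightarrow> (\<And>p. p \<in> U \<Longrightarrow> h p = g p) \<Longrightarrow> smooth_section A U h"
  by (rule smooth_section_local) blast

lemma smooth_section_sum:
  assumes "finite K" "open W"
    and "\<And>k. k \<in> K \<Longrightarrow> smooth_map A W (a k)" "\<And>k. k \<in> K \<Longrightarrow> smooth_section A W (s k)"
  shows "smooth_section A W (\<lambda>p c. \<Sum>k\<in>K. a k p *\<^sub>R s k p c)"
  unfolding smooth_section_def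
proof (intro conjI ballI)
  fix p assume "p \<in> W"
  then show "(\<lambda>c. \<Sum>k\<in>K. a k p *\<^sub>R s k p c) \<in> sym2 A p"
    using assms unfolding smooth_section_def by (intro sym2_sum) auto
next
  fix c assume c: "c \<in> A"
  have o: "open (fst c \<inter> W)" using open_chart_domain[OF c] assms(2) by blast
  show "smooth_map A (fst c \<inter> W) (\<lambda>p. \<Sum>k\<in>K. a k p *\<^sub>R s k p c)"
    using assms(3,4) c unfolding smooth_section_def
    by (intro smooth_map_sum smooth_map_scaleR o smooth_map_subset[OF assms(3)]) auto
qed

lemma smooth_endo_local:
  assumes "\<And>p. p \<in> U \<Longrightarrow> \<exists>W \<xi>. open W \<and> p \<in> W \<and> smooth_endo A W \<xi> \<and> (\<forall>q\<in>W. \<forall>t\<in>sym2 A q. \<phi> q t = \<xi> q t)"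
  shows "smooth_endo A U \<phi>"
proof (rule smooth_endoI)
  fix p assume "p \<in> U"
  from assms[OF this] obtain W \<xi> where W: "p \<in> W" "smooth_endo A W \<xi>" "\<forall>q\<in>W. \<forall>t\<in>sym2 A q. \<phi> q t = \<xi> q t"
    by (elim exE conjE)
  show "sym2_linear A p (\<phi> p)"
    by (rule sym2_linear_cong[OF smooth_endo_linear[OF W(2,1)]]) (simp add: W(1,3))
next
  fix V h assume V: "open V" "V \<subseteq> U" "smooth_section A V h"
  show "smooth_section A V (\<lambda>p. \<phi> p (h p))"
  proof (rule smooth_section_local)
    fix p assume p: "p \<in> V"
    with V(2) have "p \<in> U" by (rule subsetD)
    from assms[OF this] obtain W \<xi> where W: "open W" "p \<in> W" "smooth_endo A W \<xi>" "\<forall>q\<in>W. \<forall>t\<in>sym2 A q. \<phi> q t = \<xi> q t"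
      by (elim exE conjE)
    have o: "open (V \<inter> W)" using V W by (intro open_Int)
    have "smooth_section A (V \<inter> W) (\<lambda>q. \<xi> q (h q))"
      by (rule smooth_endo_section[OF W(3) o Int_lower2 smooth_section_subset[OF V(3) Int_lower1]])
    moreover have "\<forall>q\<in>V \<inter> W. \<phi> q (h q) = \<xi> q (h q)"
      using W(4) V(3) unfolding smooth_section_def by simp
    ultimately show "\<exists>W g. open W \<and> p \<in> W \<and> smooth_section A W g \<and> (\<forall>q\<in>W. \<phi> q (h q) = g q)"
      using p W(2) o by (intro exI[of _ "V \<inter> W"] exI conjI) auto
  qed
qed

lemma smooth_endo_cong:
  "open U \<Longrightarrow> smooth_endo A U \<xi> \<Longrightarrow> (\<And>p t. p \<in> U \<Longrightarrow> t \<in> sym2 A p \<Longrightarrow> \<phi> p t = \<xi> p t) \<Longrightarrow> smooth_endo A U \<phi>"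
  by (rule smooth_endo_local) (intro exI[of _ U] exI[of _ \<xi>] conjI; simp)

lemma aut_inv:
  assumes U: "open U" and \<phi>: "smooth_aut A U \<phi>"
  shows "smooth_endo A U (aut_inv A \<phi>)"
    and "p \<in> U \<Longrightarrow> t \<in> sym2 A p \<Longrightarrow> \<phi> p (aut_inv A \<phi> p t) = t"
    and "p \<in> U \<Longrightarrow> t \<in> sym2 A p \<Longrightarrow> aut_inv A \<phi> p (\<phi> p t) = t"
proof -
  obtain \<psi> where \<psi>: "smooth_endo A U \<psi>" "\<forall>p\<in>U. \<forall>t\<in>sym2 A p. \<phi> p (\<psi> p t) = t \<and> \<psi> p (\<phi> p t) = t"
    using \<phi> unfolding smooth_aut_def by (elim conjE exE)
  have eq: "aut_inv A \<phi> p t = \<psi> p t" if "p \<in> U" "t \<in> sym2 A p" for p t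
    using \<psi>(2) that smooth_endo_sym2[OF \<psi>(1)] by (intro aut_inv_eq) simp_all
  show "smooth_endo A U (aut_inv A \<phi>)" by (rule smooth_endo_cong[OF U \<psi>(1) eq])
  show "\<phi> p (aut_inv A \<phi> p t) = t" if "p \<in> U" "t \<in> sym2 A p" using \<psi>(2) eq that by metis
  show "aut_inv A \<phi> p (\<phi> p t) = t" if "p \<in> U" "t \<in> sym2 A p"
    using \<psi>(2) eq[OF that(1) smooth_aut_sym2[OF \<phi> that]] that by metis
qed

lemma smooth_aut_inv:
  assumes "open U" "smooth_aut A U \<phi>"
  shows "smooth_aut A U (aut_inv A \<phi>)"
  by (rule smooth_autI[OF aut_inv(1)[OF assms] smooth_aut_endo[OF assms(2)] aut_inv(3,2)[OF assms]])

lemma smooth_aut_comp: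
  assumes "open U" "smooth_aut A U \<phi>" "smooth_aut A U \<psi>"
  shows "smooth_aut A U (\<lambda>p t. \<phi> p (\<psi> p t))"
proof (rule smooth_autI)
  note \<phi> = aut_inv[OF assms(1,2)] and \<psi> = aut_inv[OF assms(1,3)]
  show "smooth_endo A U (\<lambda>p t. \<phi> p (\<psi> p t))" "smooth_endo A U (\<lambda>p t. aut_inv A \<psi> p (aut_inv A \<phi> p t))"
    by (rule smooth_endo_comp[OF smooth_aut_endo[OF assms(2)] smooth_aut_endo[OF assms(3)]],
        rule smooth_endo_comp[OF \<psi>(1) \<phi>(1)])
  fix p t assume p: "p \<in> U" "t \<in> sym2 A p"
  show "\<phi> p (\<psi> p (aut_inv A \<psi> p (aut_inv A \<phi> p t))) = t"
    using \<phi>(2) \<psi>(2) p smooth_endo_sym2[OF \<phi>(1)] by simp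
  show "aut_inv A \<psi> p (aut_inv A \<phi> p (\<phi> p (\<psi> p t))) = t"
    using \<phi>(3) \<psi>(3) p smooth_aut_sym2[OF assms(3)] by simp
qed

text \<open>A two-sided inverse is unique on each fibre, so \<open>aut_inv A \<phi>\<close>
  coincides with the inverse of every local representative and is smooth because smoothness is
  local.\<close>

lemma smooth_aut_local:
  assumes loc: "\<And>p. p \<in> U \<Longrightarrow> \<exists>W \<xi>. open W \<and> p \<in> W \<and> smooth_aut A W \<xi> \<and> (\<forall>q\<in>W. \<forall>t\<in>sym2 A q. \<phi> q t = \<xi> q t)"
  shows "smooth_aut A U \<phi>"
proof -
  have *: "\<exists>W \<xi>. open W \<and> p \<in> W \<and> smooth_aut A W \<xi> \<and>
      (\<forall>q\<in>W. \<forall>t\<in>sym2 A q. \<phi> q t = \<xi> q t \<and> aut_inv A \<phi> q t = aut_inv A \<xi> q t)" if "p \<in> U" for p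
  proof -
    from loc[OF \<open>p \<in> U\<close>] obtain W \<xi> where W: "open W" "p \<in> W" "smooth_aut A W \<xi>"
        "\<forall>q\<in>W. \<forall>t\<in>sym2 A q. \<phi> q t = \<xi> q t"
      by (elim exE conjE)
    have "aut_inv A \<phi> q t = aut_inv A \<xi> q t" if "q \<in> W" "t \<in> sym2 A q" for q t
      using W(4) that aut_inv[OF W(1,3)] smooth_endo_sym2[OF aut_inv(1)[OF W(1,3)]]
      by (intro aut_inv_eq) simp_all
    then show ?thesis using W by (intro exI[of _ W] exI[of _ \<xi>] conjI) simp_all
  qed
  show ?thesis
  proof (rule smooth_autI)
    show "smooth_endo A U \<phi>"
    proof (rule smooth_endo_local)
      fix p assume "p \<in> U"
      from loc[OF this] show "\<exists>W \<xi>. open W \<and> p \<in> W \<and> smooth_endo A W \<xi> \<and> (\<forall>q\<in>W. \<forall>t\<in>sym2 A q. \<phi> q t = \<xi> q t)"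
        by (elim exE conjE) (intro exI conjI smooth_aut_endo)
    qed
    show "smooth_endo A U (aut_inv A \<phi>)"
    proof (rule smooth_endo_local)
      fix p assume "p \<in> U"
      from *[OF this] obtain W \<xi> where W: "open W" "p \<in> W" "smooth_aut A W \<xi>"
          "\<forall>q\<in>W. \<forall>t\<in>sym2 A q. \<phi> q t = \<xi> q t \<and> aut_inv A \<phi> q t = aut_inv A \<xi> q t"
        by (elim exE conjE)
      then show "\<exists>W \<xi>. open W \<and> p \<in> W \<and> smooth_endo A W \<xi> \<and> (\<forall>q\<in>W. \<forall>t\<in>sym2 A q. aut_inv A \<phi> q t = \<xi> q t)"
        using aut_inv(1)[OF W(1,3)] by (intro exI[of _ W] exI[of _ "aut_inv A \<xi>"] conjI) simp_all
    qed
    show "\<phi> p (aut_inv A \<phi> p t) = t" "aut_inv A \<phi> p (\<phi> p t) = t" if p: "p \<in> U" "t \<in> sym2 A p" for p t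
    proof -
      from *[OF p(1)] obtain W \<xi> where W: "open W" "p \<in> W" "smooth_aut A W \<xi>"
          "\<forall>q\<in>W. \<forall>t\<in>sym2 A q. \<phi> q t = \<xi> q t \<and> aut_inv A \<phi> q t = aut_inv A \<xi> q t"
        by (elim exE conjE)
      then show "\<phi> p (aut_inv A \<phi> p t) = t" "aut_inv A \<phi> p (\<phi> p t) = t"
        using p aut_inv[OF W(1,3)] smooth_aut_sym2[OF W(3,2) p(2)] smooth_endo_sym2[OF aut_inv(1)[OF W(1,3)] W(2) p(2)]
        by simp_all
    qed
  qed
qed

lemma smooth_aut_cong:
  "open U \<Longrightarrow> smooth_aut A U \<xi> \<Longrightarrow> (\<And>p t. p \<in> U \<Longrightarrow> t \<in> sym2 A p \<Longrightarrow> \<phi> p t = \<xi> p t) \<Longrightarrow> smooth_aut A U \<phi>"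
  by (rule smooth_aut_local) (intro exI[of _ U] exI[of _ \<xi>] conjI; simp)

end

section \<open>Smoothness tested in a single frame\<close>

context compatible_chart
begin

text \<open>The components in \<open>e\<close> and in a chart of \<open>A\<close> determine each
  other by congruence with a Jacobian that is smooth on the common domain.\<close>

lemma smooth_section_iff_coord:
  assumes W: "open W" "W \<subseteq> fst e" and h: "\<And>p. p \<in> W \<Longrightarrow> h p \<in> sym2 A p"
  shows "smooth_section A W h \<longleftrightarrow> smooth_map A W (\<lambda>p. coord A e p (h p))"
proof
  assume sm: "smooth_section A W h"
  show "smooth_map A W (\<lambda>p. coord A e p (h p))"
  proof (rule smooth_map_local)
    fix p assume p: "p \<in> W"
    then obtain d where d: "d \<in> A" "p \<in> fst d" using W(2) charts_at_domain[of p] unfolding charts_at_def by blast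
    have o: "open (fst d \<inter> W)" using W open_chart_domain[OF d(1)] by blast
    have j: "smooth_map A (fst d \<inter> W) (jac e d)"
      by (rule smooth_map_subset[OF smooth_map_jac_ext[of e d]]) (use d W in auto)
    have "smooth_map A (fst d \<inter> W) (\<lambda>q. transpose (jac e d q) ** h q d ** jac e d q)"
      using sm d(1) unfolding smooth_section_def
      by (intro smooth_map_matrix_mult smooth_map_transpose o j) auto
    moreover have "\<forall>q\<in>fst d \<inter> W. coord A e q (h q) = transpose (jac e d q) ** h q d ** jac e d q"
      using W h d by (auto simp: charts_at_def intro!: coord_eq)
    ultimately show "\<exists>W' G. open W' \<and> p \<in> W' \<and> smooth_map A W' G \<and> (\<forall>q\<in>W'. coord A e q (h q) = G q)"
      using o p d by blast
  qed
next
  assume sm: "smooth_map A W (\<lambda>p. coord A e p (h p))"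
  show "smooth_section A W h"
    unfolding smooth_section_def
  proof (intro conjI ballI h)
    fix c assume c: "c \<in> A"
    have o: "open (fst c \<inter> W)" using W open_chart_domain[OF c] by blast
    have j: "smooth_map A (fst c \<inter> W) (jac c e)"
      by (rule smooth_map_subset[OF smooth_map_jac_ext[of c e]]) (use c W in auto)
    have "smooth_map A (fst c \<inter> W) (\<lambda>q. transpose (jac c e q) ** coord A e q (h q) ** jac c e q)"
      by (intro smooth_map_matrix_mult smooth_map_transpose o j smooth_map_subset[OF sm]) auto
    moreover have "h q c = transpose (jac c e q) ** coord A e q (h q) ** jac c e q" if "q \<in> fst c \<inter> W" for q
    proof -
      have "form_of A e q (coord A e q (h q)) c = h q c" using form_of_coord[OF h] that W(2) by auto
      then show ?thesis using that c by (simp add: form_of_def charts_at_def)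
    qed
    ultimately show "smooth_map A (fst c \<inter> W) (\<lambda>p. h p c)"
      by (rule smooth_map_cong[OF o])
  qed
qed

lemma smooth_section_form_of:
  assumes "open W" "W \<subseteq> fst e" "\<And>p. p \<in> W \<Longrightarrow> transpose (S p) = S p" "smooth_map A W S"
  shows "smooth_section A W (\<lambda>p. form_of A e p (S p))"
proof -
  have "smooth_map A W (\<lambda>p. coord A e p (form_of A e p (S p)))"
    by (rule smooth_map_cong[OF assms(1,4)]) (use assms in \<open>auto intro!: coord_form_of\<close>)
  then show ?thesis
    using assms by (subst smooth_section_iff_coord) (auto intro!: form_of_sym2)
qed

text \<open>By linearity the images of the constant sections \<open>sym_unit k\<close> determine
  those of all sections, and a smooth section has smooth coefficients with respect to them.\<close>

lemma smooth_endo_frameI: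
  assumes W: "open W" "W \<subseteq> fst e" and lin: "\<And>p. p \<in> W \<Longrightarrow> sym2_linear A p (\<phi> p)"
    and sm: "\<And>S. transpose S = S \<Longrightarrow> smooth_map A W (\<lambda>p. coord A e p (\<phi> p (form_of A e p S)))"
  shows "smooth_endo A W \<phi>"
proof (rule smooth_endoI[OF lin])
  fix W' h assume W': "open W'" "W' \<subseteq> W" and h: "smooth_section A W' h"
  have hs: "h p \<in> sym2 A p" if "p \<in> W'" for p using h that unfolding smooth_section_def by blast
  have hc: "smooth_map A W' (\<lambda>p. coord A e p (h p))"
    using h smooth_section_iff_coord[OF W'(1) _ hs] W'(2) W(2) by blast
  define s where "s k p = \<phi> p (form_of A e p (sym_unit k))" for k p
  have "smooth_section A W' (s k)" for k
  proof (rule smooth_section_subset[OF _ W'(2)])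
    show "smooth_section A W (s k)"
      unfolding s_def using W sm[OF transpose_sym_unit[of k]] transpose_sym_unit[of k]
      by (subst smooth_section_iff_coord) (auto intro!: sym2_linearD(1)[OF lin] form_of_sym2)
  qed
  then have "smooth_section A W' (\<lambda>p c. \<Sum>k\<in>UNIV. (coord A e p (h p) $ fst k $ snd k) *\<^sub>R s k p c)"
    by (intro smooth_section_sum W'(1) smooth_map_vec_nth hc) auto
  then show "smooth_section A W' (\<lambda>p. \<phi> p (h p))"
  proof (rule smooth_section_cong[OF W'(1)])
    fix p assume p: "p \<in> W'"
    then have pe: "p \<in> fst e" using W W' by blast
    have "h p = form_of A e p (coord A e p (h p))" using form_of_coord[OF hs[OF p] pe] by simp
    also have "coord A e p (h p) = (\<Sum>k\<in>UNIV. (coord A e p (h p) $ fst k $ snd k) *\<^sub>R sym_unit k)"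
      by (rule symmetric_matrix_expansion[OF transpose_coord[OF hs[OF p] pe]])
    also have "form_of A e p \<dots> = (\<lambda>c. \<Sum>k\<in>UNIV. (coord A e p (h p) $ fst k $ snd k) *\<^sub>R form_of A e p (sym_unit k) c)"
      by (rule form_of_sum) simp
    finally have "\<phi> p (h p) = \<phi> p \<dots>" by (rule arg_cong)
    also have "\<dots> = (\<lambda>c. \<Sum>k\<in>UNIV. (coord A e p (h p) $ fst k $ snd k) *\<^sub>R s k p c)"
      unfolding s_def
      by (rule sym2_linear_sum[OF lin[OF subsetD[OF W'(2) p]] finite form_of_sym2[OF transpose_sym_unit pe]])
    finally show "\<phi> p (h p) = (\<lambda>c. \<Sum>k\<in>UNIV. (coord A e p (h p) $ fst k $ snd k) *\<^sub>R s k p c)" .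
  qed
qed

end

section \<open>Comparison with the extensional bundle maps of the definitions\<close>

context smooth_atlas
begin

text \<open>Separates the extensionality convention from the geometric condition, so that
  constructions may proceed with arbitrary functions and be normalized at the end.\<close>

lemma bundle_endos_iff:
  assumes U: "open U" "U \<subseteq> M"
  shows "\<phi> \<in> bundle_endos A U \<longleftrightarrow> \<phi> \<in> (\<Pi>\<^sub>E p\<in>U. sym2 A p \<rightarrow>\<^sub>E sym2 A p) \<and> smooth_endo A U \<phi>"
proof
  assume \<phi>: "\<phi> \<in> bundle_endos A U"
  then have PiE: "\<phi> \<in> (\<Pi>\<^sub>E p\<in>U. sym2 A p \<rightarrow>\<^sub>E sym2 A p)" unfolding bundle_endos_def by blast
  have lin: "sym2_linear A p (\<phi> p)" if "p \<in> U" for p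
    unfolding sym2_linear_def
  proof
    show "\<forall>t\<in>sym2 A p. \<phi> p t \<in> sym2 A p" using PiE_mem[OF PiE that] by (auto dest: PiE_mem)
  qed (use \<phi> that in \<open>unfold bundle_endos_def, blast\<close>)
  have sm: "\<forall>c\<in>A. \<forall>S. transpose S = S \<longrightarrow> smooth_on (snd c ` (fst c \<inter> U))
      (\<lambda>x. \<phi> (chart_inv c x) (form_of A c (chart_inv c x) S) c)"
    using \<phi> unfolding bundle_endos_def by (elim CollectE conjE)
  have "smooth_endo A U \<phi>"
  proof (rule smooth_endo_local)
    fix p assume p: "p \<in> U"
    then obtain c where c: "c \<in> A" "p \<in> fst c" using U(2) charts_at_nonempty[of p] unfolding charts_at_def by blast
    interpret c: compatible_chart M A c by (rule compatible_chart_self[OF c(1)])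
    let ?W = "fst c \<inter> U"
    have W: "open ?W" using U open_chart_domain[OF c(1)] by blast
    have "smooth_endo A ?W \<phi>"
    proof (rule c.smooth_endo_frameI[OF W])
      fix S :: "real^'n^'n" assume S: "transpose S = S"
      have "smooth_map A ?W (\<lambda>p. \<phi> p (form_of A c p S) c)"
        by (rule smooth_map_chartI[OF c(1) W Int_lower1 sm[rule_format, OF c(1) S]])
      then show "smooth_map A ?W (\<lambda>p. coord A c p (\<phi> p (form_of A c p S)))"
        by (rule smooth_map_cong[OF W])
          (intro coord_chart sym2_linearD(1)[OF lin] c.form_of_sym2 S, simp_all add: charts_at_def c(1))
    qed (use lin in auto)
    then show "\<exists>W \<xi>. open W \<and> p \<in> W \<and> smooth_endo A W \<xi> \<and> (\<forall>q\<in>W. \<forall>t\<in>sym2 A q. \<phi> q t = \<xi> q t)"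
      using W p c by (intro exI[of _ ?W] exI[of _ \<phi>]) simp
  qed
  with PiE show "\<phi> \<in> (\<Pi>\<^sub>E p\<in>U. sym2 A p \<rightarrow>\<^sub>E sym2 A p) \<and> smooth_endo A U \<phi>" by blast
next
  assume \<phi>: "\<phi> \<in> (\<Pi>\<^sub>E p\<in>U. sym2 A p \<rightarrow>\<^sub>E sym2 A p) \<and> smooth_endo A U \<phi>"
  have "smooth_on (snd c ` (fst c \<inter> U)) (\<lambda>x. \<phi> (chart_inv c x) (form_of A c (chart_inv c x) S) c)"
    if c: "c \<in> A" and S: "transpose S = S" for c S
  proof -
    interpret c: compatible_chart M A c by (rule compatible_chart_self[OF c])
    have W: "open (fst c \<inter> U)" using U open_chart_domain[OF c] by blast
    have "smooth_section A (fst c \<inter> U) (\<lambda>p. form_of A c p S)"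
      by (rule c.smooth_section_form_of[OF W]) (auto simp: S smooth_map_const)
    then have "smooth_section A (fst c \<inter> U) (\<lambda>p. \<phi> p (form_of A c p S))"
      by (rule smooth_endo_section[OF conjunct2[OF \<phi>] W Int_lower2])
    then have "smooth_map A (fst c \<inter> (fst c \<inter> U)) (\<lambda>p. \<phi> p (form_of A c p S) c)"
      unfolding smooth_section_def using c by (elim conjE bspec)
    then show ?thesis
      using smooth_map_chartD[OF c, of "fst c \<inter> U" "\<lambda>p. \<phi> p (form_of A c p S) c"] by (simp add: Int_left_absorb)
  qed
  then show "\<phi> \<in> bundle_endos A U"
    using \<phi> unfolding bundle_endos_def smooth_endo_def sym2_linear_def by simp
qed

text \<open>The normalization to an extensional map: nothing changes on the fibres over
  \<open>U\<close>.\<close>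

definition restrict_aut :: "'a set \<Rightarrow> ('a \<Rightarrow> ('a, 'n) form \<Rightarrow> ('a, 'n) form) \<Rightarrow> 'a \<Rightarrow> ('a, 'n) form \<Rightarrow> ('a, 'n) form" where
  "restrict_aut U \<phi> = (\<lambda>p\<in>U. \<lambda>t\<in>sym2 A p. \<phi> p t)"

lemma restrict_aut_apply: "p \<in> U \<Longrightarrow> t \<in> sym2 A p \<Longrightarrow> restrict_aut U \<phi> p t = \<phi> p t"
  by (simp add: restrict_aut_def)

lemma restrict_endo:
  assumes "open U" "U \<subseteq> M" "smooth_endo A U \<phi>"
  shows "restrict_aut U \<phi> \<in> bundle_endos A U"
proof -
  have "smooth_endo A U (restrict_aut U \<phi>)"
    by (rule smooth_endo_cong[OF assms(1,3)], rule restrict_aut_apply)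
  then show ?thesis
    unfolding bundle_endos_iff[OF assms(1,2)]
    using smooth_endo_sym2[OF assms(3)] by (auto simp: restrict_aut_def)
qed

text \<open>The codomains are free because \<open>bundle_comp_PiE\<close> only places composites in
  \<open>UNIV\<close>; extensionality is what matters here.\<close>

lemma fibre_map_eqI:
  assumes "\<phi> \<in> (\<Pi>\<^sub>E p\<in>U. sym2 A p \<rightarrow>\<^sub>E X p)" "\<psi> \<in> (\<Pi>\<^sub>E p\<in>U. sym2 A p \<rightarrow>\<^sub>E Y p)"
    and "\<And>p t. p \<in> U \<Longrightarrow> t \<in> sym2 A p \<Longrightarrow> \<phi> p t = \<psi> p t"
  shows "\<phi> = \<psi>"
proof (rule extensionalityI[where A = U])
  fix p assume p: "p \<in> U"
  show "\<phi> p = \<psi> p"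
    by (rule extensionalityI[where A = "sym2 A p"])
      (use assms(3)[OF p] PiE_mem[OF assms(1) p] PiE_mem[OF assms(2) p] in \<open>auto simp: PiE_def\<close>)
qed (use assms in \<open>auto simp: PiE_def\<close>)

lemma bundle_comp_apply: "p \<in> U \<Longrightarrow> t \<in> sym2 A p \<Longrightarrow> bundle_comp A U \<phi> \<psi> p t = \<phi> p (\<psi> p t)"
  by (simp add: bundle_comp_def compose_def)

lemma bundle_id_apply: "p \<in> U \<Longrightarrow> t \<in> sym2 A p \<Longrightarrow> bundle_id A U p t = t"
  by (simp add: bundle_id_def)

lemma bundle_id_PiE: "bundle_id A U \<in> (\<Pi>\<^sub>E p\<in>U. sym2 A p \<rightarrow>\<^sub>E sym2 A p)"
  by (auto simp: bundle_id_def)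

lemma bundle_comp_PiE: "bundle_comp A U \<phi> \<psi> \<in> (\<Pi>\<^sub>E p\<in>U. sym2 A p \<rightarrow>\<^sub>E UNIV)"
  by (auto simp: bundle_comp_def compose_def)

lemma bundle_auts_iff:
  assumes U: "open U" "U \<subseteq> M"
  shows "\<phi> \<in> bundle_auts A U \<longleftrightarrow> \<phi> \<in> (\<Pi>\<^sub>E p\<in>U. sym2 A p \<rightarrow>\<^sub>E sym2 A p) \<and> smooth_aut A U \<phi>"
proof
  assume \<phi>: "\<phi> \<in> bundle_auts A U"
  then obtain \<psi> where \<psi>: "\<phi> \<in> bundle_endos A U" "\<psi> \<in> bundle_endos A U"
      "bundle_comp A U \<psi> \<phi> = bundle_id A U" "bundle_comp A U \<phi> \<psi> = bundle_id A U"
    unfolding bundle_auts_def by blast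
  have "smooth_aut A U \<phi>"
  proof (rule smooth_autI)
    fix p t assume "p \<in> U" "t \<in> sym2 A p"
    then show "\<phi> p (\<psi> p t) = t" "\<psi> p (\<phi> p t) = t"
      using \<psi>(3,4) bundle_comp_apply bundle_id_apply by metis+
  qed (use \<psi>(1,2) in \<open>auto simp: bundle_endos_iff[OF U]\<close>)
  then show "\<phi> \<in> (\<Pi>\<^sub>E p\<in>U. sym2 A p \<rightarrow>\<^sub>E sym2 A p) \<and> smooth_aut A U \<phi>"
    using \<psi>(1) bundle_endos_iff[OF U] by blast
next
  assume \<phi>: "\<phi> \<in> (\<Pi>\<^sub>E p\<in>U. sym2 A p \<rightarrow>\<^sub>E sym2 A p) \<and> smooth_aut A U \<phi>"
  let ?\<psi> = "restrict_aut U (aut_inv A \<phi>)"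
  note inv = aut_inv[OF U(1) conjunct2[OF \<phi>]]
  have "?\<psi> \<in> bundle_endos A U" by (rule restrict_endo[OF U inv(1)])
  moreover have "bundle_comp A U ?\<psi> \<phi> = bundle_id A U"
    by (rule fibre_map_eqI[OF bundle_comp_PiE bundle_id_PiE])
      (use inv smooth_aut_sym2[OF conjunct2[OF \<phi>]] in \<open>simp add: bundle_comp_apply bundle_id_apply restrict_aut_apply\<close>)
  moreover have "bundle_comp A U \<phi> ?\<psi> = bundle_id A U"
    by (rule fibre_map_eqI[OF bundle_comp_PiE bundle_id_PiE])
      (use inv in \<open>simp add: bundle_comp_apply bundle_id_apply restrict_aut_apply\<close>)
  moreover have "\<phi> \<in> bundle_endos A U" using \<phi> smooth_aut_endo bundle_endos_iff[OF U] by blast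
  ultimately show "\<phi> \<in> bundle_auts A U" unfolding bundle_auts_def by blast
qed

lemma restrict_aut_bundle_auts:
  assumes "open U" "U \<subseteq> M" "smooth_aut A U \<phi>"
  shows "restrict_aut U \<phi> \<in> bundle_auts A U"
proof -
  have "smooth_aut A U (restrict_aut U \<phi>)"
    by (rule smooth_aut_cong[OF assms(1,3)], rule restrict_aut_apply)
  then show ?thesis
    using restrict_endo[OF assms(1,2) smooth_aut_endo[OF assms(3)]]
    by (simp add: bundle_auts_iff[OF assms(1,2)] bundle_endos_iff[OF assms(1,2)])
qed

end

subsection \<open>Flat metrics in curvilinear coordinates are Ricci-flat\<close>

lemma partial_mult:
  assumes "smooth_on S f" "smooth_on S g" "x \<in> S"
  shows "partial k (\<lambda>y. f y * g y) x = f x * partial k g x + partial k f x * g x"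
  using has_derivative_partial[OF has_derivative_mult[OF smooth_on_has_derivative[OF assms(1,3)]
        smooth_on_has_derivative[OF assms(2,3)]]]
  by (simp add: partial_def)

lemma partial_sum:
  assumes "\<And>a. a \<in> I \<Longrightarrow> smooth_on S (f a)" "x \<in> S"
  shows "partial k (\<lambda>y. \<Sum>a\<in>I. f a y) x = (\<Sum>a\<in>I. partial k (f a) x)"
proof -
  have "((\<lambda>y. \<Sum>a\<in>I. f a y) has_derivative (\<lambda>v. \<Sum>a\<in>I. frechet_derivative (f a) (at x) v)) (at x)"
    by (intro has_derivative_sum smooth_on_has_derivative[OF assms(1) assms(2)])
  then show ?thesis by (simp add: has_derivative_partial) (simp add: partial_def)
qed

lemma partial_const: "partial k (\<lambda>y. c) x = 0"
  by (simp add: partial_def)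

lemma matrix_inv_eqI:
  fixes A B :: "real^'n::finite^'n"
  assumes "A ** B = mat 1"
  shows "matrix_inv A = B"
proof -
  have BA: "B ** A = mat 1" using assms matrix_left_right_inverse by blast
  have "\<exists>B. A ** B = mat 1 \<and> B ** A = mat 1" using assms BA by blast
  then have "matrix_inv A ** A = mat 1" unfolding matrix_inv_def by (metis (mono_tags, lifting) someI_ex)
  then show ?thesis using assms by (metis matrix_mul_assoc matrix_mul_lid matrix_mul_rid)
qed

text \<open>\<open>ricci\<close> is evaluated in every chart of the atlas, and the coordinates in
  which the metric is constant need not be among them. So flatness is expressed in curvilinear
  coordinates: \<open>f\<close> are the flat coordinate functions, \<open>K\<close> is the inverse
  of their Jacobian and \<open>d\<close> holds the signs of the constant diagonal metric.\<close>

locale flat_coordinates =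
  fixes S :: "(real^'n::finite) set" and f :: "'n \<Rightarrow> real^'n \<Rightarrow> real" and K :: "real^'n \<Rightarrow> real^'n^'n"
    and d :: "'n \<Rightarrow> real" and G :: "real^'n \<Rightarrow> real^'n^'n"
  assumes S: "open S" and f: "smooth_on S (f a)" and K: "smooth_on S K"
    and KJ: "x \<in> S \<Longrightarrow> (\<Sum>a\<in>UNIV. K x $ k $ a * partial l (f a) x) = (if k = l then 1 else 0)"
    and JK: "x \<in> S \<Longrightarrow> (\<Sum>l\<in>UNIV. partial l (f a) x * K x $ l $ b) = (if a = b then 1 else 0)"
    and d: "d a * d a = 1"
    and G: "x \<in> S \<Longrightarrow> G x $ i $ j = (\<Sum>a\<in>UNIV. d a * (partial i (f a) x * partial j (f a) x))"
begin

abbreviation "J j a \<equiv> partial j (f a)"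
abbreviation "H i j a \<equiv> partial i (partial j (f a))"

lemma smooth_J: "smooth_on S (J j a)" and smooth_H: "smooth_on S (H i j a)"
  and smooth_K: "smooth_on S (\<lambda>y. K y $ k $ a)"
  using S f K by (auto intro!: smooth_on_partial smooth_on_vec_nth)

lemma H_commute: "x \<in> S \<Longrightarrow> H i j a x = H j i a x"
  by (rule partial_commute[OF S _ f])

lemma partial_metric:
  assumes x: "x \<in> S"
  shows "partial l (\<lambda>y. G y $ i $ j) x = (\<Sum>a\<in>UNIV. d a * (J i a x * H l j a x + H l i a x * J j a x))"
proof -
  have "partial l (\<lambda>y. G y $ i $ j) x = partial l (\<lambda>y. \<Sum>a\<in>UNIV. d a * (J i a y * J j a y)) x"
    by (rule partial_cong[OF S x G])
  also have "\<dots> = (\<Sum>a\<in>UNIV. partial l (\<lambda>y. d a * (J i a y * J j a y)) x)"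
    by (rule partial_sum[OF _ x]) (intro smooth_on_mult S smooth_on_const smooth_J)
  also have "\<dots> = (\<Sum>a\<in>UNIV. d a * (J i a x * H l j a x + H l i a x * J j a x))"
  proof (rule sum.cong[OF refl])
    fix a
    have "partial l (\<lambda>y. d a * (J i a y * J j a y)) x =
        d a * partial l (\<lambda>y. J i a y * J j a y) x + partial l (\<lambda>y. d a) x * (J i a x * J j a x)"
      by (rule partial_mult[OF smooth_on_const _ x]) (intro smooth_on_mult S smooth_J)
    also have "partial l (\<lambda>y. J i a y * J j a y) x = J i a x * H l j a x + H l i a x * J j a x"
      by (rule partial_mult[OF smooth_J smooth_J x])
    finally show "partial l (\<lambda>y. d a * (J i a y * J j a y)) x =
        d a * (J i a x * H l j a x + H l i a x * J j a x)"
      by (simp add: partial_const)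
  qed
  finally show ?thesis .
qed

text \<open>With J the Jacobian and d the diagonal sign matrix, the metric is J^T d J, so its
  inverse is K d K^T because d is its own inverse.\<close>

lemma inverse_metric:
  assumes x: "x \<in> S"
  shows "(\<Sum>l\<in>UNIV. matrix_inv (G x) $ k $ l * J l a x) = K x $ k $ a * d a"
proof -
  define B :: "real^'n^'n" where "B = (\<chi> k l. \<Sum>b\<in>UNIV. K x $ k $ b * d b * K x $ l $ b)"
  have BJ: "(\<Sum>l\<in>UNIV. B $ k $ l * J l a x) = K x $ k $ a * d a" for k a
  proof -
    have "(\<Sum>l\<in>UNIV. B $ k $ l * J l a x) = (\<Sum>l\<in>UNIV. \<Sum>b\<in>UNIV. K x $ k $ b * d b * (J l a x * K x $ l $ b))"
      by (simp add: B_def sum_distrib_right sum_distrib_left mult_ac)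
    also have "\<dots> = (\<Sum>b\<in>UNIV. \<Sum>l\<in>UNIV. K x $ k $ b * d b * (J l a x * K x $ l $ b))"
      by (rule sum.swap)
    also have "\<dots> = (\<Sum>b\<in>UNIV. K x $ k $ b * d b * (if a = b then 1 else 0))"
      by (simp only: sum_distrib_left[symmetric] JK[OF x])
    also have "\<dots> = (\<Sum>b\<in>UNIV. if a = b then K x $ k $ b * d b else 0)"
      by (intro sum.cong) auto
    also have "\<dots> = K x $ k $ a * d a" by simp
    finally show ?thesis .
  qed
  have "(B ** G x) $ k $ j = mat 1 $ k $ j" for k j
  proof -
    have "(B ** G x) $ k $ j = (\<Sum>l\<in>UNIV. \<Sum>a\<in>UNIV. B $ k $ l * J l a x * (d a * J j a x))"
      by (simp add: matrix_matrix_mult_def G[OF x] sum_distrib_left mult_ac)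
    also have "\<dots> = (\<Sum>a\<in>UNIV. (\<Sum>l\<in>UNIV. B $ k $ l * J l a x) * (d a * J j a x))"
      by (subst sum.swap) (simp only: sum_distrib_right)
    also have "\<dots> = (\<Sum>a\<in>UNIV. (d a * d a) * (K x $ k $ a * J j a x))"
      by (simp only: BJ) (simp only: mult_ac)
    also have "\<dots> = mat 1 $ k $ j" by (simp add: d KJ[OF x] mat_def)
    finally show ?thesis .
  qed
  then have "B ** G x = mat 1" by (simp add: vec_eq_iff)
  then have "G x ** B = mat 1" using matrix_left_right_inverse by blast
  then show ?thesis using BJ by (simp add: matrix_inv_eqI)
qed

text \<open>In the Christoffel combination of first derivatives of the metric, symmetry of the
  second derivatives of \<open>f\<close> cancels all but twice the term containing
  \<open>H i j\<close>. Contraction with the inverse metric then removes the Jacobian and the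
  signs.\<close>

lemma christoffel_flat:
  assumes x: "x \<in> S"
  shows "christoffel G k i j x = (\<Sum>a\<in>UNIV. K x $ k $ a * H i j a x)"
proof -
  have "partial i (\<lambda>y. G y $ j $ l) x + partial j (\<lambda>y. G y $ i $ l) x - partial l (\<lambda>y. G y $ i $ j) x =
      (\<Sum>a\<in>UNIV. 2 * (d a * H i j a x * J l a x))" for l
    unfolding partial_metric[OF x] sum.distrib[symmetric] sum_subtractf[symmetric]
    by (intro sum.cong refl)
      (simp add: H_commute[OF x, of l i] H_commute[OF x, of l j] H_commute[OF x, of j i] algebra_simps)
  then have "christoffel G k i j x =
      (\<Sum>l\<in>UNIV. matrix_inv (G x) $ k $ l * (\<Sum>a\<in>UNIV. 2 * (d a * H i j a x * J l a x))) / 2"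
    unfolding christoffel_def by (simp only:)
  also have "\<dots> = (\<Sum>l\<in>UNIV. \<Sum>a\<in>UNIV. d a * H i j a x * (matrix_inv (G x) $ k $ l * J l a x))"
    by (simp add: sum_distrib_left sum_divide_distrib mult_ac)
  also have "\<dots> = (\<Sum>a\<in>UNIV. d a * H i j a x * (\<Sum>l\<in>UNIV. matrix_inv (G x) $ k $ l * J l a x))"
    by (subst sum.swap) (simp only: sum_distrib_left)
  also have "\<dots> = (\<Sum>a\<in>UNIV. (d a * d a) * (K x $ k $ a * H i j a x))"
    by (simp only: inverse_metric[OF x]) (simp only: mult_ac)
  finally show ?thesis by (simp add: d)
qed

text \<open>Differentiate the identity \<open>KJ\<close> and multiply by \<open>K\<close> from the
  right.\<close>

lemma partial_K:
  assumes x: "x \<in> S"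
  shows "partial m (\<lambda>y. K y $ k $ b) x = - (\<Sum>l\<in>UNIV. christoffel G k m l x * K x $ l $ b)"
proof -
  have "(\<Sum>a\<in>UNIV. partial m (\<lambda>y. K y $ k $ a) x * J l a x) = - christoffel G k m l x" for l
  proof -
    have "partial m (\<lambda>y. \<Sum>a\<in>UNIV. K y $ k $ a * J l a y) x = partial m (\<lambda>y. if k = l then 1 else 0) x"
      by (rule partial_cong[OF S x KJ])
    moreover have "partial m (\<lambda>y. \<Sum>a\<in>UNIV. K y $ k $ a * J l a y) x =
        (\<Sum>a\<in>UNIV. partial m (\<lambda>y. K y $ k $ a * J l a y) x)"
      by (rule partial_sum[OF _ x]) (intro smooth_on_mult S smooth_K smooth_J)
    moreover have "partial m (\<lambda>y. K y $ k $ a * J l a y) x =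
        K x $ k $ a * H m l a x + partial m (\<lambda>y. K y $ k $ a) x * J l a x" for a
      by (rule partial_mult[OF smooth_K smooth_J x])
    ultimately show ?thesis
      by (simp add: partial_const sum.distrib christoffel_flat[OF x])
  qed
  then have "- (\<Sum>l\<in>UNIV. christoffel G k m l x * K x $ l $ b) =
      (\<Sum>l\<in>UNIV. (\<Sum>a\<in>UNIV. partial m (\<lambda>y. K y $ k $ a) x * J l a x) * K x $ l $ b)"
    by (simp add: sum_negf)
  also have "\<dots> = (\<Sum>a\<in>UNIV. partial m (\<lambda>y. K y $ k $ a) x * (\<Sum>l\<in>UNIV. J l a x * K x $ l $ b))"
    by (simp only: sum_distrib_right sum_distrib_left mult.assoc) (rule sum.swap)
  also have "\<dots> = (\<Sum>a\<in>UNIV. if a = b then partial m (\<lambda>y. K y $ k $ a) x else 0)"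
    by (simp only: JK[OF x]) (intro sum.cong, auto)
  finally show ?thesis by simp
qed

text \<open>Differentiating \<open>K\<close> yields the quadratic term with the sign needed to
  cancel the products of Christoffel symbols in the Ricci tensor; what is left is a third derivative
  of \<open>f\<close>.\<close>

lemma partial_christoffel:
  assumes x: "x \<in> S"
  shows "partial m (christoffel G k i j) x =
    (\<Sum>a\<in>UNIV. K x $ k $ a * partial m (H i j a) x) - (\<Sum>l\<in>UNIV. christoffel G k m l x * christoffel G l i j x)"
proof -
  have "partial m (christoffel G k i j) x = partial m (\<lambda>y. \<Sum>a\<in>UNIV. K y $ k $ a * H i j a y) x"
    by (rule partial_cong[OF S x christoffel_flat])
  also have "\<dots> = (\<Sum>a\<in>UNIV. partial m (\<lambda>y. K y $ k $ a * H i j a y) x)"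
    by (rule partial_sum[OF _ x]) (intro smooth_on_mult S smooth_K smooth_H)
  also have "\<dots> = (\<Sum>a\<in>UNIV. K x $ k $ a * partial m (H i j a) x + partial m (\<lambda>y. K y $ k $ a) x * H i j a x)"
    by (intro sum.cong refl partial_mult[OF smooth_K smooth_H x])
  also have "\<dots> = (\<Sum>a\<in>UNIV. K x $ k $ a * partial m (H i j a) x) -
      (\<Sum>a\<in>UNIV. \<Sum>l\<in>UNIV. christoffel G k m l x * (K x $ l $ a * H i j a x))"
    by (simp add: partial_K[OF x] sum_subtractf sum_distrib_right mult.assoc)
  also have "(\<Sum>a\<in>UNIV. \<Sum>l\<in>UNIV. christoffel G k m l x * (K x $ l $ a * H i j a x)) =
      (\<Sum>l\<in>UNIV. christoffel G k m l x * christoffel G l i j x)"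
    by (subst sum.swap) (simp only: christoffel_flat[OF x, of _ i j] sum_distrib_left)
  finally show ?thesis .
qed

lemma partial_H_commute:
  assumes x: "x \<in> S"
  shows "partial k (H i j a) x = partial j (H i k a) x"
proof -
  have "partial k (H i j a) x = partial k (H j i a) x"
    by (rule partial_cong[OF S x H_commute])
  also have "\<dots> = partial j (H k i a) x"
    by (rule partial_commute[OF S x smooth_J])
  also have "\<dots> = partial j (H i k a) x"
    by (rule partial_cong[OF S x H_commute])
  finally show ?thesis .
qed

text \<open>The cancellation takes place for each contracted index \<open>k\<close> separately: the
  quadratic terms drop out and the third derivatives agree by symmetry.\<close>

theorem ricci_coord_flat:
  assumes x: "x \<in> S"
  shows "ricci_coord G x = 0"
proof -
  have "ricci_coord G x $ i $ j = 0" for i j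
    unfolding ricci_coord_def vec_lambda_beta
    by (rule sum.neutral) (simp add: partial_christoffel[OF x] partial_H_commute[OF x, of _ i j] sum_subtractf)
  then show ?thesis by (simp add: vec_eq_iff)
qed

end

subsection \<open>Global coordinates on a disk\<close>

locale disk_chart = compatible_chart M A e
  for M :: "'a::{t2_space, second_countable_topology} set" and A :: "('a, 'n::finite) chart set" and e +
  assumes onto: "snd e ` fst e = UNIV"

text \<open>The two smoothness clauses of \<open>diffeomorphic_Rn\<close> are the smoothness of the
  transition maps between the diffeomorphism and the charts of the atlas, so the diffeomorphism can
  be adjoined as a chart.\<close>

lemma (in smooth_atlas) disk_chart_exists:
  assumes "V \<in> disks M A"
  shows "\<exists>f. disk_chart M A (V, f)"
proof -
  obtain f :: "'a \<Rightarrow> real^'n" where V: "open V" "V \<subseteq> M" and f: "homeomorphism V UNIV f (inv_into V f)"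
    and sm: "\<And>c. c \<in> A \<Longrightarrow> smooth_on (snd c ` (fst c \<inter> V)) (f \<circ> chart_inv c)"
      "\<And>c. c \<in> A \<Longrightarrow> smooth_on (f ` (fst c \<inter> V)) (snd c \<circ> inv_into V f)"
    using assms unfolding disks_def diffeomorphic_Rn_def by blast
  have onto: "f ` V = UNIV" using f unfolding homeomorphism_def by blast
  have inv: "f (inv_into V f x) = x" for x using f unfolding homeomorphism_def by blast
  have id: "smooth_on (f ` V) (f \<circ> inv_into V f)"
    unfolding onto by (rule smooth_on_cong[OF _ _ smooth_on_id]) (auto simp: inv)
  have "smooth_manifold M (insert (V, f) A)"
    unfolding smooth_manifold_def
  proof (intro conjI ballI)
    show "\<Union> (fst ` insert (V, f) A) = M" using Union_charts V by auto
  next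
    fix c assume "c \<in> insert (V, f) A"
    then consider "c = (V, f)" | "c \<in> A" by blast
    then have "open (fst c) \<and> open (snd c ` fst c) \<and> homeomorphism (fst c) (snd c ` fst c) (snd c) (chart_inv c)"
    proof cases
      case 1
      then show ?thesis using V(1) f onto by (simp add: chart_inv_def)
    next
      case 2
      then show ?thesis using open_chart_domain open_chart_range chart_homeomorphism by blast
    qed
    then show "open (fst c)" "open (snd c ` fst c)" "homeomorphism (fst c) (snd c ` fst c) (snd c) (chart_inv c)"
      by blast+
  next
    fix c d assume "c \<in> insert (V, f) A" "d \<in> insert (V, f) A"
    then consider "c = (V, f)" "d = (V, f)" | "c \<in> A" "d = (V, f)" | "c = (V, f)" "d \<in> A" | "c \<in> A" "d \<in> A"
      by blast
    then show "smooth_on (snd c ` (fst c \<inter> fst d)) (snd d \<circ> chart_inv c)"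
    proof cases
      case 1
      then show ?thesis using id by (simp add: chart_inv_def)
    next
      case 2
      then show ?thesis using sm(1)[of c] by simp
    next
      case 3
      then show ?thesis using sm(2)[of d] by (simp add: chart_inv_def Int_commute)
    next
      case 4
      then show ?thesis by (rule smooth_transition)
    qed
  qed
  then show ?thesis
    by (intro exI[of _ f]) (unfold_locales, simp_all add: onto)
qed

section \<open>Jacobians of the coordinates of \<open>e\<close>\<close>

context compatible_chart
begin

lemma open_domain: "open (fst e)"
  by (rule ext.open_chart_domain) simp

lemma partial_coordinate:
  assumes "c \<in> insert e A" "p \<in> fst c" "p \<in> fst e"
  shows "partial l (\<lambda>y. snd e (chart_inv c y) $ a) (snd c p) = jac c e p $ a $ l"
proof -
  have "((\<lambda>y. (snd e \<circ> chart_inv c) y $ a) has_derivative (\<lambda>v. (jac c e p *v v) $ a)) (at (snd c p))"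
    by (rule bounded_linear.has_derivative[OF bounded_linear_vec_nth ext.has_derivative_transition])
      (use assms in auto)
  then show ?thesis
    by (simp add: has_derivative_partial comp_def matrix_vector_mult_basis column_def)
qed

lemma matrix_eq_mat_1: "(P :: real^'n^'n) ** Q = mat 1 \<Longrightarrow> (\<Sum>l\<in>UNIV. P $ a $ l * Q $ l $ b) = (if a = b then 1 else 0)"
  by (auto simp: matrix_matrix_mult_def mat_def vec_eq_iff)

lemma jac_sums:
  assumes "c \<in> charts_at A p" "p \<in> fst e"
  shows "(\<Sum>a\<in>UNIV. jac e c p $ k $ a * jac c e p $ a $ l) = (if k = l then 1 else 0)"
    and "(\<Sum>l\<in>UNIV. jac c e p $ a $ l * jac e c p $ l $ b) = (if a = b then 1 else 0)"
  using assms by (intro matrix_eq_mat_1 ext.jac_inverse; simp add: charts_at_def)+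

end

text \<open>The index type has no distinguished element, so the timelike direction is an arbitrary
  one.\<close>

definition minkowski :: "real^'n^'n" where
  "minkowski = (\<chi> i j. if i \<noteq> j then 0 else if i = (SOME k. True) then - 1 else 1)"

lemma transpose_minkowski: "transpose minkowski = minkowski"
  by (simp add: minkowski_def transpose_def vec_eq_iff)

lemma minkowski_congruence:
  fixes P :: "real^'n::finite^'n"
  shows "(transpose P ** minkowski ** P) $ i $ j =
    (\<Sum>a\<in>UNIV. (if a = (SOME k. True) then - 1 else 1) * (P $ a $ i * P $ a $ j))"
proof -
  have "(transpose P ** minkowski) $ i $ a = P $ a $ i * (if a = (SOME k. True) then - 1 else 1)" for a
  proof -
    have "(transpose P ** minkowski) $ i $ a = (\<Sum>b\<in>UNIV. P $ b $ i * minkowski $ b $ a)"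
      by (simp add: matrix_matrix_mult_def transpose_def)
    also have "\<dots> = (\<Sum>b\<in>UNIV. if b = a then P $ b $ i * (if a = (SOME k. True) then - 1 else 1) else 0)"
      by (rule sum.cong) (auto simp: minkowski_def)
    finally show ?thesis by simp
  qed
  then show ?thesis
    by (simp add: matrix_matrix_mult_def[of "transpose P ** minkowski"]) (intro sum.cong refl, simp)
qed

lemma lorentz_minkowski_congruence:
  fixes P Q :: "real^'n::finite^'n"
  assumes "P ** Q = mat 1"
  shows "lorentz_matrix (transpose P ** minkowski ** P)"
  unfolding lorentz_matrix_def
proof (intro exI conjI)
  show "invertible Q" using assms matrix_left_right_inverse unfolding invertible_def by blast
  show "transpose Q ** (transpose P ** minkowski ** P) ** Q =
      (\<chi> i j. if i \<noteq> j then 0 else if i = (SOME k. True) then - 1 else 1)"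
    unfolding congruence_congruence assms by (simp add: minkowski_def)
qed

section \<open>The flat metric of a chart\<close>

context compatible_chart
begin

definition flat_metric :: "'a \<Rightarrow> ('a, 'n) form" where
  "flat_metric = (\<lambda>p\<in>fst e. form_of A e p minkowski)"

lemma flat_metric_apply: "p \<in> fst e \<Longrightarrow> flat_metric p = form_of A e p minkowski"
  by (simp add: flat_metric_def)

lemma flat_metric_component:
  "c \<in> charts_at A p \<Longrightarrow> p \<in> fst e \<Longrightarrow> flat_metric p c = transpose (jac c e p) ** minkowski ** jac c e p"
  by (simp add: flat_metric_apply form_of_def)

lemma flat_metric_lorentzian: "flat_metric \<in> lorentzian_metrics A (fst e)"
proof -
  have "smooth_section A (fst e) (\<lambda>p. form_of A e p minkowski)"
    by (rule smooth_section_form_of[OF open_domain order_refl transpose_minkowski smooth_map_const])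
  then have "smooth_section A (fst e) flat_metric"
    by (rule smooth_section_cong[OF open_domain]) (rule flat_metric_apply)
  then have "flat_metric \<in> sections A (fst e)"
    by (simp add: sections_iff[OF open_domain] flat_metric_def)
  moreover have "lorentz_matrix (flat_metric p c)" if "p \<in> fst e" "c \<in> charts_at A p" for p c
    unfolding flat_metric_component[OF that(2,1)]
    by (rule lorentz_minkowski_congruence[where Q = "jac e c p"])
      (use that in \<open>auto intro!: ext.jac_inverse simp: charts_at_def\<close>)
  ultimately show ?thesis unfolding lorentzian_metrics_def by blast
qed

lemma flat_metric_ricci_flat: "flat_metric \<in> ricci_flat_metrics A (fst e)"
proof -
  have "ricci_coord (\<lambda>x. flat_metric (chart_inv c x) c) (snd c p) = 0"
    if p: "p \<in> fst e" and c: "c \<in> charts_at A p" for p c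
  proof -
    have cA: "c \<in> A" "p \<in> fst c" using c by (auto simp: charts_at_def)
    let ?S = "snd c ` (fst c \<inter> fst e)"
    have at: "\<exists>q. q \<in> fst e \<and> c \<in> charts_at A q \<and> x = snd c q \<and> chart_inv c x = q" if "x \<in> ?S" for x
      using that cA by (auto simp: charts_at_def chart_inv_chart)
    \<comment> \<open>The flat coordinates are those of \<open>e\<close>, written as functions of
      the coordinates of the atlas chart \<open>c\<close>.\<close>
    interpret flat_coordinates ?S "\<lambda>a y. snd e (chart_inv c y) $ a" "\<lambda>y. jac e c (chart_inv c y)"
      "\<lambda>a. if a = (SOME k. True) then - 1 else 1" "\<lambda>x. flat_metric (chart_inv c x) c"
    proof
      show "open ?S" by (rule open_chart_image[OF cA(1) open_domain])
      then show "smooth_on ?S (\<lambda>y. snd e (chart_inv c y) $ a)" for a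
        using ext.smooth_transition[of c e] cA by (intro smooth_on_vec_nth) (auto simp: comp_def)
      show "smooth_on ?S (\<lambda>y. jac e c (chart_inv c y))"
        by (rule smooth_map_chartD[OF cA(1) smooth_map_subset[OF smooth_map_jac_ext]]) (use cA in auto)
      fix x assume x: "x \<in> ?S"
      then obtain q where q: "q \<in> fst e" "c \<in> charts_at A q" "x = snd c q" "chart_inv c x = q" using at by blast
      have pq: "partial l (\<lambda>y. snd e (chart_inv c y) $ a) x = jac c e q $ a $ l" for a l
        unfolding q(3) by (rule partial_coordinate) (use q(1,2) in \<open>auto simp: charts_at_def\<close>)
      show "(\<Sum>a\<in>UNIV. jac e c (chart_inv c x) $ k $ a * partial l (\<lambda>y. snd e (chart_inv c y) $ a) x) =
          (if k = l then 1 else 0)" for k l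
        unfolding pq q(4) by (rule jac_sums[OF q(2,1)])
      show "(\<Sum>l\<in>UNIV. partial l (\<lambda>y. snd e (chart_inv c y) $ a) x * jac e c (chart_inv c x) $ l $ b) =
          (if a = b then 1 else 0)" for a b
        unfolding pq q(4) by (rule jac_sums[OF q(2,1)])
      show "flat_metric (chart_inv c x) c $ i $ j = (\<Sum>a\<in>UNIV. (if a = (SOME k. True) then - 1 else 1) *
          (partial i (\<lambda>y. snd e (chart_inv c y) $ a) x * partial j (\<lambda>y. snd e (chart_inv c y) $ a) x))" for i j
        unfolding pq q(4) flat_metric_component[OF q(2,1)] by (rule minkowski_congruence)
    qed auto
    show ?thesis by (rule ricci_coord_flat) (use p cA in auto)
  qed
  then show ?thesis
    using flat_metric_lorentzian
    by (auto simp: ricci_flat_metrics_def ricci_def fun_eq_iff restrict_def)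
qed

end

subsection \<open>The algebra generated by Lie derivatives acts transitively on nonvanishing forms\<close>

text \<open>By the Leibniz rule only the terms that differentiate \<open>u\<close> survive. All
  derivatives of \<open>H\<close> cancel, so the difference is of order zero in \<open>H\<close> and
  \<open>H\<close> may be an arbitrary function.\<close>

lemma lie_coord_scale:
  assumes Y: "smooth_on S Y" and u: "smooth_on S u" and x: "x \<in> S" and S: "open S"
  shows "lie_coord (\<lambda>y. u y *\<^sub>R Y y) H x $ a $ b - u x * lie_coord Y H x $ a $ b =
    partial a u x * (\<Sum>k\<in>UNIV. H x $ k $ b * Y x $ k) + partial b u x * (\<Sum>k\<in>UNIV. H x $ a $ k * Y x $ k)"
  (is "?lhs = _")
proof -
  have d: "partial i (\<lambda>y. (u y *\<^sub>R Y y) $ k) x = u x * partial i (\<lambda>y. Y y $ k) x + partial i u x * Y x $ k" for i k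
    using partial_mult[OF u smooth_on_vec_nth[OF S Y] x] by simp
  have "?lhs = (\<Sum>k\<in>UNIV. (u x *\<^sub>R Y x) $ k * partial k (\<lambda>y. H y $ a $ b) x
      + H x $ k $ b * partial a (\<lambda>y. (u y *\<^sub>R Y y) $ k) x + H x $ a $ k * partial b (\<lambda>y. (u y *\<^sub>R Y y) $ k) x
      - u x * (Y x $ k * partial k (\<lambda>y. H y $ a $ b) x
      + H x $ k $ b * partial a (\<lambda>y. Y y $ k) x + H x $ a $ k * partial b (\<lambda>y. Y y $ k) x))"
    by (simp only: lie_coord_def vec_lambda_beta sum_distrib_left sum_subtractf)
  also have "\<dots> = (\<Sum>k\<in>UNIV. partial a u x * (H x $ k $ b * Y x $ k) + partial b u x * (H x $ a $ k * Y x $ k))"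
    unfolding d by (intro sum.cong refl) (simp add: algebra_simps)
  finally show ?thesis by (simp add: sum.distrib sum_distrib_left)
qed

text \<open>The generation rules offer binary sums and no neutral element, hence the induction over
  nonempty index sets.\<close>

lemma lie_algebra_ops_combination:
  assumes "finite K" "K \<noteq> {}"
    and "\<And>k. k \<in> K \<Longrightarrow> smooth_fun A U (f k)" "\<And>k. k \<in> K \<Longrightarrow> \<Phi> k \<in> lie_algebra_ops A U"
  shows "\<exists>\<Psi>\<in>lie_algebra_ops A U. \<forall>h. \<forall>p\<in>U. \<forall>c. \<Psi> h p c = (\<Sum>k\<in>K. f k p *\<^sub>R \<Phi> k h p c)"
  using assms
proof (induction K rule: finite_ne_induct)
  case (singleton k)
  then show ?case
    by (intro bexI[of _ "\<lambda>h. sec_smult U (f k) (\<Phi> k h)"] lie_algebra_ops.smult) (auto simp: sec_smult_def)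
next
  case (insert k K)
  then obtain \<Psi> where \<Psi>: "\<Psi> \<in> lie_algebra_ops A U" "\<forall>h. \<forall>p\<in>U. \<forall>c. \<Psi> h p c = (\<Sum>k\<in>K. f k p *\<^sub>R \<Phi> k h p c)"
    by auto
  have "(\<lambda>h. sec_smult U (f k) (\<Phi> k h)) \<in> lie_algebra_ops A U"
    by (rule lie_algebra_ops.smult) (use insert.prems in auto)
  then have "(\<lambda>h. sec_add U (sec_smult U (f k) (\<Phi> k h)) (\<Psi> h)) \<in> lie_algebra_ops A U"
    by (rule lie_algebra_ops.add[OF _ \<Psi>(1)])
  then show ?case
    using insert.hyps \<Psi>(2) by (rule_tac bexI) (auto simp: sec_add_def sec_smult_def)
qed

context compatible_chart
begin

definition coord_field :: "'n \<Rightarrow> 'a \<Rightarrow> ('a, 'n) tvec" where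
  "coord_field j = (\<lambda>p\<in>fst e. \<lambda>c. if c \<in> charts_at A p then column j (jac e c p) else 0)"

lemma smooth_coordinate: "smooth_map A (fst e) (\<lambda>p. snd e p $ i)"
  by (rule smooth_map_vec_nth[OF open_domain smooth_map_restrict_atlas[OF ext.smooth_map_chart]]) simp

lemma vector_field_scale:
  assumes u: "smooth_map A (fst e) u"
  shows "(\<lambda>p\<in>fst e. \<lambda>c. u p *\<^sub>R coord_field j p c) \<in> vector_fields A (fst e)"
  unfolding vector_fields_def
proof (intro CollectI conjI ballI)
  have "(\<lambda>c. u p *\<^sub>R coord_field j p c) \<in> tangent A p" if p: "p \<in> fst e" for p
  proof -
    show ?thesis
      unfolding tangent_def
    proof (intro CollectI conjI ballI allI impI)
      fix c d assume cd: "c \<in> charts_at A p" "d \<in> charts_at A p"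
      have jc: "jac e d p = jac c d p ** jac e c p"
        by (rule ext.jac_comp[symmetric]) (use p cd in \<open>auto simp: charts_at_def\<close>)
      have "column j (jac e d p) = jac c d p *v column j (jac e c p)"
        unfolding jc by (simp add: column_def matrix_matrix_mult_def matrix_vector_mult_def)
      then show "u p *\<^sub>R coord_field j p d = jac c d p *v (u p *\<^sub>R coord_field j p c)"
        using p cd by (simp add: coord_field_def matrix_vector_mult_scaleR)
    qed (simp add: coord_field_def p)
  qed
  then show "(\<lambda>p\<in>fst e. \<lambda>c. u p *\<^sub>R coord_field j p c) \<in> (\<Pi>\<^sub>E p\<in>fst e. tangent A p)" by auto
next
  fix c assume c: "c \<in> A"
  have o: "open (fst c \<inter> fst e)" using open_domain open_chart_domain[OF c] by blast
  have jm: "smooth_map A (fst c \<inter> fst e) (jac e c)"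
    by (rule smooth_map_subset[OF smooth_map_jac_ext[of e c]]) (use c in auto)
  have "smooth_map A (fst c \<inter> fst e) (\<lambda>p. u p *\<^sub>R column j (jac e c p))"
    unfolding column_def
    by (intro smooth_map_scaleR o smooth_map_subset[OF u] smooth_map_vec_lambda smooth_map_vec_nth jm) auto
  then have "smooth_map A (fst c \<inter> fst e) (\<lambda>p. (\<lambda>p\<in>fst e. \<lambda>c. u p *\<^sub>R coord_field j p c) p c)"
    by (rule smooth_map_cong[OF o]) (use c in \<open>auto simp: coord_field_def charts_at_def\<close>)
  then show "smooth_on (snd c ` (fst c \<inter> fst e)) (\<lambda>x. (\<lambda>p\<in>fst e. \<lambda>c. u p *\<^sub>R coord_field j p c) (chart_inv c x) c)"
    by (rule smooth_map_chartD[OF c]) simp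
qed

text \<open>For a function \<open>u\<close> and a field \<open>X\<close>, \<open>L\<^bsub>uX\<^esub> - u L\<^sub>X\<close> is the zero-order operator
  \<open>h \<mapsto> du \<otimes> h(X,-) + h(X,-) \<otimes> du\<close>; with coordinate functions and fields these give the action of
  all elementary matrices.\<close>

definition elementary_op :: "'n \<Rightarrow> 'n \<Rightarrow> ('a \<Rightarrow> ('a, 'n) form) \<Rightarrow> 'a \<Rightarrow> ('a, 'n) form" where
  "elementary_op i j = (\<lambda>h. sec_add (fst e)
     (lie_derivative A (fst e) (\<lambda>p\<in>fst e. \<lambda>c. snd e p $ i *\<^sub>R coord_field j p c) h)
     (sec_smult (fst e) (\<lambda>p. - snd e p $ i)
       (lie_derivative A (fst e) (\<lambda>p\<in>fst e. \<lambda>c. 1 *\<^sub>R coord_field j p c) h)))"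

lemma elementary_op_in: "elementary_op i j \<in> lie_algebra_ops A (fst e)"
  unfolding elementary_op_def
  by (intro lie_algebra_ops.intros vector_field_scale smooth_coordinate smooth_map_const)
    (auto simp: smooth_fun_iff intro!: smooth_map_minus open_domain smooth_coordinate)

lemma elementary_op_off_charts: "p \<in> fst e \<Longrightarrow> c \<notin> charts_at A p \<Longrightarrow> elementary_op i j h p c = 0"
  by (simp add: elementary_op_def sec_add_def sec_smult_def lie_derivative_def)

text \<open>Row \<open>i\<close> of \<open>jac c e p\<close> is du for the coordinate u numbered
  \<open>i\<close>, and column \<open>j\<close> of \<open>jac e c p\<close> is the coordinate field
  X numbered \<open>j\<close>; the right-hand side is du \<otimes> h(X,-) + h(-,X) \<otimes> du in
  the chart \<open>c\<close>.\<close>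

lemma elementary_op_component:
  assumes p: "p \<in> fst e" and c: "c \<in> charts_at A p"
  shows "elementary_op i j h p c $ a $ b =
    jac c e p $ i $ a * (\<Sum>k\<in>UNIV. h p c $ k $ b * jac e c p $ k $ j) +
    jac c e p $ i $ b * (\<Sum>k\<in>UNIV. h p c $ a $ k * jac e c p $ k $ j)"
proof -
  have cA: "c \<in> A" "p \<in> fst c" using c by (auto simp: charts_at_def)
  let ?S = "snd c ` (fst c \<inter> fst e)" and ?H = "\<lambda>x. h (chart_inv c x) c"
    and ?u = "\<lambda>x. snd e (chart_inv c x) $ i" and ?Y = "\<lambda>x. (\<lambda>p\<in>fst e. \<lambda>c. 1 *\<^sub>R coord_field j p c) (chart_inv c x) c"
  have S: "open ?S" by (rule open_chart_image[OF cA(1) open_domain])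
  have inv: "chart_inv c (snd c p) = p" by (rule chart_inv_chart[OF cA])
  have x: "snd c p \<in> ?S" using p cA by blast
  have Y: "smooth_on ?S ?Y"
    using vector_field_scale[OF smooth_map_const, of 1 j] cA(1) unfolding vector_fields_def by blast
  have u: "smooth_on ?S ?u"
    using smooth_coordinate[of i] cA(1) unfolding smooth_map_def by blast
  \<comment> \<open>The restricted function that defines the scaled field and the product of
    \<open>?u\<close> and \<open>?Y\<close> agree on the chart image only, which is enough since
    partial derivatives see only the germ.\<close>
  have eq: "lie_coord (\<lambda>x. (\<lambda>p\<in>fst e. \<lambda>c. snd e p $ i *\<^sub>R coord_field j p c) (chart_inv c x) c) ?H (snd c p) =
      lie_coord (\<lambda>x. ?u x *\<^sub>R ?Y x) ?H (snd c p)"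
  proof -
    have "partial m (\<lambda>y. (\<lambda>p\<in>fst e. \<lambda>c. snd e p $ i *\<^sub>R coord_field j p c) (chart_inv c y) c $ k) (snd c p) =
        partial m (\<lambda>y. (?u y *\<^sub>R ?Y y) $ k) (snd c p)" for m k
      by (rule partial_cong[OF S x]) (use chart_inv_chart[OF cA(1)] in auto)
    then show ?thesis using p inv by (simp add: lie_coord_def)
  qed
  have "elementary_op i j h p c $ a $ b = lie_coord (\<lambda>x. ?u x *\<^sub>R ?Y x) ?H (snd c p) $ a $ b
      - ?u (snd c p) * lie_coord ?Y ?H (snd c p) $ a $ b"
    using p c eq inv by (simp add: elementary_op_def sec_add_def sec_smult_def lie_derivative_def)
  also have "\<dots> = jac c e p $ i $ a * (\<Sum>k\<in>UNIV. h p c $ k $ b * jac e c p $ k $ j) +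
    jac c e p $ i $ b * (\<Sum>k\<in>UNIV. h p c $ a $ k * jac e c p $ k $ j)"
    unfolding lie_coord_scale[OF Y u x S]
    using partial_coordinate[of c p _ i] p c cA inv by (simp add: coord_field_def column_def)
  finally show ?thesis .
qed

text \<open>In the composite the inner result is contracted with the field numbered
  \<open>j\<close>. One term extracts the coefficient of \<open>h\<close> at (j, l); the others
  arise when \<open>j = k\<close> and form \<open>elementary_op i l h\<close>, which is
  subtracted.\<close>

definition rank_one_op :: "'n \<Rightarrow> 'n \<Rightarrow> 'n \<Rightarrow> 'n \<Rightarrow> ('a \<Rightarrow> ('a, 'n) form) \<Rightarrow> 'a \<Rightarrow> ('a, 'n) form" where
  "rank_one_op i j k l = (\<lambda>h. sec_add (fst e) (elementary_op i j (elementary_op k l h))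
     (sec_smult (fst e) (\<lambda>p. if j = k then - 1 else 0) (elementary_op i l h)))"

lemma rank_one_op_in: "rank_one_op i j k l \<in> lie_algebra_ops A (fst e)"
  unfolding rank_one_op_def
  by (rule lie_algebra_ops.add[OF lie_algebra_ops.comp[OF elementary_op_in elementary_op_in]
        lie_algebra_ops.smult[OF _ elementary_op_in]])
    (simp add: smooth_fun_iff smooth_map_const)

lemma rank_one_op_off_charts: "p \<in> fst e \<Longrightarrow> c \<notin> charts_at A p \<Longrightarrow> rank_one_op i j k l h p c = 0"
  by (simp add: rank_one_op_def sec_add_def sec_smult_def elementary_op_off_charts)

lemma rank_one_op_component:
  assumes p: "p \<in> fst e" and c: "c \<in> charts_at A p" and h: "h p \<in> sym2 A p"
  shows "rank_one_op i j k l h p c $ a $ b = coord A e p (h p) $ j $ l *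
    (jac c e p $ i $ a * jac c e p $ k $ b + jac c e p $ i $ b * jac c e p $ k $ a)"
proof -
  define P where "P = jac c e p"
  define Q where "Q = jac e c p"
  \<comment> \<open>\<open>w l\<close> is the covector obtained by inserting the coordinate field
    numbered \<open>l\<close> into \<open>h p\<close>, written in the chart
    \<open>c\<close>.\<close>
  define w where "w l b = (\<Sum>n\<in>UNIV. h p c $ n $ b * Q $ n $ l)" for l b
  have sym: "h p c $ m $ n = h p c $ n $ m" for m n
    using arg_cong[OF sym2D(2)[OF h c], of "\<lambda>S. S $ n $ m"] by (simp add: transpose_def)
  have PQ: "(\<Sum>m\<in>UNIV. P $ k $ m * Q $ m $ j) = (if k = j then 1 else 0)"
    unfolding P_def Q_def by (rule jac_sums[OF c p])
  have D: "elementary_op k l h p c $ a $ b = P $ k $ a * w l b + P $ k $ b * w l a" for k l a b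
    unfolding elementary_op_component[OF p c] P_def[symmetric] Q_def[symmetric] w_def
    by (simp add: sym[of a])
  have coord: "coord A e p (h p) $ j $ l = (\<Sum>m\<in>UNIV. w l m * Q $ m $ j)"
  proof -
    have "coord A e p (h p) $ j $ l = (\<Sum>n\<in>UNIV. (\<Sum>m\<in>UNIV. Q $ m $ j * h p c $ m $ n) * Q $ n $ l)"
      unfolding coord_eq[OF h p c] Q_def[symmetric] by (simp add: matrix_matrix_mult_def transpose_def)
    also have "\<dots> = (\<Sum>m\<in>UNIV. \<Sum>n\<in>UNIV. h p c $ n $ m * Q $ n $ l * Q $ m $ j)"
      unfolding sum_distrib_right by (subst sum.swap) (simp add: sym mult_ac)
    finally show ?thesis unfolding w_def sum_distrib_right .
  qed
  have E: "(\<Sum>m\<in>UNIV. (P $ k $ m * w l b + P $ k $ b * w l m) * Q $ m $ j) =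
      (if k = j then w l b else 0) + P $ k $ b * coord A e p (h p) $ j $ l" for b
  proof -
    have "(\<Sum>m\<in>UNIV. (P $ k $ m * w l b + P $ k $ b * w l m) * Q $ m $ j) =
        w l b * (\<Sum>m\<in>UNIV. P $ k $ m * Q $ m $ j) + P $ k $ b * (\<Sum>m\<in>UNIV. w l m * Q $ m $ j)"
      by (simp add: sum_distrib_left sum.distrib[symmetric] algebra_simps)
    then show ?thesis unfolding PQ coord by simp
  qed
  have "elementary_op i j (elementary_op k l h) p c $ a $ b =
      P $ i $ a * (\<Sum>m\<in>UNIV. (P $ k $ m * w l b + P $ k $ b * w l m) * Q $ m $ j) +
      P $ i $ b * (\<Sum>m\<in>UNIV. (P $ k $ m * w l a + P $ k $ a * w l m) * Q $ m $ j)"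
    unfolding elementary_op_component[OF p c, of i j] D P_def[symmetric] Q_def[symmetric]
    by (simp add: add.commute mult.commute)
  then have "rank_one_op i j k l h p c $ a $ b =
      P $ i $ a * ((if k = j then w l b else 0) + P $ k $ b * coord A e p (h p) $ j $ l) +
      P $ i $ b * ((if k = j then w l a else 0) + P $ k $ a * coord A e p (h p) $ j $ l) +
      (if j = k then - 1 else 0) * (P $ i $ a * w l b + P $ i $ b * w l a)"
    unfolding E using p by (simp add: rank_one_op_def sec_add_def sec_smult_def D)
  then show ?thesis
    unfolding P_def[symmetric] by (simp add: algebra_simps)
qed

text \<open>A rank-one operator multiplies a fixed symmetric form by one coefficient of its
  argument. Weights proportional to the coefficients of \<open>h\<close> turn that factor into a sum
  of squares, which is positive and can be divided out. The operator depends on \<open>h\<close>,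
  and only its value at \<open>h\<close> is prescribed.\<close>

theorem lie_algebra_transitive:
  assumes h: "smooth_section A (fst e) h" "\<And>p. p \<in> fst e \<Longrightarrow> coord A e p (h p) \<noteq> 0"
    and s: "smooth_section A (fst e) s"
  shows "\<exists>\<Phi>\<in>lie_algebra_ops A (fst e). \<forall>p\<in>fst e. \<Phi> h p = s p"
proof -
  have hs: "h p \<in> sym2 A p" and ss: "s p \<in> sym2 A p" if "p \<in> fst e" for p
    using h(1) s that unfolding smooth_section_def by blast+
  define \<gamma> where "\<gamma> p = coord A e p (h p)" for p
  define \<sigma> where "\<sigma> p = coord A e p (s p)" for p
  define N where "N p = (\<Sum>m\<in>UNIV. \<gamma> p $ fst m $ snd m * \<gamma> p $ fst m $ snd m)" for p
  have \<gamma>: "smooth_map A (fst e) \<gamma>" unfolding \<gamma>_def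
    using smooth_section_iff_coord[OF open_domain order_refl hs] h(1) by blast
  have \<sigma>: "smooth_map A (fst e) \<sigma>" unfolding \<sigma>_def
    using smooth_section_iff_coord[OF open_domain order_refl ss] s by blast
  have N0: "N p \<noteq> 0" if "p \<in> fst e" for p
  proof
    assume "N p = 0"
    then have "\<gamma> p $ fst m $ snd m = 0" for m
      unfolding N_def by (subst (asm) sum_nonneg_eq_0_iff) auto
    then have "\<gamma> p = 0" by (metis fst_conv snd_conv vec_eq_iff zero_index)
    then show False using h(2)[OF that] by (simp add: \<gamma>_def)
  qed
  have N: "smooth_map A (fst e) N" unfolding N_def
    by (intro smooth_map_sum smooth_map_mult smooth_map_vec_nth open_domain \<gamma>)
  \<comment> \<open>The weights are normalized by \<open>N\<close>, so that at \<open>h\<close> the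
    coefficient extraction sums to 1.\<close>
  have "\<exists>T\<in>lie_algebra_ops A (fst e). \<forall>g. \<forall>p\<in>fst e. \<forall>c. T g p c =
      (\<Sum>m\<in>UNIV. (\<gamma> p $ fst m $ snd m / N p) *\<^sub>R rank_one_op i (fst m) k (snd m) g p c)" for i k
  proof (rule lie_algebra_ops_combination[OF finite UNIV_not_empty _ rank_one_op_in], unfold smooth_fun_iff)
    fix m
    show "smooth_map A (fst e) (\<lambda>p. \<gamma> p $ fst m $ snd m / N p)"
      by (rule smooth_map_divide[OF open_domain N0 _ N]) (assumption, intro smooth_map_vec_nth open_domain \<gamma>)
  qed
  then have "\<forall>ik. \<exists>T. T \<in> lie_algebra_ops A (fst e) \<and> (\<forall>g. \<forall>p\<in>fst e. \<forall>c. T g p c =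
      (\<Sum>m\<in>UNIV. (\<gamma> p $ fst m $ snd m / N p) *\<^sub>R rank_one_op (fst ik) (fst m) (snd ik) (snd m) g p c))"
    unfolding Bex_def by (intro allI)
  from choice[OF this] obtain T where "\<forall>ik. T ik \<in> lie_algebra_ops A (fst e) \<and> (\<forall>g. \<forall>p\<in>fst e. \<forall>c. T ik g p c =
      (\<Sum>m\<in>UNIV. (\<gamma> p $ fst m $ snd m / N p) *\<^sub>R rank_one_op (fst ik) (fst m) (snd ik) (snd m) g p c))"
    by (elim exE)
  note T = this[THEN spec, THEN conjunct1] this[THEN spec, THEN conjunct2, rule_format]
  have Th: "T ik h p c $ a $ b = jac c e p $ fst ik $ a * jac c e p $ snd ik $ b + jac c e p $ fst ik $ b * jac c e p $ snd ik $ a"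
    (is "_ = ?R") if p: "p \<in> fst e" and c: "c \<in> charts_at A p" for ik p c a b
  proof -
    have "T ik h p c $ a $ b = (\<Sum>m\<in>UNIV. (\<gamma> p $ fst m $ snd m / N p) * (\<gamma> p $ fst m $ snd m * ?R))"
      by (simp add: T(2)[OF p] rank_one_op_component[where h = h, OF p c hs[OF p]] \<gamma>_def)
    also have "\<dots> = N p / N p * ?R"
      unfolding N_def sum_divide_distrib sum_distrib_right by (intro sum.cong) simp_all
    finally show ?thesis using N0[OF p] by simp
  qed
  \<comment> \<open>At \<open>h\<close> the operator \<open>T (i, k)\<close> gives both orderings of
    the product of du_i and du_k; since \<sigma> is symmetric, the sum over all pairs counts every
    term twice.\<close>
  have "\<exists>\<Phi>\<in>lie_algebra_ops A (fst e). \<forall>g. \<forall>p\<in>fst e. \<forall>c. \<Phi> g p c =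
      (\<Sum>m\<in>UNIV. (\<sigma> p $ fst m $ snd m / 2) *\<^sub>R T m g p c)"
  proof (rule lie_algebra_ops_combination[OF finite UNIV_not_empty _ T(1)], unfold smooth_fun_iff)
    fix m
    show "smooth_map A (fst e) (\<lambda>p. \<sigma> p $ fst m $ snd m / 2)"
      by (rule smooth_map_divide[OF open_domain _ _ smooth_map_const])
        (simp, intro smooth_map_vec_nth open_domain \<sigma>)
  qed
  then obtain \<Phi> where \<Phi>: "\<Phi> \<in> lie_algebra_ops A (fst e)"
      "\<forall>g. \<forall>p\<in>fst e. \<forall>c. \<Phi> g p c = (\<Sum>m\<in>UNIV. (\<sigma> p $ fst m $ snd m / 2) *\<^sub>R T m g p c)"
    by (elim bexE)
  note \<Phi>_eq = \<Phi>(2)[rule_format]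
  have "\<Phi> h p c = s p c" if p: "p \<in> fst e" for p c
  proof (cases "c \<in> charts_at A p")
    case True
    let ?P = "jac c e p"
    have sym: "\<sigma> p $ k $ i = \<sigma> p $ i $ k" for i k
      using arg_cong[OF transpose_coord[OF ss[OF p] p], of "\<lambda>S. S $ i $ k"] by (simp add: \<sigma>_def transpose_def)
    have "\<Phi> h p c $ a $ b = s p c $ a $ b" for a b
    proof -
      have "\<Phi> h p c $ a $ b = (\<Sum>m\<in>UNIV. (\<sigma> p $ fst m $ snd m / 2) *
          (?P $ fst m $ a * ?P $ snd m $ b + ?P $ fst m $ b * ?P $ snd m $ a))"
        using p True by (simp add: \<Phi>_eq Th)
      also have "\<dots> = (\<Sum>i\<in>UNIV. \<Sum>k\<in>UNIV. (\<sigma> p $ i $ k / 2) * (?P $ i $ a * ?P $ k $ b + ?P $ i $ b * ?P $ k $ a))"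
        by (simp add: sum.cartesian_product UNIV_Times_UNIV[symmetric] case_prod_unfold del: UNIV_Times_UNIV)
      also have "\<dots> = (\<Sum>i\<in>UNIV. \<Sum>k\<in>UNIV. \<sigma> p $ i $ k / 2 * (?P $ i $ a * ?P $ k $ b)) +
          (\<Sum>i\<in>UNIV. \<Sum>k\<in>UNIV. \<sigma> p $ k $ i / 2 * (?P $ k $ a * ?P $ i $ b))"
        by (simp add: sum.distrib distrib_left sym mult_ac)
      also have "\<dots> = (\<Sum>i\<in>UNIV. \<Sum>k\<in>UNIV. \<sigma> p $ i $ k * (?P $ i $ a * ?P $ k $ b))"
        by (subst (2) sum.swap) (simp add: sum.distrib[symmetric])
      also have "\<dots> = (transpose ?P ** \<sigma> p ** ?P) $ a $ b"
        unfolding matrix_matrix_mult_def transpose_def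
        by (subst sum.swap) (simp add: sum_distrib_right sum_distrib_left mult_ac)
      also have "\<dots> = form_of A e p (\<sigma> p) c $ a $ b" using True by (simp add: form_of_def)
      finally show ?thesis unfolding \<sigma>_def form_of_coord[OF ss[OF p] p] .
    qed
    then show ?thesis by (simp add: vec_eq_iff)
  next
    case False
    then show ?thesis
      using p sym2D(1)[OF ss[OF p] False] by (simp add: \<Phi>_eq T(2) rank_one_op_off_charts)
  qed
  then show ?thesis using \<Phi>(1) by blast
qed

end

subsection \<open>Trivializing descent data over a disk\<close>

context compatible_chart
begin

text \<open>The frame of \<open>e\<close> identifies the fibre at \<open>p\<close> with the fibre at
  \<open>\<rho> p\<close>, and conjugation by this identification lets the automorphism at
  \<open>\<rho> p\<close> act at \<open>p\<close>.\<close>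

definition pullback :: "('a \<Rightarrow> 'a) \<Rightarrow> ('a \<Rightarrow> ('a, 'n) form \<Rightarrow> ('a, 'n) form) \<Rightarrow> 'a \<Rightarrow> ('a, 'n) form \<Rightarrow> ('a, 'n) form" where
  "pullback \<rho> a p t = form_of A e p (coord A e (\<rho> p) (a (\<rho> p) (form_of A e (\<rho> p) (coord A e p t))))"

lemma pullback_sym2:
  assumes "p \<in> fst e" "\<rho> p \<in> fst e" "t \<in> sym2 A p"
    and "\<And>t. t \<in> sym2 A (\<rho> p) \<Longrightarrow> a (\<rho> p) t \<in> sym2 A (\<rho> p)"
  shows "pullback \<rho> a p t \<in> sym2 A p"
  unfolding pullback_def
  by (rule form_of_sym2[OF transpose_coord[OF assms(4)[OF form_of_sym2[OF transpose_coord]]]]) (use assms in auto)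

lemma pullback_pullback:
  assumes p: "p \<in> fst e" "\<rho> p \<in> fst e" "t \<in> sym2 A p"
    and b: "\<And>t. t \<in> sym2 A (\<rho> p) \<Longrightarrow> b (\<rho> p) t \<in> sym2 A (\<rho> p)"
    and ab: "\<And>t. t \<in> sym2 A (\<rho> p) \<Longrightarrow> a (\<rho> p) (b (\<rho> p) t) = t"
  shows "pullback \<rho> a p (pullback \<rho> b p t) = t"
proof -
  let ?t = "form_of A e (\<rho> p) (coord A e p t)"
  have t: "?t \<in> sym2 A (\<rho> p)" by (rule form_of_sym2[OF transpose_coord[OF p(3,1)] p(2)])
  have "pullback \<rho> a p (pullback \<rho> b p t) =
      form_of A e p (coord A e (\<rho> p) (a (\<rho> p) (form_of A e (\<rho> p) (coord A e (\<rho> p) (b (\<rho> p) ?t)))))"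
    unfolding pullback_def coord_form_of[OF transpose_coord[OF b[OF t] p(2)] p(1)] ..
  also have "\<dots> = form_of A e p (coord A e p t)"
    unfolding form_of_coord[OF b[OF t] p(2)] ab[OF t] coord_form_of[OF transpose_coord[OF p(3,1)] p(2)] ..
  also have "\<dots> = t" by (rule form_of_coord[OF p(3,1)])
  finally show ?thesis .
qed

text \<open>In the frame of \<open>e\<close>, pulling back amounts to composing the component
  functions of \<open>a\<close> with \<open>r\<close>, so smoothness of \<open>r\<close> is what
  counts.\<close>

lemma pullback_endo:
  assumes Y: "open Y" "Y \<subseteq> fst e" and Z: "open Z" "Z \<subseteq> fst e" "\<rho> ` Y \<subseteq> Z"
    and r: "smooth_on UNIV r" "\<And>p. p \<in> Y \<Longrightarrow> snd e (\<rho> p) = r (snd e p)"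
    and a: "smooth_endo A Z a"
  shows "smooth_endo A Y (pullback \<rho> a)"
proof (rule smooth_endo_frameI[OF Y])
  fix p assume p: "p \<in> Y"
  then have pe: "p \<in> fst e" "\<rho> p \<in> Z" "\<rho> p \<in> fst e" using Y Z by auto
  note lin = sym2_linearD[OF smooth_endo_linear[OF a pe(2)]]
  show "sym2_linear A p (pullback \<rho> a p)"
    unfolding sym2_linear_def
  proof (intro conjI ballI allI)
    show "pullback \<rho> a p t \<in> sym2 A p" if "t \<in> sym2 A p" for t
      by (rule pullback_sym2[where \<rho> = \<rho> and a = a, OF pe(1,3) that lin(1)])
    fix s t x y assume st: "s \<in> sym2 A p" "t \<in> sym2 A p"
    have *: "form_of A e (\<rho> p) (coord A e p s) \<in> sym2 A (\<rho> p)" "form_of A e (\<rho> p) (coord A e p t) \<in> sym2 A (\<rho> p)"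
      using st pe by (auto intro!: form_of_sym2 transpose_coord)
    show "pullback \<rho> a p (\<lambda>c. x *\<^sub>R s c + y *\<^sub>R t c) =
        (\<lambda>c. x *\<^sub>R pullback \<rho> a p s c + y *\<^sub>R pullback \<rho> a p t c)"
      unfolding pullback_def coord_lincomb form_of_lincomb lin(2)[OF *] ..
  qed
next
  fix S :: "real^'n^'n" assume S: "transpose S = S"
  define m where "m q = coord A e q (a q (form_of A e q S))" for q
  have sec: "smooth_section A Z (\<lambda>q. a q (form_of A e q S))"
    by (rule smooth_endo_section[OF a Z(1) order_refl smooth_section_form_of[OF Z(1,2) S smooth_map_const]])
  have "smooth_map A Z m" unfolding m_def
    by (rule iffD1[OF smooth_section_iff_coord[OF Z(1,2)] sec]) (use sec in \<open>simp add: smooth_section_def\<close>)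
  then have "smooth_map (insert e A) Z m"
    using Z(1,2) domain_subset by (intro smooth_map_ext) auto
  then have m: "smooth_on (snd e ` Z) (\<lambda>x. m (chart_inv e x))"
    by (rule ext.smooth_map_chartD[OF insertI1 _ Z(2)])
  have inv: "chart_inv e (snd e q) = q" if "q \<in> fst e" for q using ext.chart_inv_chart that by simp
  have se: "smooth_map A Y (snd e)"
    by (rule smooth_map_subset[OF smooth_map_restrict_atlas[OF ext.smooth_map_chart[OF insertI1]] Y(2)])
  have "smooth_map A Y (\<lambda>p. r (snd e p))"
    by (rule smooth_map_compose[OF Y(1) subset_UNIV se r(1)])
  then have "smooth_map A Y (\<lambda>p. m (chart_inv e (r (snd e p))))"
    by (rule smooth_map_compose[OF Y(1) _ _ m, rotated]) (use Z(3) r(2) in force)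
  then show "smooth_map A Y (\<lambda>p. coord A e p (pullback \<rho> a p (form_of A e p S)))"
  proof (rule smooth_map_cong[OF Y(1)])
    fix p assume p: "p \<in> Y"
    then have pe: "p \<in> fst e" "\<rho> p \<in> Z" "\<rho> p \<in> fst e" using Y Z by auto
    have "a (\<rho> p) (form_of A e (\<rho> p) S) \<in> sym2 A (\<rho> p)"
      by (rule smooth_endo_sym2[OF a pe(2) form_of_sym2[OF S pe(3)]])
    then show "coord A e p (pullback \<rho> a p (form_of A e p S)) = m (chart_inv e (r (snd e p)))"
      unfolding pullback_def coord_form_of[OF S pe(1)] r(2)[OF p, symmetric] inv[OF pe(3)] m_def
      by (intro coord_form_of transpose_coord pe)
  qed
qed

lemma pullback_aut:
  assumes Y: "open Y" "Y \<subseteq> fst e" and Z: "open Z" "Z \<subseteq> fst e" "\<rho> ` Y \<subseteq> Z"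
    and r: "smooth_on UNIV r" "\<And>p. p \<in> Y \<Longrightarrow> snd e (\<rho> p) = r (snd e p)"
    and a: "smooth_aut A Z a"
  shows "smooth_aut A Y (pullback \<rho> a)"
proof (rule smooth_autI)
  note inv = aut_inv[OF Z(1) a]
  show "smooth_endo A Y (pullback \<rho> a)" "smooth_endo A Y (pullback \<rho> (aut_inv A a))"
    by (rule pullback_endo[OF Y Z r smooth_aut_endo[OF a]], assumption,
        rule pullback_endo[OF Y Z r inv(1)], assumption)
  fix p t assume p: "p \<in> Y" "t \<in> sym2 A p"
  then have pe: "p \<in> fst e" "\<rho> p \<in> Z" "\<rho> p \<in> fst e" using Y Z by auto
  show "pullback \<rho> a p (pullback \<rho> (aut_inv A a) p t) = t"
    by (rule pullback_pullback[where \<rho> = \<rho> and a = a and b = "aut_inv A a", OF pe(1,3) p(2) smooth_endo_sym2[OF inv(1) pe(2)] inv(2)[OF pe(2)]])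
  show "pullback \<rho> (aut_inv A a) p (pullback \<rho> a p t) = t"
    by (rule pullback_pullback[where \<rho> = \<rho> and b = a and a = "aut_inv A a", OF pe(1,3) p(2) smooth_aut_sym2[OF a pe(2)] inv(3)[OF pe(2)]])
qed

text \<open>The linear map that fixes the hyperplane on which the functional \<open>m\<close>
  vanishes and sends \<open>h p\<close> to \<open>g p\<close>. The redundant scalars 1 and -1 give
  it the shape of a linear combination to which \<open>sym2_lincomb\<close> and
  \<open>coord_lincomb\<close> apply.\<close>

definition shear :: "real^'n^'n \<Rightarrow> ('a \<Rightarrow> ('a, 'n) form) \<Rightarrow> ('a \<Rightarrow> ('a, 'n) form) \<Rightarrow> 'a \<Rightarrow> ('a, 'n) form \<Rightarrow> ('a, 'n) form" where
  "shear m h g p t = (\<lambda>c. 1 *\<^sub>R t c + ((m \<bullet> coord A e p t) / (m \<bullet> coord A e p (h p))) *\<^sub>R (1 *\<^sub>R g p c + (- 1) *\<^sub>R h p c))"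

lemma coord_shear:
  "coord A e p (shear m h g p t) = coord A e p t +
    ((m \<bullet> coord A e p t) / (m \<bullet> coord A e p (h p))) *\<^sub>R (coord A e p (g p) - coord A e p (h p))"
  unfolding shear_def coord_lincomb by simp

lemma shear_endo:
  assumes W: "open W" "W \<subseteq> fst e" and h: "smooth_section A W h" and g: "smooth_section A W g"
    and m: "\<And>p. p \<in> W \<Longrightarrow> m \<bullet> coord A e p (h p) \<noteq> 0"
  shows "smooth_endo A W (shear m h g)"
proof (rule smooth_endoI)
  have hs: "h p \<in> sym2 A p" "g p \<in> sym2 A p" if "p \<in> W" for p
    using h g that unfolding smooth_section_def by blast+
  have sh: "shear m h g p t \<in> sym2 A p" if "p \<in> W" "t \<in> sym2 A p" for p t
    unfolding shear_def using that hs by (intro sym2_lincomb) auto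
  have coords: "smooth_map A W' (\<lambda>p. coord A e p (s p))" if "open W'" "W' \<subseteq> W" "smooth_section A W' s" for W' s
    using that W(2) smooth_section_iff_coord[of W' s] unfolding smooth_section_def by blast
  show "sym2_linear A p (shear m h g p)" if p: "p \<in> W" for p
    unfolding sym2_linear_def
  proof (intro conjI ballI allI sh[OF p])
    fix s t x y
    show "shear m h g p (\<lambda>c. x *\<^sub>R s c + y *\<^sub>R t c) = (\<lambda>c. x *\<^sub>R shear m h g p s c + y *\<^sub>R shear m h g p t c)"
      unfolding shear_def coord_lincomb
      by (simp add: fun_eq_iff inner_add_right add_divide_distrib algebra_simps)
  qed
  fix W' s assume W': "open W'" "W' \<subseteq> W" and s: "smooth_section A W' s"
  have ss: "s p \<in> sym2 A p" if "p \<in> W'" for p using s that unfolding smooth_section_def by blast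
  have inner: "smooth_map A W' (\<lambda>p. m \<bullet> F p)" if "smooth_map A W' F" for F
    by (rule smooth_map_linear[OF bounded_linear_inner_right W'(1) that])
  note c = coords[OF W' s] coords[OF W' smooth_section_subset[OF h W'(2)]] coords[OF W' smooth_section_subset[OF g W'(2)]]
  have "smooth_map A W' (\<lambda>p. coord A e p (shear m h g p (s p)))"
    unfolding coord_shear using m W'(2)
    by (intro smooth_map_add smooth_map_scaleR smooth_map_divide smooth_map_diff inner c W'(1)) auto
  then show "smooth_section A W' (\<lambda>p. shear m h g p (s p))"
    using smooth_section_iff_coord[OF W'(1), of "\<lambda>p. shear m h g p (s p)"] W W' sh ss by blast
qed

text \<open>The quotient of \<open>m\<close> on \<open>t\<close> by \<open>m\<close> on
  \<open>h p\<close> equals that of \<open>m\<close> on the image of \<open>t\<close> by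
  \<open>m\<close> on \<open>g p\<close>. Hence exchanging \<open>g\<close> and \<open>h\<close>
  subtracts exactly what was added.\<close>

lemma shear_shear:
  assumes "m \<bullet> coord A e p (h p) \<noteq> 0" "m \<bullet> coord A e p (g p) \<noteq> 0"
  shows "shear m g h p (shear m h g p t) = t"
proof -
  have "(m \<bullet> coord A e p (shear m h g p t)) / (m \<bullet> coord A e p (g p)) = (m \<bullet> coord A e p t) / (m \<bullet> coord A e p (h p))"
    unfolding coord_shear using assms by (simp add: inner_add_right inner_diff_right field_simps)
  then show ?thesis
    unfolding shear_def[of m g h] by (simp add: shear_def fun_eq_iff algebra_simps)
qed

lemma shear_aut:
  assumes W: "open W" "W \<subseteq> fst e" and h: "smooth_section A W h" and g: "smooth_section A W g"
    and m: "\<And>p. p \<in> W \<Longrightarrow> m \<bullet> coord A e p (h p) \<noteq> 0" "\<And>p. p \<in> W \<Longrightarrow> m \<bullet> coord A e p (g p) \<noteq> 0"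
  shows "smooth_aut A W (shear m h g)"
  by (rule smooth_autI[OF shear_endo[OF W h g m(1)] shear_endo[OF W g h m(2)]])
    (auto intro!: shear_shear m)

lemma shear_apply: "m \<bullet> coord A e p (h p) \<noteq> 0 \<Longrightarrow> shear m h g p (h p) = g p"
  by (simp add: shear_def)

end

text \<open>Supplies a functional for a shear: it must be nonzero on the source for the map to exist
  and on the target for it to be invertible.\<close>

lemma exists_nonorthogonal:
  fixes u v :: "'b::real_inner"
  assumes "u \<noteq> 0" "v \<noteq> 0"
  shows "\<exists>m. m \<bullet> u \<noteq> 0 \<and> m \<bullet> v \<noteq> 0"
proof (cases "u \<bullet> v = 0")
  case True
  then show ?thesis using assms by (intro exI[of _ "u + v"]) (simp add: inner_add_left inner_commute[of v u])
next
  case False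
  then show ?thesis using assms by (intro exI[of _ u]) simp
qed

text \<open>The part of a descent datum that enters the trivialization: the metrics appear as
  nonvanishing sections. The matrix \<open>D\<close> is constant in the frame of \<open>e\<close>,
  and choosing it as \<open>minkowski\<close> later makes the target Ricci-flat.\<close>

locale descent_data = disk_chart M A e
  for M :: "'a::{t2_space, second_countable_topology} set" and A :: "('a, 'n::finite) chart set" and e +
  fixes I :: "'i set" and U :: "'i \<Rightarrow> 'a set" and x :: "'i \<Rightarrow> 'a \<Rightarrow> ('a, 'n) form"
    and h :: "'i \<Rightarrow> 'i \<Rightarrow> 'a \<Rightarrow> ('a, 'n) form \<Rightarrow> ('a, 'n) form" and D :: "real^'n^'n"
  assumes open_U: "i \<in> I \<Longrightarrow> open (U i)" and cover: "(\<Union>i\<in>I. U i) = fst e"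
    and x: "i \<in> I \<Longrightarrow> smooth_section A (U i) (x i)"
    and x_nonzero: "i \<in> I \<Longrightarrow> p \<in> U i \<Longrightarrow> coord A e p (x i p) \<noteq> 0"
    and h: "i \<in> I \<Longrightarrow> j \<in> I \<Longrightarrow> smooth_aut A (U i \<inter> U j) (h i j)"
    and h_x: "i \<in> I \<Longrightarrow> j \<in> I \<Longrightarrow> p \<in> U i \<Longrightarrow> p \<in> U j \<Longrightarrow> h i j p (x i p) = x j p"
    and cocycle: "i \<in> I \<Longrightarrow> j \<in> I \<Longrightarrow> k \<in> I \<Longrightarrow> p \<in> U i \<Longrightarrow> p \<in> U j \<Longrightarrow> p \<in> U k \<Longrightarrow> t \<in> sym2 A p \<Longrightarrow>
      h j k p (h i j p t) = h i k p t"
    and D: "transpose D = D" "D \<noteq> 0"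
begin

abbreviation "y p \<equiv> form_of A e p D"

abbreviation "preim W \<equiv> fst e \<inter> snd e -` W"

text \<open>Over \<open>W\<close>, \<open>s\<close> trivializes the bundle glued from the cocycle \<open>h\<close> by identifying it with
  \<open>Sym\<^sup>2(T\<^sup>*M)\<close>, in such a way that the glued section \<open>x\<close> corresponds to the constant section \<open>y\<close>.\<close>

definition solution :: "(real^'n) set \<Rightarrow> (real^'n \<Rightarrow> 'i \<Rightarrow> ('a, 'n) form \<Rightarrow> ('a, 'n) form) \<Rightarrow> bool" where
  "solution W s \<longleftrightarrow> (\<forall>i\<in>I. smooth_aut A (U i \<inter> preim W) (\<lambda>p. s (snd e p) i) \<and>
     (\<forall>p\<in>U i \<inter> preim W. s (snd e p) i (y p) = x i p \<and>
       (\<forall>j\<in>I. p \<in> U j \<longrightarrow> (\<forall>t\<in>sym2 A p. h i j p (s (snd e p) i t) = s (snd e p) j t))))"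

lemma solutionI:
  assumes "\<And>i. i \<in> I \<Longrightarrow> smooth_aut A (U i \<inter> preim W) (\<lambda>p. s (snd e p) i)"
    and "\<And>i p. i \<in> I \<Longrightarrow> p \<in> U i \<Longrightarrow> p \<in> preim W \<Longrightarrow> s (snd e p) i (y p) = x i p"
    and "\<And>i j p t. i \<in> I \<Longrightarrow> j \<in> I \<Longrightarrow> p \<in> U i \<Longrightarrow> p \<in> U j \<Longrightarrow> p \<in> preim W \<Longrightarrow> t \<in> sym2 A p \<Longrightarrow>
      h i j p (s (snd e p) i t) = s (snd e p) j t"
  shows "solution W s"
  unfolding solution_def using assms by simp

lemma solutionD:
  assumes "solution W s"
  shows "i \<in> I \<Longrightarrow> smooth_aut A (U i \<inter> preim W) (\<lambda>p. s (snd e p) i)"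
    and "i \<in> I \<Longrightarrow> p \<in> U i \<Longrightarrow> p \<in> preim W \<Longrightarrow> s (snd e p) i (y p) = x i p"
    and "i \<in> I \<Longrightarrow> j \<in> I \<Longrightarrow> p \<in> U i \<Longrightarrow> p \<in> U j \<Longrightarrow> p \<in> preim W \<Longrightarrow> t \<in> sym2 A p \<Longrightarrow>
      h i j p (s (snd e p) i t) = s (snd e p) j t"
  using assms unfolding solution_def by simp_all

lemma open_preim: "open W \<Longrightarrow> open (preim W)"
  by (rule ext.open_chart_vimage[OF insertI1])

lemma U_subset: "i \<in> I \<Longrightarrow> U i \<subseteq> fst e"
  using cover by blast

lemma inv_snd: "p \<in> fst e \<Longrightarrow> chart_inv e (snd e p) = p"
  by (rule ext.chart_inv_chart[OF insertI1])

lemma chart_inv_in: "chart_inv e z \<in> fst e" and snd_inv: "snd e (chart_inv e z) = z"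
proof -
  have "z \<in> snd e ` fst e" using onto by blast
  then show "chart_inv e z \<in> fst e" "snd e (chart_inv e z) = z" using inv_snd by auto
qed

lemma y_sym2: "p \<in> fst e \<Longrightarrow> y p \<in> sym2 A p"
  by (rule form_of_sym2[OF D(1)])

lemma solution_sheaf:
  assumes "\<And>z. z \<in> S \<Longrightarrow> \<exists>W s'. open W \<and> z \<in> W \<and> solution W s' \<and> (\<forall>w\<in>W. s w = s' w)"
  shows "solution S s"
proof (rule solutionI)
  fix i assume i: "i \<in> I"
  show "smooth_aut A (U i \<inter> preim S) (\<lambda>p. s (snd e p) i)"
  proof (rule smooth_aut_local)
    fix p assume p: "p \<in> U i \<inter> preim S"
    then have "snd e p \<in> S" by blast
    from assms[OF this] obtain W s' where W: "open W" "snd e p \<in> W" "solution W s'" "\<forall>w\<in>W. s w = s' w"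
      by (elim exE conjE)
    show "\<exists>W \<xi>. open W \<and> p \<in> W \<and> smooth_aut A W \<xi> \<and> (\<forall>q\<in>W. \<forall>t\<in>sym2 A q. s (snd e q) i t = \<xi> q t)"
    proof (intro exI conjI)
      show "open (U i \<inter> preim W)" using open_U[OF i] open_preim[OF W(1)] by (rule open_Int)
      show "smooth_aut A (U i \<inter> preim W) (\<lambda>p. s' (snd e p) i)" by (rule solutionD(1)[OF W(3) i])
    qed (use p W in auto)
  qed
next
  fix i p assume i: "i \<in> I" "p \<in> U i" "p \<in> preim S"
  then have "snd e p \<in> S" by blast
  from assms[OF this] obtain W s' where W: "open W" "snd e p \<in> W" "solution W s'" "\<forall>w\<in>W. s w = s' w"
    by (elim exE conjE)
  then show "s (snd e p) i (y p) = x i p" using solutionD(2)[OF W(3) i(1,2)] i(3) by simp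
next
  fix i j p t assume i: "i \<in> I" "j \<in> I" "p \<in> U i" "p \<in> U j" "p \<in> preim S" "t \<in> sym2 A p"
  then have "snd e p \<in> S" by blast
  from assms[OF this] obtain W s' where W: "open W" "snd e p \<in> W" "solution W s'" "\<forall>w\<in>W. s w = s' w"
    by (elim exE conjE)
  then show "h i j p (s (snd e p) i t) = s (snd e p) j t" using solutionD(3)[OF W(3) i(1-4)] i(5,6) by simp
qed

text \<open>Inside one member \<open>U i\<close> a shear carries \<open>y\<close> to
  \<open>x i\<close>; composing it with the gluing maps out of \<open>U i\<close> defines the
  components for the other indices, and the cocycle condition makes them compatible.\<close>

lemma solution_local: "\<exists>W s. open W \<and> z \<in> W \<and> solution W s"
proof -
  define p0 where "p0 = chart_inv e z"
  have p0: "p0 \<in> fst e" "snd e p0 = z" using chart_inv_in snd_inv by (auto simp: p0_def)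
  then obtain i where i: "i \<in> I" "p0 \<in> U i" using cover by blast
  have xs: "x i p \<in> sym2 A p" if "p \<in> U i" for p using x[OF i(1)] that unfolding smooth_section_def by blast
  have y_coord: "coord A e p (y p) = D" if "p \<in> fst e" for p by (rule coord_form_of[OF D(1) that])
  obtain m where m: "m \<bullet> D \<noteq> 0" "m \<bullet> coord A e p0 (x i p0) \<noteq> 0"
    using exists_nonorthogonal[OF D(2) x_nonzero[OF i]] by blast
  \<comment> \<open>The functional \<open>m\<close> is chosen at \<open>p0\<close>; by continuity it
    remains nonzero on \<open>x i\<close> near that point, while on \<open>y\<close> it has the
    constant value given by \<open>D\<close>.\<close>
  define W where "W = {p \<in> U i. m \<bullet> coord A e p (x i p) \<noteq> 0}"
  have "smooth_map A (U i) (\<lambda>p. coord A e p (x i p))"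
    using smooth_section_iff_coord[OF open_U[OF i(1)] U_subset[OF i(1)] xs] x[OF i(1)] by blast
  then have "continuous_on (U i) (\<lambda>p. m \<bullet> coord A e p (x i p))"
    using U_subset[OF i(1)] domain_subset open_U[OF i(1)]
    by (intro continuous_on_inner continuous_on_const smooth_map_continuous_on) auto
  then have "open (U i \<inter> (\<lambda>p. m \<bullet> coord A e p (x i p)) -` (- {0}))"
    by (rule continuous_open_preimage[OF _ open_U[OF i(1)]]) auto
  moreover have "U i \<inter> (\<lambda>p. m \<bullet> coord A e p (x i p)) -` (- {0}) = W" by (auto simp: W_def)
  ultimately have W: "open W" by simp
  have We: "W \<subseteq> fst e" and WU: "W \<subseteq> U i" using U_subset[OF i(1)] by (auto simp: W_def)
  have preim: "preim (snd e ` W) = W" using We inv_snd by (auto simp: image_iff) (metis subsetD)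
  have \<phi>: "smooth_aut A W (shear m y (x i))"
    by (rule shear_aut[OF W We smooth_section_form_of[OF W We D(1) smooth_map_const] smooth_section_subset[OF x[OF i(1)] WU]])
      (use We m y_coord in \<open>auto simp: W_def\<close>)
  define s where "s w j t = h i j (chart_inv e w) (shear m y (x i) (chart_inv e w) t)" for w j t
  have s: "s (snd e p) j t = h i j p (shear m y (x i) p t)" if "p \<in> W" for p j t
    using that We inv_snd by (auto simp: s_def)
  have "solution (snd e ` W) s"
  proof (rule solutionI, unfold preim)
    fix j assume j: "j \<in> I"
    have o: "open (U j \<inter> W)" using open_U[OF j] W by blast
    have "smooth_aut A (U j \<inter> W) (\<lambda>p t. h i j p (shear m y (x i) p t))"
      by (rule smooth_aut_comp[OF o smooth_aut_subset[OF h[OF i(1) j]] smooth_aut_subset[OF \<phi>]]) (use WU in auto)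
    then show "smooth_aut A (U j \<inter> W) (\<lambda>p. s (snd e p) j)"
      by (rule smooth_aut_cong[OF o]) (simp add: s)
    fix p assume p: "p \<in> U j" "p \<in> W"
    then have "shear m y (x i) p (y p) = x i p"
      using We m y_coord by (intro shear_apply) auto
    then show "s (snd e p) j (y p) = x j p"
      using p WU h_x[OF i(1) j] by (auto simp: s)
  next
    fix j k p t assume jk: "j \<in> I" "k \<in> I" "p \<in> U j" "p \<in> U k" "p \<in> W" "t \<in> sym2 A p"
    have "shear m y (x i) p t \<in> sym2 A p" by (rule smooth_aut_sym2[OF \<phi> jk(5,6)])
    then show "h j k p (s (snd e p) j t) = s (snd e p) k t"
      using cocycle[OF i(1) jk(1,2) _ jk(3,4)] jk(5) WU by (auto simp: s)
  qed
  moreover have "open (snd e ` W)"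
    using ext.open_chart_image[OF insertI1 W] We by (simp add: Int_absorb1)
  moreover have "z \<in> snd e ` W" using p0(2) i(2) m(2) by (auto simp: W_def intro!: image_eqI[of _ _ p0])
  ultimately show ?thesis by blast
qed

text \<open>Over the overlap, \<open>a\<close> is the inverse of the first trivialization composed
  with the second, an automorphism fixing \<open>y\<close>. Its pullback \<open>b\<close> exists
  over all of \<open>W1\<close>, still fixes \<open>y\<close>, and equals \<open>a\<close> at the
  fixed points of \<open>r\<close>; so the first trivialization composed with \<open>b\<close> is a
  solution that equals the second one there.\<close>

lemma solution_patch:
  assumes W: "open W1" "open W2" and s1: "solution W1 s1" and s2: "solution W2 s2"
    and r: "smooth_on UNIV r" "r ` W1 \<subseteq> W1 \<inter> W2"
  shows "\<exists>s. solution W1 s \<and> (\<forall>z\<in>W1 \<inter> W2. r z = z \<longrightarrow> s z = s2 z)"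
proof -
  let ?Y = "preim W1" and ?Z = "preim (W1 \<inter> W2)"
  note S1 = solutionD[OF s1] and S2 = solutionD[OF s2]
  have oY: "open ?Y" and oZ: "open ?Z" by (rule open_preim[OF W(1)], rule open_preim[OF open_Int[OF W]])
  define f1 where "f1 i p = s1 (snd e p) i" for i p
  define f2 where "f2 i p = s2 (snd e p) i" for i p
  have f1: "smooth_aut A (U i \<inter> ?Y) (f1 i)" if "i \<in> I" for i
    unfolding f1_def by (rule S1(1)[OF that])
  have f1Z: "smooth_aut A (U i \<inter> ?Z) (f1 i)" if "i \<in> I" for i
    by (rule smooth_aut_subset[OF f1[OF that]]) blast
  have f2Z: "smooth_aut A (U i \<inter> ?Z) (f2 i)" if "i \<in> I" for i
    unfolding f2_def by (rule smooth_aut_subset[OF S2(1)[OF that]]) blast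
  have oUZ: "open (U i \<inter> ?Z)" if "i \<in> I" for i using open_U[OF that] oZ by (rule open_Int)
  note inv1 = aut_inv[OF oUZ f1Z]
  define \<iota> where "\<iota> p = (SOME i. i \<in> I \<and> p \<in> U i)" for p
  have \<iota>: "\<iota> p \<in> I" "p \<in> U (\<iota> p)" if "p \<in> fst e" for p
  proof -
    have "\<exists>i. i \<in> I \<and> p \<in> U i" using that cover by blast
    then have "\<iota> p \<in> I \<and> p \<in> U (\<iota> p)" unfolding \<iota>_def by (rule someI_ex)
    then show "\<iota> p \<in> I" "p \<in> U (\<iota> p)" by blast+
  qed
  define a where "a p t = aut_inv A (f1 (\<iota> p)) p (f2 (\<iota> p) p t)" for p t
  \<comment> \<open>The gluing map from \<open>\<iota> p\<close> to \<open>i\<close> intertwines the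
    components of both solutions, hence the quotient does not depend on the index, and locally a
    fixed index can be used.\<close>
  have a_eq: "a p t = aut_inv A (f1 i) p (f2 i p t)" if i: "i \<in> I" "p \<in> U i" "p \<in> ?Z" "t \<in> sym2 A p" for i p t
  proof -
    have k: "\<iota> p \<in> I" "p \<in> U (\<iota> p)" using \<iota> i(3) by auto
    have pk: "p \<in> U (\<iota> p) \<inter> ?Z" and pi: "p \<in> U i \<inter> ?Z" using k i by auto
    have p12: "p \<in> preim W1" "p \<in> preim W2" using i(3) by auto
    have t2: "f2 (\<iota> p) p t \<in> sym2 A p" by (rule smooth_aut_sym2[OF f2Z[OF k(1)] pk i(4)])
    have u: "a p t \<in> sym2 A p" unfolding a_def by (rule smooth_endo_sym2[OF inv1(1)[OF k(1) k(1)] pk t2])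
    have "f1 (\<iota> p) p (a p t) = f2 (\<iota> p) p t" unfolding a_def by (rule inv1(2)[OF k(1) k(1) pk t2])
    then have "h (\<iota> p) i p (f1 (\<iota> p) p (a p t)) = h (\<iota> p) i p (f2 (\<iota> p) p t)" by simp
    then have "f1 i p (a p t) = f2 i p t"
      unfolding f1_def f2_def S1(3)[OF k(1) i(1) k(2) i(2) p12(1) u] S2(3)[OF k(1) i(1) k(2) i(2) p12(2) i(4)] .
    then show ?thesis using inv1(3)[OF i(1) i(1) pi u] by simp
  qed
  have a_sym2: "a p t \<in> sym2 A p" and f1_a: "f1 i p (a p t) = f2 i p t"
    if i: "i \<in> I" "p \<in> U i" "p \<in> ?Z" "t \<in> sym2 A p" for i p t
  proof -
    have pi: "p \<in> U i \<inter> ?Z" using i by blast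
    have t2: "f2 i p t \<in> sym2 A p" by (rule smooth_aut_sym2[OF f2Z[OF i(1)] pi i(4)])
    show "a p t \<in> sym2 A p" unfolding a_eq[OF i] by (rule smooth_endo_sym2[OF inv1(1)[OF i(1) i(1)] pi t2])
    show "f1 i p (a p t) = f2 i p t" unfolding a_eq[OF i] by (rule inv1(2)[OF i(1) i(1) pi t2])
  qed
  have a_aut: "smooth_aut A ?Z a"
  proof (rule smooth_aut_local)
    fix p assume p: "p \<in> ?Z"
    then obtain i where i: "i \<in> I" "p \<in> U i" using cover by blast
    have "smooth_aut A (U i \<inter> ?Z) (\<lambda>p t. aut_inv A (f1 i) p (f2 i p t))"
      by (rule smooth_aut_comp[OF oUZ[OF i(1)] smooth_aut_inv[OF oUZ[OF i(1)] f1Z[OF i(1)]] f2Z[OF i(1)]])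
    then show "\<exists>W \<xi>. open W \<and> p \<in> W \<and> smooth_aut A W \<xi> \<and> (\<forall>q\<in>W. \<forall>t\<in>sym2 A q. a q t = \<xi> q t)"
      using oUZ[OF i(1)] i p a_eq[OF i(1)]
      by (intro exI[of _ "U i \<inter> ?Z"] exI[of _ "\<lambda>p t. aut_inv A (f1 i) p (f2 i p t)"] conjI) auto
  qed
  have a_y: "a p (y p) = y p" if p: "p \<in> ?Z" for p
  proof -
    obtain i where i: "i \<in> I" "p \<in> U i" using p cover by blast
    have yp: "y p \<in> sym2 A p" by (rule y_sym2) (use p in blast)
    have "f2 i p (y p) = f1 i p (y p)"
      using S1(2)[OF i] S2(2)[OF i] p by (simp add: f1_def f2_def)
    then show ?thesis using a_eq[OF i p yp] inv1(3)[OF i(1) i(1) _ yp] i p by simp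
  qed
  \<comment> \<open>The lift of \<open>r\<close> to the disk; it exists everywhere because the
    coordinates of \<open>e\<close> fill the whole of \<real>^n.\<close>
  define \<rho> where "\<rho> p = chart_inv e (r (snd e p))" for p
  have \<rho>: "\<rho> p \<in> ?Z" "snd e (\<rho> p) = r (snd e p)" if "p \<in> ?Y" for p
    using that r(2) chart_inv_in snd_inv by (auto simp: \<rho>_def)
  define b where "b = pullback \<rho> a"
  have b: "smooth_aut A ?Y b"
    unfolding b_def by (rule pullback_aut[OF oY _ oZ _ _ r(1) _ a_aut]) (use \<rho> in auto)
  \<comment> \<open>Here the constancy of \<open>y\<close> in the frame of \<open>e\<close> is
    essential: the identification of the fibres at \<open>p\<close> and \<open>\<rho> p\<close>
    matches \<open>y p\<close> with \<open>y (\<rho> p)\<close>.\<close>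
  have b_y: "b p (y p) = y p" if p: "p \<in> ?Y" for p
    using p \<rho>[OF p] a_y[OF \<rho>(1)[OF p]] by (simp add: b_def pullback_def coord_form_of[OF D(1)])
  have b_fixed: "b p t = a p t" if p: "p \<in> ?Z" "r (snd e p) = snd e p" "t \<in> sym2 A p" for p t
  proof -
    have pe: "p \<in> fst e" using p(1) by blast
    have \<rho>p: "\<rho> p = p" unfolding \<rho>_def p(2) by (rule inv_snd[OF pe])
    have "a p t \<in> sym2 A p" by (rule smooth_aut_sym2[OF a_aut p(1,3)])
    then show ?thesis
      unfolding b_def pullback_def \<rho>p form_of_coord[OF p(3) pe] by (rule form_of_coord[OF _ pe])
  qed
  \<comment> \<open>The corrected first solution equals \<open>s2\<close> at fixed points only on
    symmetric forms, whereas the claim is equality of functions. The case distinction takes care of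
    the remaining arguments.\<close>
  define s where "s z i t = (if r z = z \<and> z \<in> W2 then s2 z i t else s1 z i (b (chart_inv e z) t))" for z i t
  have s: "s (snd e p) i t = f1 i p (b p t)" if p: "i \<in> I" "p \<in> U i" "p \<in> ?Y" "t \<in> sym2 A p" for i p t
  proof (cases "r (snd e p) = snd e p \<and> snd e p \<in> W2")
    case True
    then have "p \<in> ?Z" using p(3) by blast
    then have "f1 i p (b p t) = f2 i p t" using b_fixed f1_a p True by simp
    then show ?thesis using True by (simp add: s_def f2_def)
  next
    case False
    have "chart_inv e (snd e p) = p" by (rule inv_snd) (use p(3) in blast)
    then show ?thesis unfolding s_def f1_def if_not_P[OF False] by simp
  qed
  have "solution W1 s"
  proof (rule solutionI)
    fix i assume i: "i \<in> I"
    have o: "open (U i \<inter> ?Y)" using open_U[OF i] oY by (rule open_Int)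
    have "smooth_aut A (U i \<inter> ?Y) (\<lambda>p t. f1 i p (b p t))"
      by (rule smooth_aut_comp[OF o f1[OF i] smooth_aut_subset[OF b Int_lower2]])
    then show "smooth_aut A (U i \<inter> ?Y) (\<lambda>p. s (snd e p) i)"
      by (rule smooth_aut_cong[OF o]) (use s[OF i] in auto)
    fix p assume p: "p \<in> U i" "p \<in> ?Y"
    have "y p \<in> sym2 A p" by (rule y_sym2) (use p in blast)
    then show "s (snd e p) i (y p) = x i p"
      using s[OF i p] b_y[OF p(2)] S1(2)[OF i p] by (simp add: f1_def)
  next
    fix i j p t assume ij: "i \<in> I" "j \<in> I" "p \<in> U i" "p \<in> U j" "p \<in> ?Y" "t \<in> sym2 A p"
    have "b p t \<in> sym2 A p" by (rule smooth_aut_sym2[OF b ij(5,6)])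
    then show "h i j p (s (snd e p) i t) = s (snd e p) j t"
      unfolding s[OF ij(1,3,5,6)] s[OF ij(2,4,5,6)] f1_def by (rule S1(3)[OF ij(1-5)])
  qed
  moreover have "\<forall>z\<in>W1 \<inter> W2. r z = z \<longrightarrow> s z = s2 z" by (auto simp: s_def fun_eq_iff)
  ultimately show ?thesis by blast
qed

theorem descent_trivialization:
  "\<exists>f. \<forall>i\<in>I. smooth_aut A (U i) (f i) \<and> (\<forall>p\<in>U i. f i p (y p) = x i p) \<and>
    (\<forall>j\<in>I. \<forall>p\<in>U i \<inter> U j. \<forall>t\<in>sym2 A p. h i j p (f i p t) = f j p t)"
proof -
  interpret euclidean_patching solution
    by unfold_locales (rule solution_sheaf solution_local solution_patch; assumption)+
  obtain s where s: "solution UNIV s" using solution_UNIV by blast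
  have U: "U i \<inter> preim UNIV = U i" if "i \<in> I" for i using U_subset[OF that] by auto
  have pe: "p \<in> preim UNIV" if "i \<in> I" "p \<in> U i" for i p using U_subset that by auto
  show ?thesis
  proof (intro exI ballI conjI)
    fix i assume i: "i \<in> I"
    show "smooth_aut A (U i) (\<lambda>p. s (snd e p) i)" using solutionD(1)[OF s i] U[OF i] by simp
    show "s (snd e p) i (y p) = x i p" if "p \<in> U i" for p by (rule solutionD(2)[OF s i that pe[OF i that]])
    show "h i j p (s (snd e p) i t) = s (snd e p) j t" if "j \<in> I" "p \<in> U i \<inter> U j" "t \<in> sym2 A p" for j p t
      using solutionD(3)[OF s i that(1) _ _ _ that(3)] pe[OF i] that(2) by blast
  qed
qed

end

subsection \<open>The groupoids of Ricci-flat metrics\<close>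

lemma ricci_coord_cong:
  fixes G G' :: "real^'n::finite \<Rightarrow> real^'n^'n"
  assumes S: "open S" "x \<in> S" and G: "\<And>y. y \<in> S \<Longrightarrow> G y = G' y"
  shows "ricci_coord G x = ricci_coord G' x"
proof -
  have *: "christoffel G k i j y = christoffel G' k i j y" if y: "y \<in> S" for k i j y
  proof -
    have "partial l (\<lambda>y. G y $ a $ b) y = partial l (\<lambda>y. G' y $ a $ b) y" for l a b
      by (rule partial_cong[OF S(1) y]) (simp add: G)
    then show ?thesis unfolding christoffel_def by (simp add: G[OF y])
  qed
  have "partial l (christoffel G k i j) x = partial l (christoffel G' k i j) x" for l k i j
    by (rule partial_cong[OF S *])
  then show ?thesis unfolding ricci_coord_def by (simp add: *[OF S(2)])
qed

lemma lorentz_matrix_nonzero: "\<not> lorentz_matrix (0 :: real^'n::finite^'n)"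
proof
  assume "lorentz_matrix (0 :: real^'n^'n)"
  then obtain P :: "real^'n^'n" and k
    where P: "transpose P ** 0 ** P = (\<chi> i j. if i \<noteq> j then 0 else if i = k then -1 else 1)"
    unfolding lorentz_matrix_def by blast
  have "(transpose P ** 0 ** P) $ k $ k = - 1" unfolding P by simp
  then show False by (simp add: matrix_matrix_mult_def)
qed

lemma (in compatible_chart) coord_lorentzian_nonzero:
  assumes "g \<in> lorentzian_metrics A U" "p \<in> U" "p \<in> fst e"
  shows "coord A e p (g p) \<noteq> 0"
proof
  assume 0: "coord A e p (g p) = 0"
  obtain c where c: "c \<in> charts_at A p" using charts_at_domain[OF assms(3)] by blast
  have g: "g p \<in> sym2 A p" "lorentz_matrix (g p c)"
    using assms c unfolding lorentzian_metrics_def sections_def by (auto dest: PiE_mem)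
  have "g p c = form_of A e p 0 c" using form_of_coord[OF g(1) assms(3)] 0 by simp
  also have "\<dots> = 0" using c by (simp add: form_of_def matrix_matrix_mult_def vec_eq_iff)
  finally show False using g(2) by (simp add: lorentz_matrix_nonzero)
qed

context smooth_atlas
begin

lemma disks_open: "U \<in> disks M A \<Longrightarrow> open U" and disks_subset: "U \<in> disks M A \<Longrightarrow> U \<subseteq> M"
  by (simp_all add: disks_def)

text \<open>Ensures that (i, i) always belongs to \<open>overlaps\<close>, so that the identity is
  really recorded there as a gluing map.\<close>

lemma disks_nonempty: "U \<in> disks M A \<Longrightarrow> U \<noteq> {}"
  using disk_chart_exists[of U] disk_chart.onto by fastforce

lemma metric_section:
  assumes "open U" "g \<in> ricci_flat_metrics A U"
  shows "g \<in> extensional U" "smooth_section A U g" "p \<in> U \<Longrightarrow> g p \<in> sym2 A p"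
proof -
  have "g \<in> sections A U" using assms(2) by (simp add: ricci_flat_metrics_def lorentzian_metrics_def)
  then show "g \<in> extensional U" "smooth_section A U g" unfolding sections_iff[OF assms(1)] by blast+
  then show "p \<in> U \<Longrightarrow> g p \<in> sym2 A p" unfolding smooth_section_def by blast
qed

lemma restrict_metric:
  assumes UV: "open U" "open V" "U \<subseteq> V" and g: "g \<in> ricci_flat_metrics A V"
  shows "restrict g U \<in> ricci_flat_metrics A U"
proof -
  have "smooth_section A U (restrict g U)"
    by (rule smooth_section_cong[OF UV(1) smooth_section_subset[OF metric_section(2)[OF UV(2) g] UV(3)]]) simp
  then have "restrict g U \<in> lorentzian_metrics A U"
    using g UV(3) by (auto simp: lorentzian_metrics_def ricci_flat_metrics_def sections_iff[OF UV(1)])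
  moreover have "ricci_coord (\<lambda>x. restrict g U (chart_inv c x) c) (snd c p) = 0"
    if p: "p \<in> U" and c: "c \<in> charts_at A p" for p c
  proof -
    have cA: "c \<in> A" "p \<in> fst c" using c by (auto simp: charts_at_def)
    have "ricci_coord (\<lambda>x. restrict g U (chart_inv c x) c) (snd c p) = ricci_coord (\<lambda>x. g (chart_inv c x) c) (snd c p)"
      by (rule ricci_coord_cong[OF open_chart_image[OF cA(1) UV(1)]])
        (use p cA in \<open>auto simp: chart_inv_chart[OF cA(1)]\<close>)
    also have "\<dots> = ricci A V g p c" using p c UV(3) by (auto simp: ricci_def)
    also have "\<dots> = 0" using g p UV(3) by (auto simp: ricci_flat_metrics_def)
    finally show ?thesis .
  qed
  ultimately show ?thesis by (auto simp: ricci_flat_metrics_def ricci_def fun_eq_iff restrict_def)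
qed

lemma groupoid_simps:
  "Obj (ricci_flat_groupoid A U) = ricci_flat_metrics A U"
  "Cmp (ricci_flat_groupoid A U) = bundle_comp A U"
  "Idn (ricci_flat_groupoid A U) = (\<lambda>g. bundle_id A U)"
  by (simp_all add: ricci_flat_groupoid_def)

lemma psh_simps:
  "grpd_on (ricci_flat_psh A) = ricci_flat_groupoid A"
  "res_ob (ricci_flat_psh A) = (\<lambda>V U g. restrict g U)"
  "res_mor (ricci_flat_psh A) = (\<lambda>V U \<phi>. restrict \<phi> U)"
  by (simp_all add: ricci_flat_psh_def)

abbreviation "hom U \<equiv> Hom (ricci_flat_groupoid A U)"

text \<open>What is needed is an operator whose value at \<open>g\<close> is the difference of the
  two metrics; \<open>lie_algebra_transitive\<close> provides it because a Lorentzian metric has no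
  zeros.\<close>

lemma infinitesimal_condition:
  assumes U: "U \<in> disks M A" and g: "g \<in> ricci_flat_metrics A U" and g': "g' \<in> ricci_flat_metrics A U"
  shows "\<exists>\<Phi>\<in>lie_algebra_ops A U. g' = sec_add U g (\<Phi> g)"
proof -
  obtain f where "disk_chart M A (U, f)" using disk_chart_exists[OF U] by blast
  then interpret e: disk_chart M A "(U, f)" .
  note oU = disks_open[OF U]
  note G = metric_section[OF oU g] and G' = metric_section[OF oU g']
  have sec: "smooth_section A U (\<lambda>p c. 1 *\<^sub>R g' p c + (- 1) *\<^sub>R g p c)"
    unfolding smooth_section_def
  proof (intro conjI ballI)
    fix p assume p: "p \<in> U"
    show "(\<lambda>c. 1 *\<^sub>R g' p c + (- 1) *\<^sub>R g p c) \<in> sym2 A p" by (rule sym2_lincomb[OF G'(3)[OF p] G(3)[OF p]])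
  next
    fix c assume c: "c \<in> A"
    have "smooth_map A (fst c \<inter> U) (\<lambda>p. g p c)" "smooth_map A (fst c \<inter> U) (\<lambda>p. g' p c)"
      using G(2) G'(2) c unfolding smooth_section_def by simp_all
    then have "smooth_map A (fst c \<inter> U) (\<lambda>p. g' p c - g p c)"
      by (intro smooth_map_diff open_Int oU open_chart_domain[OF c])
    then show "smooth_map A (fst c \<inter> U) (\<lambda>p. 1 *\<^sub>R g' p c + (- 1) *\<^sub>R g p c)" by simp
  qed
  have nz: "coord A (U, f) p (g p) \<noteq> 0" if "p \<in> U" for p
    by (rule e.coord_lorentzian_nonzero[of g U]) (use g that in \<open>auto simp: ricci_flat_metrics_def\<close>)
  have "\<exists>\<Phi>\<in>lie_algebra_ops A U. \<forall>p\<in>U. \<Phi> g p = (\<lambda>c. 1 *\<^sub>R g' p c + (- 1) *\<^sub>R g p c)"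
    by (rule e.lie_algebra_transitive[unfolded fst_conv, OF G(2) nz sec])
  then obtain \<Phi> where \<Phi>: "\<Phi> \<in> lie_algebra_ops A U" "\<forall>p\<in>U. \<Phi> g p = (\<lambda>c. 1 *\<^sub>R g' p c + (- 1) *\<^sub>R g p c)"
    by (elim bexE)
  have "g' = sec_add U g (\<Phi> g)"
    by (rule extensionalityI[OF G'(1)]) (use \<Phi>(2) in \<open>auto simp: sec_add_def\<close>)
  then show ?thesis using \<Phi>(1) by blast
qed

lemma hom_iff:
  assumes U: "U \<in> disks M A" and g: "g \<in> ricci_flat_metrics A U" "g' \<in> ricci_flat_metrics A U"
  shows "\<phi> \<in> hom U g g' \<longleftrightarrow>
    \<phi> \<in> (\<Pi>\<^sub>E p\<in>U. sym2 A p \<rightarrow>\<^sub>E sym2 A p) \<and> smooth_aut A U \<phi> \<and> (\<forall>p\<in>U. \<phi> p (g p) = g' p)"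
proof -
  have "g' = act U g \<phi> \<longleftrightarrow> (\<forall>p\<in>U. \<phi> p (g p) = g' p)"
  proof
    assume "g' = act U g \<phi>"
    then show "\<forall>p\<in>U. \<phi> p (g p) = g' p" by (simp add: act_def)
  next
    assume "\<forall>p\<in>U. \<phi> p (g p) = g' p"
    then show "g' = act U g \<phi>"
      by (intro extensionalityI[OF metric_section(1)[OF disks_open[OF U] g(2)]]) (auto simp: act_def)
  qed
  then show ?thesis
    using infinitesimal_condition[OF assms]
    by (simp add: ricci_flat_groupoid_def bundle_auts_iff[OF disks_open[OF U] disks_subset[OF U]])
qed

lemma homI:
  assumes "U \<in> disks M A" "g \<in> ricci_flat_metrics A U" "g' \<in> ricci_flat_metrics A U"
    and "smooth_aut A U \<phi>" "\<And>p. p \<in> U \<Longrightarrow> \<phi> p (g p) = g' p"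
  shows "restrict_aut U \<phi> \<in> hom U g g'"
  unfolding hom_iff[OF assms(1-3)]
  using restrict_aut_bundle_auts[OF disks_open[OF assms(1)] disks_subset[OF assms(1)] assms(4)]
    metric_section(3)[OF disks_open[OF assms(1)] assms(2)] assms(5)
  by (simp add: bundle_auts_iff[OF disks_open[OF assms(1)] disks_subset[OF assms(1)]] restrict_aut_apply)

lemma homD:
  assumes "U \<in> disks M A" "g \<in> ricci_flat_metrics A U" "g' \<in> ricci_flat_metrics A U" "\<phi> \<in> hom U g g'"
  shows "\<phi> \<in> (\<Pi>\<^sub>E p\<in>U. sym2 A p \<rightarrow>\<^sub>E sym2 A p)" "smooth_aut A U \<phi>" "p \<in> U \<Longrightarrow> \<phi> p (g p) = g' p"
    "p \<in> U \<Longrightarrow> t \<in> sym2 A p \<Longrightarrow> \<phi> p t \<in> sym2 A p"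
  using assms(4) smooth_aut_sym2 unfolding hom_iff[OF assms(1-3)] by blast+

lemma hom_id:
  assumes "U \<in> disks M A" "g \<in> ricci_flat_metrics A U"
  shows "bundle_id A U \<in> hom U g g"
  using homI[OF assms(1,2,2) smooth_aut_id] by (simp add: restrict_aut_def bundle_id_def)

lemma hom_comp:
  assumes U: "U \<in> disks M A" and g: "g \<in> ricci_flat_metrics A U" "g' \<in> ricci_flat_metrics A U" "g'' \<in> ricci_flat_metrics A U"
    and \<phi>: "\<phi> \<in> hom U g g'" and \<psi>: "\<psi> \<in> hom U g' g''"
  shows "bundle_comp A U \<psi> \<phi> \<in> hom U g g''"
proof -
  note F = homD[OF U g(1,2) \<phi>] and G = homD[OF U g(2,3) \<psi>]
  have "restrict_aut U (\<lambda>p t. \<psi> p (\<phi> p t)) \<in> hom U g g''"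
    by (rule homI[OF U g(1,3) smooth_aut_comp[OF disks_open[OF U] G(2) F(2)]]) (simp add: F(3) G(3))
  then show ?thesis by (simp add: restrict_aut_def bundle_comp_def compose_def)
qed

text \<open>The operator that witnesses the infinitesimality condition over \<open>V\<close> is not
  restricted: through \<open>hom_iff\<close>, the disk \<open>U\<close> supplies a witness of its
  own. Composition and inversion of morphisms are treated in the same way.\<close>

lemma hom_restrict:
  assumes UV: "U \<in> disks M A" "V \<in> disks M A" "U \<subseteq> V"
    and g: "g \<in> ricci_flat_metrics A V" "g' \<in> ricci_flat_metrics A V" and \<phi>: "\<phi> \<in> hom V g g'"
  shows "restrict \<phi> U \<in> hom U (restrict g U) (restrict g' U)"
proof -
  note F = homD[OF UV(2) g \<phi>]
  have "smooth_aut A U (restrict \<phi> U)"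
    by (rule smooth_aut_cong[OF disks_open[OF UV(1)] smooth_aut_subset[OF F(2) UV(3)]]) simp
  moreover have "restrict \<phi> U \<in> (\<Pi>\<^sub>E p\<in>U. sym2 A p \<rightarrow>\<^sub>E sym2 A p)"
    using F(1) UV(3) by (auto simp: PiE_iff)
  ultimately show ?thesis
    unfolding hom_iff[OF UV(1) restrict_metric[OF disks_open[OF UV(1)] disks_open[OF UV(2)] UV(3) g(1)]
        restrict_metric[OF disks_open[OF UV(1)] disks_open[OF UV(2)] UV(3) g(2)]]
    using F(3) UV(3) by auto
qed

lemma groupoid_ricci_flat:
  assumes U: "U \<in> disks M A"
  shows "groupoid (ricci_flat_groupoid A U)"
  unfolding groupoid_def groupoid_simps
proof (intro conjI ballI)
  fix g assume g: "g \<in> ricci_flat_metrics A U"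
  show "bundle_id A U \<in> hom U g g" by (rule hom_id[OF U g])
  fix g' assume g': "g' \<in> ricci_flat_metrics A U"
  {
    fix \<phi> assume \<phi>: "\<phi> \<in> hom U g g'"
    note F = homD[OF U g g' \<phi>]
    show "bundle_comp A U \<phi> (bundle_id A U) = \<phi>" "bundle_comp A U (bundle_id A U) \<phi> = \<phi>"
      by (rule fibre_map_eqI[OF bundle_comp_PiE F(1)], simp add: bundle_comp_apply bundle_id_apply F(4))+
    let ?\<psi> = "restrict_aut U (aut_inv A \<phi>)"
    note inv = aut_inv[OF disks_open[OF U] F(2)]
    have "aut_inv A \<phi> p (g' p) = g p" if "p \<in> U" for p
      using inv(3)[OF that metric_section(3)[OF disks_open[OF U] g that]] F(3)[OF that] by simp
    then have "?\<psi> \<in> hom U g' g"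
      by (rule homI[OF U g' g smooth_aut_inv[OF disks_open[OF U] F(2)]])
    moreover have "bundle_comp A U ?\<psi> \<phi> = bundle_id A U" "bundle_comp A U \<phi> ?\<psi> = bundle_id A U"
      by (rule fibre_map_eqI[OF bundle_comp_PiE bundle_id_PiE],
          simp add: bundle_comp_apply bundle_id_apply restrict_aut_apply F(4) inv)+
    ultimately show "\<exists>\<psi>\<in>hom U g' g. bundle_comp A U \<psi> \<phi> = bundle_id A U \<and> bundle_comp A U \<phi> \<psi> = bundle_id A U"
      by blast
  }
  fix g'' assume g'': "g'' \<in> ricci_flat_metrics A U"
  {
    fix \<phi> \<psi> assume \<phi>: "\<phi> \<in> hom U g g'" "\<psi> \<in> hom U g' g''"
    show "bundle_comp A U \<psi> \<phi> \<in> hom U g g''" by (rule hom_comp[OF U g g' g'' \<phi>])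
  }
  fix k \<phi> \<psi> \<xi> assume k: "k \<in> ricci_flat_metrics A U" "\<phi> \<in> hom U g g'" "\<psi> \<in> hom U g' g''" "\<xi> \<in> hom U g'' k"
  show "bundle_comp A U \<xi> (bundle_comp A U \<psi> \<phi>) = bundle_comp A U (bundle_comp A U \<xi> \<psi>) \<phi>"
    by (rule fibre_map_eqI[OF bundle_comp_PiE bundle_comp_PiE])
      (simp add: bundle_comp_apply homD(4)[OF U g g' k(2)])
qed

lemma restrict_bundle_id: "U \<subseteq> V \<Longrightarrow> restrict (bundle_id A V) U = bundle_id A U"
  by (auto simp: bundle_id_def restrict_def fun_eq_iff)

lemma restrict_bundle_comp:
  "U \<subseteq> V \<Longrightarrow> restrict (bundle_comp A V \<psi> \<phi>) U = bundle_comp A U (restrict \<psi> U) (restrict \<phi> U)"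
  by (auto simp: bundle_comp_def restrict_def fun_eq_iff)

lemma functor_restrict:
  assumes UV: "U \<in> disks M A" "V \<in> disks M A" "U \<subseteq> V"
  shows "grpd_functor (ricci_flat_groupoid A V) (ricci_flat_groupoid A U) (\<lambda>g. restrict g U) (\<lambda>\<phi>. restrict \<phi> U)"
  unfolding grpd_functor_def groupoid_simps
  using hom_restrict[OF UV] restrict_metric[OF disks_open[OF UV(1)] disks_open[OF UV(2)] UV(3)]
    restrict_bundle_id[OF UV(3)] restrict_bundle_comp[OF UV(3)]
  by simp

lemma presheaf_ricci_flat: "presheaf_of_groupoids (disks M A) (ricci_flat_psh A)"
  unfolding presheaf_of_groupoids_def psh_simps groupoid_simps
proof (intro conjI ballI impI)
  fix U g assume U: "U \<in> disks M A" and g: "g \<in> ricci_flat_metrics A U"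
  show "restrict g U = g" by (rule extensional_restrict[OF metric_section(1)[OF disks_open[OF U] g]])
  fix g' \<phi> assume "g' \<in> ricci_flat_metrics A U" "\<phi> \<in> hom U g g'"
  then show "restrict \<phi> U = \<phi>"
    using homD(1)[OF U g] by (intro extensional_restrict) (auto simp: PiE_iff)
next
  fix W V U :: "'a set" and g :: "'a \<Rightarrow> ('a, 'n) form"
  assume "U \<subseteq> V \<and> V \<subseteq> W"
  then have "V \<inter> U = U" by blast
  then show "restrict (restrict g V) U = restrict g U" by simp
  fix \<phi> :: "'a \<Rightarrow> ('a, 'n) form \<Rightarrow> ('a, 'n) form"
  show "restrict (restrict \<phi> V) U = restrict \<phi> U" using \<open>V \<inter> U = U\<close> by simp
qed (use groupoid_ricci_flat functor_restrict in auto)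

end

subsection \<open>Descent\<close>

locale disk_cover = smooth_atlas M A
  for M :: "'a::{t2_space, second_countable_topology} set" and A :: "('a, 'n::finite) chart set" +
  fixes V :: "'a set" and I :: "'i set" and U :: "'i \<Rightarrow> 'a set"
  assumes V: "V \<in> disks M A" and good: "good_cover M A V I U"
begin

abbreviation "desc \<equiv> descent (ricci_flat_psh A) I U"

lemma U_disk: "i \<in> I \<Longrightarrow> U i \<in> disks M A" and cover: "(\<Union>i\<in>I. U i) = V"
  using good unfolding good_cover_def by blast+

lemma U_subset: "i \<in> I \<Longrightarrow> U i \<subseteq> V"
  using cover by blast

lemma inter_disk:
  assumes "F \<subseteq> I" "finite F" "F \<noteq> {}" "(\<Inter>i\<in>F. U i) \<noteq> {}"
  shows "(\<Inter>i\<in>F. U i) \<in> disks M A"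
proof -
  have "open (\<Inter>i\<in>F. U i)" using assms(1,2) disks_open[OF U_disk] by (intro open_INT) auto
  moreover have "(\<Inter>i\<in>F. U i) \<subseteq> M" using assms(1,3) disks_subset[OF U_disk] by blast
  moreover have "diffeomorphic_Rn A (\<Inter>i\<in>F. U i)" using good assms unfolding good_cover_def by blast
  ultimately show ?thesis by (simp add: disks_def)
qed

lemma double_disk: "i \<in> I \<Longrightarrow> j \<in> I \<Longrightarrow> U i \<inter> U j \<noteq> {} \<Longrightarrow> U i \<inter> U j \<in> disks M A"
  using inter_disk[of "{i, j}"] by simp

lemma descent_obj_iff:
  "(x, h) \<in> Obj desc \<longleftrightarrow>
    x \<in> extensional I \<and> (\<forall>i\<in>I. x i \<in> ricci_flat_metrics A (U i)) \<and> h \<in> extensional (overlaps I U) \<and>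
    (\<forall>i\<in>I. \<forall>j\<in>I. U i \<inter> U j \<noteq> {} \<longrightarrow>
      h (i, j) \<in> hom (U i \<inter> U j) (restrict (x i) (U i \<inter> U j)) (restrict (x j) (U i \<inter> U j))) \<and>
    (\<forall>i\<in>I. h (i, i) = bundle_id A (U i)) \<and>
    (\<forall>i\<in>I. \<forall>j\<in>I. \<forall>k\<in>I. U i \<inter> U j \<inter> U k \<noteq> {} \<longrightarrow>
      bundle_comp A (U i \<inter> U j \<inter> U k) (restrict (h (j, k)) (U i \<inter> U j \<inter> U k)) (restrict (h (i, j)) (U i \<inter> U j \<inter> U k))
        = restrict (h (i, k)) (U i \<inter> U j \<inter> U k))"
  by (auto simp: descent_def psh_simps groupoid_simps PiE_iff overlaps_def Let_def)

lemma descent_hom_iff: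
  "F \<in> Hom desc (x, h) (x', h') \<longleftrightarrow>
    F \<in> extensional I \<and> (\<forall>i\<in>I. F i \<in> hom (U i) (x i) (x' i)) \<and>
    (\<forall>i\<in>I. \<forall>j\<in>I. U i \<inter> U j \<noteq> {} \<longrightarrow>
      bundle_comp A (U i \<inter> U j) (h' (i, j)) (restrict (F i) (U i \<inter> U j)) =
      bundle_comp A (U i \<inter> U j) (restrict (F j) (U i \<inter> U j)) (h (i, j)))"
  by (auto simp: descent_def psh_simps groupoid_simps PiE_iff overlaps_def Let_def)

abbreviation "can_glue \<equiv> \<lambda>(i, j)\<in>overlaps I U. bundle_id A (U i \<inter> U j)"
abbreviation "can_ob \<equiv> canonical_ob (ricci_flat_psh A) V I U"
abbreviation "can_mor \<equiv> canonical_mor (ricci_flat_psh A) V I U"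

lemma can_ob_eq: "can_ob x = (\<lambda>i\<in>I. restrict x (U i), can_glue)"
  by (simp add: canonical_ob_def psh_simps groupoid_simps)

lemma can_mor_eq: "can_mor \<phi> = (\<lambda>i\<in>I. restrict \<phi> (U i))"
  by (simp add: canonical_mor_def psh_simps)

lemma metric_U: "i \<in> I \<Longrightarrow> g \<in> ricci_flat_metrics A V \<Longrightarrow> restrict g (U i) \<in> ricci_flat_metrics A (U i)"
  using restrict_metric[OF disks_open[OF U_disk] disks_open[OF V] U_subset] by blast

lemma can_ob_Obj:
  assumes x: "x \<in> ricci_flat_metrics A V"
  shows "can_ob x \<in> Obj desc"
  unfolding can_ob_eq descent_obj_iff
proof (intro conjI ballI impI)
  fix i j assume ij: "i \<in> I" "j \<in> I" "U i \<inter> U j \<noteq> {}"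
  have W: "U i \<inter> U j \<in> disks M A" by (rule double_disk[OF ij])
  have "restrict x (U i \<inter> U j) \<in> ricci_flat_metrics A (U i \<inter> U j)"
    by (rule restrict_metric[OF disks_open[OF W] disks_open[OF V] _ x]) (use U_subset[OF ij(1)] in blast)
  then have "bundle_id A (U i \<inter> U j) \<in> hom (U i \<inter> U j) (restrict x (U i \<inter> U j)) (restrict x (U i \<inter> U j))"
    by (rule hom_id[OF W])
  moreover have "U i \<inter> (U i \<inter> U j) = U i \<inter> U j" "U j \<inter> (U i \<inter> U j) = U i \<inter> U j" by blast+
  ultimately show "can_glue (i, j)
      \<in> hom (U i \<inter> U j) (restrict ((\<lambda>i\<in>I. restrict x (U i)) i) (U i \<inter> U j))
          (restrict ((\<lambda>i\<in>I. restrict x (U i)) j) (U i \<inter> U j))"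
    using ij by (simp add: overlaps_def)
next
  fix i assume i: "i \<in> I"
  then show "can_glue (i, i) = bundle_id A (U i)"
    using disks_nonempty[OF U_disk[OF i]] by (simp add: overlaps_def)
next
  fix i j k assume ijk: "i \<in> I" "j \<in> I" "k \<in> I" "U i \<inter> U j \<inter> U k \<noteq> {}"
  let ?W = "U i \<inter> U j \<inter> U k"
  have r: "restrict (bundle_id A (U i \<inter> U j)) ?W = bundle_id A ?W" "restrict (bundle_id A (U j \<inter> U k)) ?W = bundle_id A ?W"
    "restrict (bundle_id A (U i \<inter> U k)) ?W = bundle_id A ?W"
    by (rule restrict_bundle_id, blast)+
  have o: "(i, j) \<in> overlaps I U" "(j, k) \<in> overlaps I U" "(i, k) \<in> overlaps I U"
    using ijk by (auto simp: overlaps_def)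
  have "bundle_comp A ?W (bundle_id A ?W) (bundle_id A ?W) = bundle_id A ?W"
    by (rule fibre_map_eqI[OF bundle_comp_PiE bundle_id_PiE]) (simp add: bundle_comp_apply bundle_id_apply)
  then show "bundle_comp A ?W (restrict (can_glue (j, k)) ?W)
      (restrict (can_glue (i, j)) ?W) =
      restrict (can_glue (i, k)) ?W"
    using o r by simp
qed (auto simp: metric_U[OF _ x])

lemma can_functor: "grpd_functor (ricci_flat_groupoid A V) desc can_ob can_mor"
  unfolding grpd_functor_def groupoid_simps
proof (intro conjI ballI)
  fix x assume x: "x \<in> ricci_flat_metrics A V"
  show "can_ob x \<in> Obj desc" by (rule can_ob_Obj[OF x])
  show "can_mor (bundle_id A V) = Idn desc (can_ob x)"
    unfolding can_ob_eq can_mor_eq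
    by (rule ext) (simp add: descent_def psh_simps groupoid_simps restrict_bundle_id[OF U_subset])
  fix y assume y: "y \<in> ricci_flat_metrics A V"
  {
    fix \<phi> assume \<phi>: "\<phi> \<in> hom V x y"
    show "can_mor \<phi> \<in> Hom desc (can_ob x) (can_ob y)"
      unfolding can_ob_eq can_mor_eq descent_hom_iff
    proof (intro conjI ballI impI)
      fix i assume i: "i \<in> I"
      show "(\<lambda>i\<in>I. restrict \<phi> (U i)) i \<in> hom (U i) ((\<lambda>i\<in>I. restrict x (U i)) i) ((\<lambda>i\<in>I. restrict y (U i)) i)"
        using hom_restrict[OF U_disk[OF i] V U_subset[OF i] x y \<phi>] i by simp
      fix j assume j: "j \<in> I" "U i \<inter> U j \<noteq> {}"
      let ?W = "U i \<inter> U j"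
      have r: "restrict (restrict \<phi> (U i)) ?W = restrict \<phi> ?W" "restrict (restrict \<phi> (U j)) ?W = restrict \<phi> ?W"
        by (simp_all add: Int_left_absorb Int_left_commute[of "U j"])
      have W: "?W \<subseteq> V" using U_subset[OF i] by blast
      have "bundle_comp A ?W (bundle_id A ?W) (restrict \<phi> ?W) = bundle_comp A ?W (restrict \<phi> ?W) (bundle_id A ?W)"
        by (rule fibre_map_eqI[OF bundle_comp_PiE bundle_comp_PiE])
          (use W homD(4)[OF V x y \<phi>] in \<open>auto simp: bundle_comp_apply bundle_id_apply\<close>)
      then show "bundle_comp A ?W (can_glue (i, j)) (restrict ((\<lambda>i\<in>I. restrict \<phi> (U i)) i) ?W) =
          bundle_comp A ?W (restrict ((\<lambda>i\<in>I. restrict \<phi> (U i)) j) ?W) (can_glue (i, j))"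
        using i j r by (simp add: overlaps_def)
    qed simp
  }
  fix z \<phi> \<psi>
  show "can_mor (bundle_comp A V \<psi> \<phi>) = Cmp desc (can_mor \<psi>) (can_mor \<phi>)"
    unfolding can_mor_eq
    by (rule ext) (simp add: descent_def psh_simps groupoid_simps restrict_bundle_comp[OF U_subset])
qed

lemma can_mor_bij:
  assumes x: "x \<in> ricci_flat_metrics A V" and y: "y \<in> ricci_flat_metrics A V"
  shows "bij_betw can_mor (hom V x y) (Hom desc (can_ob x) (can_ob y))"
proof (rule bij_betwI')
  fix \<phi> \<psi> assume \<phi>: "\<phi> \<in> hom V x y" and \<psi>: "\<psi> \<in> hom V x y"
  show "can_mor \<phi> = can_mor \<psi> \<longleftrightarrow> \<phi> = \<psi>"
  proof
    assume eq: "can_mor \<phi> = can_mor \<psi>"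
    show "\<phi> = \<psi>"
    proof (rule fibre_map_eqI[OF homD(1)[OF V x y \<phi>] homD(1)[OF V x y \<psi>]])
      fix p t assume "p \<in> V"
      then obtain i where i: "i \<in> I" "p \<in> U i" using cover by blast
      have "can_mor \<phi> i p = can_mor \<psi> i p" using eq by simp
      then show "\<phi> p t = \<psi> p t" using i by (simp add: can_mor_eq)
    qed
  qed simp
next
  fix \<phi> assume "\<phi> \<in> hom V x y"
  then show "can_mor \<phi> \<in> Hom desc (can_ob x) (can_ob y)"
    using can_functor x y unfolding grpd_functor_def groupoid_simps by blast
next
  fix F assume F: "F \<in> Hom desc (can_ob x) (can_ob y)"
  have F_ext: "F \<in> extensional I"
    and F_hom: "\<And>i. i \<in> I \<Longrightarrow> F i \<in> hom (U i) (restrict x (U i)) (restrict y (U i))"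
    using F unfolding can_ob_eq descent_hom_iff by auto
  note FD = homD[OF U_disk metric_U[OF _ x] metric_U[OF _ y] F_hom]
  \<comment> \<open>Between canonical objects all gluing maps are identities, so the descent
    condition says that the components coincide on overlaps.\<close>
  have F_agree: "F i p = F j p" if ij: "i \<in> I" "j \<in> I" "p \<in> U i" "p \<in> U j" for i j p
  proof -
    let ?W = "U i \<inter> U j"
    have "bundle_comp A ?W (bundle_id A ?W) (restrict (F i) ?W) = bundle_comp A ?W (restrict (F j) ?W) (bundle_id A ?W)"
      using F ij unfolding can_ob_eq descent_hom_iff by (auto simp: overlaps_def)
    then have eq: "bundle_comp A ?W (bundle_id A ?W) (restrict (F i) ?W) p t = bundle_comp A ?W (restrict (F j) ?W) (bundle_id A ?W) p t" for t
      by simp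
    have "F i p t = F j p t" if "t \<in> sym2 A p" for t
      using eq[of t] that ij FD(4)[OF ij(1,1,1,1,3) that] by (simp add: bundle_comp_apply bundle_id_apply)
    moreover have "F i p \<in> extensional (sym2 A p)" "F j p \<in> extensional (sym2 A p)"
      using PiE_mem[OF FD(1)[OF ij(1,1,1,1)] ij(3)] PiE_mem[OF FD(1)[OF ij(2,2,2,2)] ij(4)] by (auto simp: PiE_iff)
    ultimately show ?thesis by (metis extensionalityI)
  qed
  define \<iota> where "\<iota> p = (SOME i. i \<in> I \<and> p \<in> U i)" for p
  have \<iota>: "\<iota> p \<in> I \<and> p \<in> U (\<iota> p)" if "p \<in> V" for p
    unfolding \<iota>_def by (rule someI_ex) (use that cover in blast)
  define \<phi> where "\<phi> = (\<lambda>p\<in>V. F (\<iota> p) p)"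
  have \<phi>: "\<phi> p = F i p" if "i \<in> I" "p \<in> U i" for i p
  proof -
    have p: "p \<in> V" using that U_subset by blast
    have "F (\<iota> p) p = F i p" by (rule F_agree[OF conjunct1[OF \<iota>[OF p]] that(1) conjunct2[OF \<iota>[OF p]] that(2)])
    then show ?thesis using p by (simp add: \<phi>_def)
  qed
  have "smooth_aut A V \<phi>"
  proof (rule smooth_aut_local)
    fix p assume "p \<in> V"
    then obtain i where i: "i \<in> I" "p \<in> U i" using cover by blast
    then show "\<exists>W \<xi>. open W \<and> p \<in> W \<and> smooth_aut A W \<xi> \<and> (\<forall>q\<in>W. \<forall>t\<in>sym2 A q. \<phi> q t = \<xi> q t)"
      using disks_open[OF U_disk[OF i(1)]] FD(2)[OF i(1,1,1,1)] \<phi>[OF i(1)]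
      by (intro exI[of _ "U i"] exI[of _ "F i"] conjI) auto
  qed
  moreover have "\<phi> \<in> (\<Pi>\<^sub>E p\<in>V. sym2 A p \<rightarrow>\<^sub>E sym2 A p)"
  proof (rule PiE_I)
    fix p assume "p \<in> V"
    then obtain i where i: "i \<in> I" "p \<in> U i" using cover by blast
    show "\<phi> p \<in> sym2 A p \<rightarrow>\<^sub>E sym2 A p"
      unfolding \<phi>[OF i] by (rule PiE_mem[OF FD(1)[OF i(1,1,1,1)] i(2)])
  qed (simp add: \<phi>_def)
  moreover have "\<phi> p (x p) = y p" if p: "p \<in> V" for p
  proof -
    obtain i where i: "i \<in> I" "p \<in> U i" using p cover by blast
    show ?thesis using FD(3)[OF i(1,1,1,1) i(2)] \<phi>[OF i] i by simp
  qed
  ultimately have "\<phi> \<in> hom V x y" by (simp add: hom_iff[OF V x y])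
  moreover have "F = can_mor \<phi>"
  proof (rule extensionalityI[OF F_ext])
    fix i assume i: "i \<in> I"
    have "F i \<in> extensional (U i)" using FD(1)[OF i i i i] by (simp add: PiE_iff)
    then have "F i = restrict \<phi> (U i)" by (rule extensionalityI) (use \<phi>[OF i] in auto)
    then show "F i = can_mor \<phi> i" using i by (simp add: can_mor_eq)
  qed (simp add: can_mor_eq)
  ultimately show "\<exists>\<phi>\<in>hom V x y. F = can_mor \<phi>" by blast
qed

text \<open>One and the same flat metric serves every descent datum; the datum only determines the
  isomorphism.\<close>

lemma can_essentially_surjective:
  assumes z: "z \<in> Obj desc"
  shows "\<exists>g\<in>ricci_flat_metrics A V. Hom desc (can_ob g) z \<noteq> {}"
proof -
  obtain x h where xh: "z = (x, h)" by (cases z)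
  have x: "\<And>i. i \<in> I \<Longrightarrow> x i \<in> ricci_flat_metrics A (U i)"
    and h: "\<And>i j. i \<in> I \<Longrightarrow> j \<in> I \<Longrightarrow> U i \<inter> U j \<noteq> {} \<Longrightarrow>
      h (i, j) \<in> hom (U i \<inter> U j) (restrict (x i) (U i \<inter> U j)) (restrict (x j) (U i \<inter> U j))"
    and coc: "\<And>i j k. i \<in> I \<Longrightarrow> j \<in> I \<Longrightarrow> k \<in> I \<Longrightarrow> U i \<inter> U j \<inter> U k \<noteq> {} \<Longrightarrow>
      bundle_comp A (U i \<inter> U j \<inter> U k) (restrict (h (j, k)) (U i \<inter> U j \<inter> U k)) (restrict (h (i, j)) (U i \<inter> U j \<inter> U k))
        = restrict (h (i, k)) (U i \<inter> U j \<inter> U k)"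
    using z unfolding xh descent_obj_iff by blast+
  have xr: "restrict (x i) (U i \<inter> U j) \<in> ricci_flat_metrics A (U i \<inter> U j)"
    "restrict (x i) (U j \<inter> U i) \<in> ricci_flat_metrics A (U j \<inter> U i)" if "i \<in> I" "j \<in> I" for i j
    using disks_open[OF U_disk[OF that(1)]] disks_open[OF U_disk[OF that(2)]]
    by (auto intro!: restrict_metric[OF _ _ _ x[OF that(1)]])
  note hD = homD[OF double_disk xr(1) xr(2) h]
  obtain f where "disk_chart M A (V, f)" using disk_chart_exists[OF V] by blast
  then interpret e: disk_chart M A "(V, f)" .
  interpret e: descent_data M A "(V, f)" I U x "\<lambda>i j. h (i, j)" minkowski
  proof unfold_locales
    fix i assume i: "i \<in> I"
    show "open (U i)" by (rule disks_open[OF U_disk[OF i]])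
    show "smooth_section A (U i) (x i)" by (rule metric_section(2)[OF disks_open[OF U_disk[OF i]] x[OF i]])
    show "coord A (V, f) p (x i p) \<noteq> 0" if "p \<in> U i" for p
      by (rule e.coord_lorentzian_nonzero[of "x i" "U i"])
        (use x[OF i] that U_subset[OF i] in \<open>auto simp: ricci_flat_metrics_def\<close>)
    fix j assume j: "j \<in> I"
    show "smooth_aut A (U i \<inter> U j) (h (i, j))"
    proof (cases "U i \<inter> U j = {}")
      \<comment> \<open>No gluing map is recorded on an empty overlap, and being an automorphism
        over the empty set is vacuous.\<close>
      case True
      show ?thesis unfolding True by (rule smooth_aut_local) simp
    next
      case False
      show ?thesis by (rule hD(2)[OF i j False i j j i i j False])
    qed
    show "h (i, j) p (x i p) = x j p" if "p \<in> U i" "p \<in> U j" for p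
    proof -
      have ne: "U i \<inter> U j \<noteq> {}" using that by blast
      show ?thesis using hD(3)[OF i j ne i j j i i j ne, of p] that by simp
    qed
    fix k p t assume k: "k \<in> I" "p \<in> U i" "p \<in> U j" "p \<in> U k" "t \<in> sym2 A p"
    let ?W = "U i \<inter> U j \<inter> U k"
    have ne: "?W \<noteq> {}" "U i \<inter> U j \<noteq> {}" using k by blast+
    have "bundle_comp A ?W (restrict (h (j, k)) ?W) (restrict (h (i, j)) ?W) p t = restrict (h (i, k)) ?W p t"
      using coc[OF i j k(1) ne(1)] by simp
    then show "h (j, k) p (h (i, j) p t) = h (i, k) p t"
      using k by (simp add: bundle_comp_apply)
  next
    show "(\<Union>i\<in>I. U i) = fst (V, f)" using cover by simp
    show "transpose minkowski = (minkowski :: real^'n^'n)" by (rule transpose_minkowski)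
    have "(minkowski :: real^'n^'n) $ (SOME k. True) $ (SOME k. True) = - 1" by (simp add: minkowski_def)
    then show "(minkowski :: real^'n^'n) \<noteq> 0" by (metis neg_equal_0_iff_equal one_neq_zero zero_index)
  qed
  let ?g = "e.flat_metric"
  have g: "?g \<in> ricci_flat_metrics A V" using e.flat_metric_ricci_flat by simp
  obtain \<phi> where \<phi>: "\<forall>i\<in>I. smooth_aut A (U i) (\<phi> i) \<and> (\<forall>p\<in>U i. \<phi> i p (form_of A (V, f) p minkowski) = x i p) \<and>
      (\<forall>j\<in>I. \<forall>p\<in>U i \<inter> U j. \<forall>t\<in>sym2 A p. h (i, j) p (\<phi> i p t) = \<phi> j p t)"
    using e.descent_trivialization by blast
  \<comment> \<open>Compatibility with \<open>h\<close> in the trivialization is precisely the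
    condition for a morphism out of an object whose gluing maps are identities.\<close>
  let ?F = "\<lambda>i\<in>I. restrict_aut (U i) (\<phi> i)"
  have "?F \<in> Hom desc (can_ob ?g) (x, h)"
    unfolding can_ob_eq descent_hom_iff
  proof (intro conjI ballI impI)
    fix i assume i: "i \<in> I"
    have "restrict_aut (U i) (\<phi> i) \<in> hom (U i) (restrict ?g (U i)) (x i)"
      by (rule homI[OF U_disk[OF i] metric_U[OF i g] x[OF i]])
        (use \<phi> i U_subset[OF i] in \<open>auto simp: e.flat_metric_apply\<close>)
    then show "?F i \<in> hom (U i) ((\<lambda>i\<in>I. restrict ?g (U i)) i) (x i)" using i by simp
    fix j assume j: "j \<in> I" "U i \<inter> U j \<noteq> {}"
    let ?W = "U i \<inter> U j"
    have "bundle_comp A ?W (h (i, j)) (restrict (?F i) ?W) = bundle_comp A ?W (restrict (?F j) ?W) (bundle_id A ?W)"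
      by (rule fibre_map_eqI[OF bundle_comp_PiE bundle_comp_PiE])
        (use \<phi> i j in \<open>simp add: bundle_comp_apply bundle_id_apply restrict_aut_apply\<close>)
    then show "bundle_comp A ?W (h (i, j)) (restrict (?F i) ?W) =
        bundle_comp A ?W (restrict (?F j) ?W) (can_glue (i, j))"
      using i j by (simp add: overlaps_def)
  qed simp
  then show ?thesis using g unfolding xh by blast
qed

theorem weak_equivalence_canonical: "weak_equivalence (ricci_flat_groupoid A V) desc can_ob can_mor"
  unfolding weak_equivalence_def groupoid_simps
  using can_functor can_mor_bij can_essentially_surjective by blast

end

theorem theorem1p1:
  fixes M :: "'a::{t2_space, second_countable_topology} set"
    and A :: "('a, 'n::finite) chart set"
    and gM :: "'a \<Rightarrow> ('a, 'n) form"
  assumes "smooth_manifold M A"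
    and "gM \<in> lorentzian_metrics A M"
  shows "stack (disks M A)
           (good_cover M A :: 'a set \<Rightarrow> 'i set \<Rightarrow> ('i \<Rightarrow> 'a set) \<Rightarrow> bool)
           (ricci_flat_psh A)"
proof -
  interpret smooth_atlas M A by unfold_locales (rule assms(1))
  have "weak_equivalence (ricci_flat_groupoid A V) (descent (ricci_flat_psh A) I U)
      (canonical_ob (ricci_flat_psh A) V I U) (canonical_mor (ricci_flat_psh A) V I U)"
    if "V \<in> disks M A" "good_cover M A V I U" for V and I :: "'i set" and U
  proof -
    interpret disk_cover M A V I U by unfold_locales (rule that)+
    show ?thesis by (rule weak_equivalence_canonical)
  qed
  then show ?thesis
    unfolding stack_def psh_simps(1) using presheaf_ricci_flat by blast
qed

end
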